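(* Let $1<p<\infty$ and let $a \in (C + H^\infty)(\mathbb{T})$. Then the Toeplitz operator $T(a) : H^p(\mathbb{T}) \to H^p(\mathbb{T})$ satisfies $$\|T(a)\|_m = \|a\|_{L^\infty} \quad\text{and}\quad \|T(a)\|_{\mathrm{e}} \le 2^{\left|1 - \frac{2}{p}\right|}\,\|a\|_{L^\infty}.$$
   Context: $\mathbb{T}=\{z\in\mathbb{C}:|z|=1\}$; $\widehat f(k)=\frac1{2\pi}\int_{-\pi}^{\pi} f(e^{i\theta})e^{-ik\theta}\,d\theta$, $k\in\mathbb{Z}$, are the Fourier coefficients of $f\in L^1(\mathbb{T})$. For $1\le p\le\infty$, $H^p(\mathbb{T})=\{f\in L^p(\mathbb{T}):\widehat f(k)=0\text{ for all }k<0\}$ with the $L^p(\mathbb{T})$ norm. The Riesz projection $P$ sends $f=\sum_{k\in\mathbb{Z}}\widehat f(k)e^{ik\theta}$ to $\sum_{k\ge0}\widehat f(k)e^{ik\theta}$; it is bounded from $L^p(\mathbb{T})$ to $H^p(\mathbb{T})$ for $1<p<\infty$. For $a\in L^\infty(\mathbb{T})$, the Toeplitz operator is $T(a)f:=P(af)$, $f \in H^p(\mathbb{T})$. $(C+H^\infty)(\mathbb{T})=\{f+g: f\in C(\mathbb{T}),\ g\in H^\infty(\mathbb{T})\}\subseteq L^\infty(\mathbb{T})$. For Banach spaces $X,Y$ and a bounded linear operator $A:X\to Y$: $\|A\|_{\mathrm{e}}:=\inf\{\|A-K\|: K:X\to Y\text{ compact linear}\}$ is the essential norm, and $\|A\|_m:=\inf\|A|_M\|$,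 where the infimum is over all closed linear subspaces $M\subseteq X$ with $\dim(X/M)<\infty$ and $A|_M$ is the restriction of $A$ to $M$. *)

theory Defs
  imports "HOL-Probability.Probability"
begin

text \<open>Normalised arc length measure on the unit circle.\<close>

definition circle :: "complex measure" where
  "circle = distr (uniform_measure lborel {-pi..pi}) (restrict_space borel (sphere 0 1)) cis"

lemma space_circle [simp]: "space circle = sphere 0 1"
  by (simp add: circle_def space_restrict_space)

lemma sets_circle [measurable_cong]: "sets circle = sets (restrict_space borel (sphere 0 1))"
  by (simp add: circle_def)

lemma cis_measurable_sphere [measurable]: "cis \<in> borel \<rightarrow>\<^sub>M restrict_space borel (sphere 0 1)"
  by (intro measurable_restrict_space2 borel_measurable_continuous_onI continuous_intros) auto

lemma AE_circle_imp:
  assumes "AE z in circle. Q z"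
  shows "AE t in lborel. t \<in> {-pi..pi} \<longrightarrow> Q (cis t)"
proof -
  have "cis \<in> uniform_measure lborel {-pi..pi} \<rightarrow>\<^sub>M restrict_space borel (sphere 0 1)"
    using cis_measurable_sphere by simp
  from AE_distrD[OF this assms[unfolded circle_def]]
  have "AE t in uniform_measure lborel {-pi..pi}. Q (cis t)" .
  thus ?thesis by (subst (asm) AE_uniform_measure) simp_all
qed

text \<open>The space of all measurable functions on the circle modulo equality almost everywhere;
  every \<open>L\<^sup>p\<close> is a subspace of it.  Values of a representative off the circle play no role,
  because the underlying set of \<^const>\<open>circle\<close> is the unit circle itself.\<close>

definition ae_eq :: "(complex \<Rightarrow> complex) \<Rightarrow> (complex \<Rightarrow> complex) \<Rightarrow> bool" where
  "ae_eq f g \<longleftrightarrow> f \<in> borel_measurable circle \<and> g \<in> borel_measurable circle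
     \<and> (AE z in circle. f z = g z)"

quotient_type L0 = "complex \<Rightarrow> complex" / partial: ae_eq
proof (rule part_equivpI)
  show "\<exists>f. ae_eq f f" by (rule exI[of _ "\<lambda>_. 0"]) (simp add: ae_eq_def)
  show "symp ae_eq" unfolding symp_def ae_eq_def by (auto elim: AE_mp)
  show "transp ae_eq" unfolding transp_def ae_eq_def by auto
qed

instantiation L0 :: comm_ring
begin

lift_definition zero_L0 :: L0 is "\<lambda>_. 0"
  by (simp add: ae_eq_def)

lift_definition plus_L0 :: "L0 \<Rightarrow> L0 \<Rightarrow> L0" is "\<lambda>f g z. f z + g z"
  by (auto simp: ae_eq_def)

lift_definition minus_L0 :: "L0 \<Rightarrow> L0 \<Rightarrow> L0" is "\<lambda>f g z. f z - g z"
  by (auto simp: ae_eq_def)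

lift_definition uminus_L0 :: "L0 \<Rightarrow> L0" is "\<lambda>f z. - f z"
  by (auto simp: ae_eq_def)

lift_definition times_L0 :: "L0 \<Rightarrow> L0 \<Rightarrow> L0" is "\<lambda>f g z. f z * g z"
  by (auto simp: ae_eq_def)

instance
  by standard (transfer; auto simp: ae_eq_def algebra_simps)+

end

lift_definition cscale :: "complex \<Rightarrow> L0 \<Rightarrow> L0" is "\<lambda>c f z. c * f z"
  by (auto simp: ae_eq_def)

global_interpretation L0: vector_space cscale
  by standard (transfer; auto simp: ae_eq_def algebra_simps)+

lift_definition fourier :: "L0 \<Rightarrow> int \<Rightarrow> complex" is
  "\<lambda>f k. (1 / (2 * pi)) * (LINT t:{-pi..pi}|lborel. f (cis t) * cis (- (of_int k * t)))"
proof -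
  fix f g assume *: "ae_eq f g"
  hence [measurable]: "f \<in> borel_measurable circle" "g \<in> borel_measurable circle"
    by (auto simp: ae_eq_def)
  have [measurable]: "(\<lambda>t::real. cis (- (of_int k * t))) \<in> borel_measurable lborel" for k
    by (simp, intro borel_measurable_continuous_onI continuous_intros)
  have [measurable]: "(\<lambda>t. f (cis t)) \<in> borel_measurable lborel"
       "(\<lambda>t. g (cis t)) \<in> borel_measurable lborel"
    by measurable
  have "AE t in lborel. t \<in> {-pi..pi} \<longrightarrow> f (cis t) = g (cis t)"
    using * by (intro AE_circle_imp) (simp add: ae_eq_def)
  hence "(LINT t:{-pi..pi}|lborel. f (cis t) * cis (- (of_int k * t)))
       = (LINT t:{-pi..pi}|lborel. g (cis t) * cis (- (of_int k * t)))" for k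
    unfolding set_lebesgue_integral_def
    by (intro integral_cong_AE) (auto simp: indicator_def)
  thus "(\<lambda>k. (1 / (2 * pi)) * (LINT t:{-pi..pi}|lborel. f (cis t) * cis (- (of_int k * t)))) =
        (\<lambda>k. (1 / (2 * pi)) * (LINT t:{-pi..pi}|lborel. g (cis t) * cis (- (of_int k * t))))"
    by presburger
qed

lemma ae_eq_esssup:
  "ae_eq f g \<Longrightarrow> esssup circle (\<lambda>z. ereal (cmod (f z))) = esssup circle (\<lambda>z. ereal (cmod (g z)))"
  by (intro esssup_AE_cong) (auto simp: ae_eq_def)

text \<open>Exponents are used in the range \<open>[1, \<infinity>]\<close> only.\<close>

lift_definition in_Lp :: "ennreal \<Rightarrow> L0 \<Rightarrow> bool" is
  "\<lambda>p f. if p = \<infinity> then esssup circle (\<lambda>z. ereal (cmod (f z))) < \<infinity>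
         else integrable circle (\<lambda>z. cmod (f z) powr enn2real p)"
proof -
  fix p :: ennreal and f g assume *: "ae_eq f g"
  hence [measurable]: "f \<in> borel_measurable circle" "g \<in> borel_measurable circle"
    by (auto simp: ae_eq_def)
  have "integrable circle (\<lambda>z. cmod (f z) powr enn2real p) =
        integrable circle (\<lambda>z. cmod (g z) powr enn2real p)"
    using * by (intro integrable_cong_AE) (auto simp: ae_eq_def)
  with ae_eq_esssup[OF *] show "?thesis p f g"
    by simp
qed

lift_definition Lp_norm :: "ennreal \<Rightarrow> L0 \<Rightarrow> real" is
  "\<lambda>p f. if p = \<infinity> then real_of_ereal (esssup circle (\<lambda>z. ereal (cmod (f z))))
         else (LINT z|circle. cmod (f z) powr enn2real p) powr (1 / enn2real p)"
proof -
  fix p :: ennreal and f g assume *: "ae_eq f g"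
  hence [measurable]: "f \<in> borel_measurable circle" "g \<in> borel_measurable circle"
    by (auto simp: ae_eq_def)
  have "(LINT z|circle. cmod (f z) powr enn2real p) =
        (LINT z|circle. cmod (g z) powr enn2real p)"
    using * by (intro integral_cong_AE) (auto simp: ae_eq_def)
  with ae_eq_esssup[OF *] show "?thesis p f g"
    by simp
qed

definition Lp :: "ennreal \<Rightarrow> L0 set" where
  "Lp p = {f. in_Lp p f}"

definition Hp :: "ennreal \<Rightarrow> L0 set" where
  "Hp p = {f \<in> Lp p. \<forall>k<0. fourier f k = 0}"

definition C_plus_Hinf :: "L0 set" where
  "C_plus_Hinf = {abs_L0 f + g | f g. continuous_on (sphere 0 1) f \<and> g \<in> Hp \<infinity>}"

text \<open>The description determines at most one element, since functions in \<open>L\<^sup>1\<close> are determined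
  by their Fourier coefficients; for \<open>f \<in> L\<^sup>p\<close> with \<open>1 < p < \<infinity>\<close> it exists and lies in \<open>H\<^sup>p\<close>
  by a theorem of M. Riesz.\<close>

definition riesz_projection :: "L0 \<Rightarrow> L0" where
  "riesz_projection f = (THE g. g \<in> Lp 1 \<and>
     (\<forall>k. fourier g k = (if k \<ge> 0 then fourier f k else 0)))"

definition toeplitz :: "L0 \<Rightarrow> L0 \<Rightarrow> L0" where
  "toeplitz a f = riesz_projection (a * f)"

text \<open>A normed space is given below by a subspace of \<^typ>\<open>L0\<close> together with a norm on it.
  Operator norms take values in \<open>[0, \<infinity>]\<close>, so no boundedness is presupposed.\<close>

abbreviation norm_topology :: "L0 set \<Rightarrow> (L0 \<Rightarrow> real) \<Rightarrow> L0 topology" where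
  "norm_topology X N \<equiv> Metric_space.mtopology X (\<lambda>f g. N (f - g))"

definition linear_map :: "L0 set \<Rightarrow> L0 set \<Rightarrow> (L0 \<Rightarrow> L0) \<Rightarrow> bool" where
  "linear_map X Y A \<longleftrightarrow> A \<in> X \<rightarrow> Y
     \<and> (\<forall>f\<in>X. \<forall>g\<in>X. A (f + g) = A f + A g)
     \<and> (\<forall>c. \<forall>f\<in>X. A (cscale c f) = cscale c (A f))"

definition op_norm :: "L0 set \<Rightarrow> (L0 \<Rightarrow> real) \<Rightarrow> (L0 \<Rightarrow> real) \<Rightarrow> (L0 \<Rightarrow> L0) \<Rightarrow> ennreal" where
  "op_norm X NX NY A = (SUP f\<in>{f\<in>X. NX f \<le> 1}. ennreal (NY (A f)))"

definition compact_operator ::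
  "L0 set \<Rightarrow> (L0 \<Rightarrow> real) \<Rightarrow> L0 set \<Rightarrow> (L0 \<Rightarrow> real) \<Rightarrow> (L0 \<Rightarrow> L0) \<Rightarrow> bool" where
  "compact_operator X NX Y NY K \<longleftrightarrow> linear_map X Y K \<and>
     compactin (norm_topology Y NY) (norm_topology Y NY closure_of (K ` {f\<in>X. NX f \<le> 1}))"

definition essential_norm ::
  "L0 set \<Rightarrow> (L0 \<Rightarrow> real) \<Rightarrow> L0 set \<Rightarrow> (L0 \<Rightarrow> real) \<Rightarrow> (L0 \<Rightarrow> L0) \<Rightarrow> ennreal" where
  "essential_norm X NX Y NY A =
     (INF K\<in>{K. compact_operator X NX Y NY K}. op_norm X NX NY (\<lambda>f. A f - K f))"

text \<open>\<open>dim (X / M) < \<infinity>\<close>: the quotient is spanned by the classes of finitely many vectors.\<close>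

definition finite_codim :: "L0 set \<Rightarrow> L0 set \<Rightarrow> bool" where
  "finite_codim X M \<longleftrightarrow> (\<exists>B. finite B \<and> B \<subseteq> X \<and> (\<forall>f\<in>X. \<exists>b\<in>L0.span B. f - b \<in> M))"

definition m_norm ::
  "L0 set \<Rightarrow> (L0 \<Rightarrow> real) \<Rightarrow> (L0 \<Rightarrow> real) \<Rightarrow> (L0 \<Rightarrow> L0) \<Rightarrow> ennreal" where
  "m_norm X NX NY A =
     (INF M\<in>{M. M \<subseteq> X \<and> L0.subspace M \<and> closedin (norm_topology X NX) M \<and> finite_codim X M}.
        op_norm M NX NY A)"

end

theory Submission
  imports Defs "HOL-Complex_Analysis.Conformal_Mappings"
begin

text \<open>
  If the Fourier coefficients of \<open>b \<in> L\<^sup>\<infinity>\<close> vanish below \<open>-N\<close> then \<open>T(b)\<close> is multiplication by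
  \<open>b\<close> on \<open>z\<^sup>N H\<^sup>p\<close>, and symbols in \<open>C + H\<^sup>\<infinity>\<close> are uniform limits of such \<open>b\<close>; so on \<open>z\<^sup>N H\<^sup>p\<close> with
  \<open>N\<close> large, \<open>T(a)\<close> is close to multiplication by \<open>a\<close>. As \<open>z\<^sup>N H\<^sup>p\<close> has finite codimension, this
  bounds \<open>\<parallel>T(a)\<parallel>\<^sub>m\<close> from above. For the lower bound, choose trigonometric polynomials close to the
  indicators of many disjoint pieces of the set where \<open>\<bar>a\<bar>\<close> almost attains its supremum and shift
  them into \<open>z\<^sup>N H\<^sup>p\<close>: a subspace of small codimension contains a nontrivial combination of them.
  For the essential norm take \<open>K = T(a) \<sigma>\<^sub>n\<close> with the Fejer mean \<open>\<sigma>\<^sub>n\<close>: up to a small error \<open>I - \<sigma>\<^sub>n\<close>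
  maps into \<open>z\<^sup>N H\<^sup>p\<close>, and \<open>\<parallel>I - \<sigma>\<^sub>n\<parallel> \<le> 2 powr \<bar>1 - 2/p\<bar>\<close> by Riesz--Thorin interpolation between
  the bound \<open>1\<close> on \<open>L\<^sup>2\<close> and the trivial bound \<open>2\<close>. Interpolation also reduces the boundedness of the
  Riesz projection to the exponents \<open>2\<^sup>n\<close>, where Cotlar's identity gives it by induction.
\<close>

section \<open>The spaces \<open>L\<^sup>p\<close> of complex functions\<close>

text \<open>Before the Riesz projection is known to be bounded it can be neither interpolated nor
  dualised. Interpolation and duality are therefore applied only to operators that add to
  \<open>l * f\<close> finitely many Fourier modes with real weights: the differences
  \<open>I - \<sigma>\<^sub>n\<close> and the analytic halves of the Fejer means. These are bounded
  on every \<open>L\<^sup>p\<close> for a crude reason, and only the constant has to be improved.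
  Real weights make them self-adjoint, so a bound for p is a bound for the conjugate exponent, and p
  \<ge> 2 suffices. A constant uniform in N for the analytic halves then produces the projection as
  a limit. The compact perturbation uses Fejer means and not partial sums because Fejer means are
  contractions on every \<open>L\<^sup>p\<close>; this is where the endpoint constant 2 comes from.
  They do not annihilate the low modes, but for fixed N the first N coefficients of
  \<open>f - \<sigma>\<^sub>n f\<close> tend to 0 uniformly on the unit ball, and this is the small
  error to be absorbed.\<close>

definition Lp_fun :: "real \<Rightarrow> 'a measure \<Rightarrow> ('a \<Rightarrow> complex) set" where
  "Lp_fun p M = {f \<in> borel_measurable M. integrable M (\<lambda>x. cmod (f x) powr p)}"

definition pnorm :: "real \<Rightarrow> 'a measure \<Rightarrow> ('a \<Rightarrow> complex) \<Rightarrow> real" where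
  "pnorm p M f = (LINT x|M. cmod (f x) powr p) powr (1 / p)"

lemma Lp_fun_measurable: "f \<in> Lp_fun p M \<Longrightarrow> f \<in> borel_measurable M"
  by (simp add: Lp_fun_def)

lemma Lp_fun_integrable: "f \<in> Lp_fun p M \<Longrightarrow> integrable M (\<lambda>x. cmod (f x) powr p)"
  by (simp add: Lp_fun_def)

lemma pnorm_nonneg [simp]: "0 \<le> pnorm p M f"
  by (simp add: pnorm_def)

lemma pnorm_powr:
  assumes "p > 0"
  shows "pnorm p M f powr p = (LINT x|M. cmod (f x) powr p)"
  using assms by (simp add: pnorm_def powr_powr)

lemma pnorm_le_iff:
  assumes "p > 0" "0 \<le> c"
  shows "pnorm p M f \<le> c \<longleftrightarrow> (LINT x|M. cmod (f x) powr p) \<le> c powr p"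
proof -
  have "pnorm p M f \<le> c \<longleftrightarrow> pnorm p M f powr p \<le> c powr p"
    using assms powr_mono2[of p "pnorm p M f" c] powr_less_mono2[of p c "pnorm p M f"]
    by (meson pnorm_nonneg not_le less_imp_le)
  thus ?thesis using assms by (simp add: pnorm_powr)
qed

lemma pnorm_zero [simp]: "pnorm p M (\<lambda>_. 0) = 0"
  by (simp add: pnorm_def)

lemma Lp_fun_zero [simp]: "(\<lambda>_. 0) \<in> Lp_fun p M"
  by (simp add: Lp_fun_def)

lemma Lp_fun_cmult: "f \<in> Lp_fun p M \<Longrightarrow> (\<lambda>x. c * f x) \<in> Lp_fun p M"
  by (auto simp: Lp_fun_def norm_mult powr_mult)

lemma pnorm_cmult:
  assumes "p > 0"
  shows "pnorm p M (\<lambda>x. c * f x) = cmod c * pnorm p M f"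
  using assms by (simp add: pnorm_def norm_mult powr_mult powr_powr)

lemma pnorm_uminus: "pnorm p M (\<lambda>x. - f x) = pnorm p M f"
  by (simp add: pnorm_def)

lemma pnorm_cnj: "pnorm p M (\<lambda>x. cnj (f x)) = pnorm p M f"
  by (simp add: pnorm_def)

lemma Lp_fun_uminus: "f \<in> Lp_fun p M \<Longrightarrow> (\<lambda>x. - f x) \<in> Lp_fun p M"
  by (auto simp: Lp_fun_def)

lemma Lp_fun_cnj: "f \<in> Lp_fun p M \<Longrightarrow> (\<lambda>x. cnj (f x)) \<in> Lp_fun p M"
  by (auto simp: Lp_fun_def intro: borel_measurable_continuous_on[OF continuous_on_cnj[OF continuous_on_id]])

lemma Lp_fun_mono:
  assumes "g \<in> Lp_fun p M" "f \<in> borel_measurable M" "AE x in M. cmod (f x) \<le> c * cmod (g x)"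
    and "p > 0" "c \<ge> 0"
  shows "f \<in> Lp_fun p M" "pnorm p M f \<le> c * pnorm p M g"
proof -
  note [measurable] = assms(2) Lp_fun_measurable[OF assms(1)]
  have int: "integrable M (\<lambda>x. (c * cmod (g x)) powr p)"
    using Lp_fun_integrable[OF assms(1)] assms by (simp add: powr_mult)
  have AE: "AE x in M. cmod (f x) powr p \<le> (c * cmod (g x)) powr p"
    using assms(3) by eventually_elim (use assms in \<open>auto intro!: powr_mono2\<close>)
  have int2: "integrable M (\<lambda>x. cmod (f x) powr p)"
    by (rule Bochner_Integration.integrable_bound[OF int]) (use AE in auto)
  thus "f \<in> Lp_fun p M" by (simp add: Lp_fun_def)
  have "(LINT x|M. cmod (f x) powr p) \<le> (LINT x|M. (c * cmod (g x)) powr p)"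
    by (intro integral_mono_AE int int2 AE)
  also have "\<dots> = (c * pnorm p M g) powr p"
    using assms by (simp add: powr_mult pnorm_powr)
  finally show "pnorm p M f \<le> c * pnorm p M g"
    using assms by (simp add: pnorm_le_iff)
qed

lemma pnorm_cong_AE:
  assumes "f \<in> borel_measurable M" "g \<in> borel_measurable M" "AE x in M. f x = g x"
  shows "pnorm p M f = pnorm p M g"
  unfolding pnorm_def using assms
  by (intro arg_cong[where f="\<lambda>u. u powr (1/p)"] integral_cong_AE) auto

lemma pnorm_eq_0_AE:
  assumes "f \<in> Lp_fun p M" "pnorm p M f = 0" "p > 0"
  shows "AE x in M. f x = 0"
proof -
  have "(LINT x|M. cmod (f x) powr p) = 0"
    using pnorm_powr[OF assms(3), of M f] assms by simp
  hence "AE x in M. cmod (f x) powr p = 0"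
    using Lp_fun_integrable[OF assms(1)] by (subst (asm) integral_nonneg_eq_0_iff_AE) auto
  thus ?thesis by eventually_elim simp
qed

lemma convex_powr_nonneg:
  fixes u v :: real
  assumes "p \<ge> 1" "u \<ge> 0" "v \<ge> 0" "s \<ge> 0" "t \<ge> 0" "s + t = 1"
  shows "(s * u + t * v) powr p \<le> s * u powr p + t * v powr p"
proof -
  \<comment> \<open>If one argument vanishes, the claim reduces to s powr p \<le> s for a weight s
    in [0, 1].\<close>
  have *: "r powr p \<le> r" if "r \<ge> 0" "r \<le> 1" for r :: real
    using powr_mono'[of 1 p r] that assms by (cases "r = 0") auto
  show ?thesis
  proof (cases "u = 0 \<or> v = 0")
    case True
    thus ?thesis using *[of s] *[of t] assms by (auto simp: powr_mult intro!: mult_right_mono)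
  next
    case False
    have "s = 1 - t" using assms by simp
    show ?thesis using convex_onD[OF powr_convex[OF assms(1)], of t u v] False assms
      unfolding \<open>s = 1 - t\<close> by simp
  qed
qed

text \<open>Minkowski's inequality from convexity: f + g is a + b times a convex combination of f/a
  and g/b. The numbers a and b lie strictly above the two norms and tend to them only at the end, so
  that vanishing norms need no separate treatment.\<close>

lemma pnorm_triangle:
  assumes "p \<ge> 1" and f: "f \<in> Lp_fun p M" and g: "g \<in> Lp_fun p M"
  shows "(\<lambda>x. f x + g x) \<in> Lp_fun p M" "pnorm p M (\<lambda>x. f x + g x) \<le> pnorm p M f + pnorm p M g"
proof -
  note [measurable] = Lp_fun_measurable[OF f] Lp_fun_measurable[OF g]
  note int = Lp_fun_integrable[OF f] Lp_fun_integrable[OF g]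
  have point: "cmod (f x + g x) powr p \<le>
     (a + b) powr p * (a / (a + b) * (cmod (f x) / a) powr p + b / (a + b) * (cmod (g x) / b) powr p)"
    if "a > 0" "b > 0" for a b x
  proof -
    have "cmod (f x + g x) powr p \<le> (cmod (f x) + cmod (g x)) powr p"
      using assms by (intro powr_mono2 norm_triangle_ineq) auto
    also have "cmod (f x) + cmod (g x) = (a + b) * (a / (a+b) * (cmod (f x) / a) + b / (a+b) * (cmod (g x) / b))"
      using that by (simp add: distrib_left)
    also have "\<dots> powr p = (a + b) powr p * (a / (a+b) * (cmod (f x) / a) + b / (a+b) * (cmod (g x) / b)) powr p"
      using that by (intro powr_mult)
    also have "\<dots> \<le> (a + b) powr p * (a / (a+b) * (cmod (f x) / a) powr p + b / (a+b) * (cmod (g x) / b) powr p)"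
      using that assms
      by (intro mult_left_mono convex_powr_nonneg) (auto simp flip: add_divide_distrib)
    finally show ?thesis .
  qed
  have I: "integrable M (\<lambda>x. (a + b) powr p * (a / (a + b) * (cmod (f x) / a) powr p + b / (a + b) * (cmod (g x) / b) powr p))"
    if "a > 0" "b > 0" for a b
    using that int by (auto simp: powr_divide)
  have J: "integrable M (\<lambda>x. cmod (f x + g x) powr p)"
    by (rule Bochner_Integration.integrable_bound[OF I[of 1 1]]) (use point[of 1 1] in auto)
  thus "(\<lambda>x. f x + g x) \<in> Lp_fun p M" by (simp add: Lp_fun_def)
  have main: "pnorm p M (\<lambda>x. f x + g x) \<le> a + b" if "pnorm p M f < a" "pnorm p M g < b" for a b
  proof -
    have ab: "a > 0" "b > 0" using that by (smt (verit) pnorm_nonneg)+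
    have le: "(LINT x|M. cmod (h x) powr p) \<le> c powr p" if "pnorm p M h < c" for c and h :: "'a \<Rightarrow> complex"
      using that pnorm_le_iff[of p c M h] assms(1) pnorm_nonneg[of p M h] by linarith
    have "(LINT x|M. cmod (f x + g x) powr p) \<le> (LINT x|M. (a + b) powr p * (a / (a + b) * (cmod (f x) / a) powr p + b / (a + b) * (cmod (g x) / b) powr p))"
      by (intro integral_mono I J point ab)
    also have "\<dots> = (a + b) powr p * (a / (a + b) * ((LINT x|M. cmod (f x) powr p) / a powr p) + b / (a + b) * ((LINT x|M. cmod (g x) powr p) / b powr p))"
      using int ab by (simp add: powr_divide)
    also have "\<dots> \<le> (a + b) powr p * (a / (a + b) * 1 + b / (a + b) * 1)"
      using le[OF that(1)] le[OF that(2)] ab by (intro mult_left_mono add_mono) (auto simp: field_simps)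
    also have "\<dots> = (a + b) powr p" using ab by (simp flip: add_divide_distrib)
    finally show ?thesis using ab assms(1) by (simp add: pnorm_le_iff)
  qed
  show "pnorm p M (\<lambda>x. f x + g x) \<le> pnorm p M f + pnorm p M g"
  proof (rule field_le_epsilon)
    fix e :: real assume "e > 0"
    thus "pnorm p M (\<lambda>x. f x + g x) \<le> pnorm p M f + pnorm p M g + e"
      using main[of "pnorm p M f + e/2" "pnorm p M g + e/2"] by simp
  qed
qed

lemma pnorm_triangle_diff:
  assumes "p \<ge> 1" and f: "f \<in> Lp_fun p M" and g: "g \<in> Lp_fun p M"
  shows "(\<lambda>x. f x - g x) \<in> Lp_fun p M" "pnorm p M (\<lambda>x. f x - g x) \<le> pnorm p M f + pnorm p M g"
  using pnorm_triangle[OF assms(1) f Lp_fun_uminus[OF g]] by (simp_all add: pnorm_uminus)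

lemma pnorm_sum:
  assumes "p \<ge> 1" "finite I" "\<And>i. i \<in> I \<Longrightarrow> f i \<in> Lp_fun p M"
  shows "(\<lambda>x. \<Sum>i\<in>I. f i x) \<in> Lp_fun p M \<and> pnorm p M (\<lambda>x. \<Sum>i\<in>I. f i x) \<le> (\<Sum>i\<in>I. pnorm p M (f i))"
  using assms(2,3)
proof (induction I rule: finite_induct)
  case (insert i I)
  thus ?case using pnorm_triangle[OF assms(1), of "f i" M "\<lambda>x. \<Sum>i\<in>I. f i x"] by auto
qed simp

section \<open>Hoelder's inequality and its consequences on a probability space\<close>

lemma conj_exponent_gt_1:
  fixes p q :: real
  assumes "p > 1" "1 / p + 1 / q = 1"
  shows "q > 1"
proof -
  have "1 / q = 1 - 1 / p" "0 < 1 / p" "1 / p < 1" using assms by auto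
  hence "0 < 1 / q" "1 / q < 1" by auto
  thus ?thesis by (simp add: divide_less_eq split: if_splits)
qed

text \<open>Young's inequality for |f|/a and |g|/b, integrated. As in Minkowski's inequality, a and
  b exceed the norms and then decrease to them.\<close>

lemma Lp_Holder:
  assumes "p > 1" "1 / p + 1 / q = 1" and f: "f \<in> Lp_fun p M" and g: "g \<in> Lp_fun q M"
  shows "integrable M (\<lambda>x. f x * g x)" "cmod (LINT x|M. f x * g x) \<le> pnorm p M f * pnorm q M g"
proof -
  have q: "q > 1" by (rule conj_exponent_gt_1[OF assms(1,2)])
  note [measurable] = Lp_fun_measurable[OF f] Lp_fun_measurable[OF g]
  note int = Lp_fun_integrable[OF f] Lp_fun_integrable[OF g]
  have point: "cmod (f x * g x) \<le> a * b * ((cmod (f x) / a) powr p / p + (cmod (g x) / b) powr q / q)"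
    if "a > 0" "b > 0" for a b x
  proof -
    have "cmod (f x * g x) = a * b * ((cmod (f x) / a) * (cmod (g x) / b))"
      using that by (simp add: norm_mult)
    also have "\<dots> \<le> a * b * ((cmod (f x) / a) powr p / p + (cmod (g x) / b) powr q / q)"
      using that assms q by (intro mult_left_mono Youngs_inequality) auto
    finally show ?thesis .
  qed
  have I: "integrable M (\<lambda>x. a * b * ((cmod (f x) / a) powr p / p + (cmod (g x) / b) powr q / q))"
    if "a > 0" "b > 0" for a b
    using that int by (auto simp: powr_divide)
  show J: "integrable M (\<lambda>x. f x * g x)"
    by (rule Bochner_Integration.integrable_bound[OF I[of 1 1]])
       (use point[of 1 1] in \<open>auto intro!: order.trans[OF _ abs_ge_self]\<close>)
  have le: "(LINT x|M. cmod (h x) powr s) \<le> c powr s" if "pnorm s M h < c" "s > 1" for c s and h :: "'a \<Rightarrow> complex"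
    using that pnorm_le_iff[of s c M h] pnorm_nonneg[of s M h] by linarith
  have main: "cmod (LINT x|M. f x * g x) \<le> a * b" if "pnorm p M f < a" "pnorm q M g < b" for a b
  proof -
    have ab: "a > 0" "b > 0" using that by (smt (verit) pnorm_nonneg)+
    have "cmod (LINT x|M. f x * g x) \<le> (LINT x|M. cmod (f x * g x))" by (rule integral_norm_bound)
    also have "\<dots> \<le> (LINT x|M. a * b * ((cmod (f x) / a) powr p / p + (cmod (g x) / b) powr q / q))"
      by (intro integral_mono I point ab integrable_norm J)
    also have "\<dots> = a * b * ((LINT x|M. cmod (f x) powr p) / a powr p / p + (LINT x|M. cmod (g x) powr q) / b powr q / q)"
      using int ab by (simp add: powr_divide)
    also have "\<dots> \<le> a * b * (1 / p + 1 / q)"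
      using le[OF that(1)] le[OF that(2)] ab q assms by (intro mult_left_mono add_mono divide_right_mono) (auto simp: field_simps)
    finally show ?thesis using assms by simp
  qed
  have "cmod (LINT x|M. f x * g x) \<le> (pnorm p M f + e) * (pnorm q M g + e)" if "e > 0" for e
    using main[of "pnorm p M f + e" "pnorm q M g + e"] that by simp
  hence "\<forall>\<^sub>F e in at_right 0. cmod (LINT x|M. f x * g x) \<le> (pnorm p M f + e) * (pnorm q M g + e)"
    by (auto simp: eventually_at_right_field intro!: exI[of _ 1])
  moreover have "((\<lambda>e. (pnorm p M f + e) * (pnorm q M g + e)) \<longlongrightarrow> (pnorm p M f + 0) * (pnorm q M g + 0)) (at_right 0)"
    by (intro tendsto_intros)
  ultimately have "cmod (LINT x|M. f x * g x) \<le> (pnorm p M f + 0) * (pnorm q M g + 0)"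
    by (intro tendsto_lowerbound[where F="at_right 0"]) auto
  thus "cmod (LINT x|M. f x * g x) \<le> pnorm p M f * pnorm q M g" by simp
qed

lemma bounded_Lp_fun:
  assumes "prob_space M" "f \<in> borel_measurable M" "AE x in M. cmod (f x) \<le> c" "p > 0" "c \<ge> 0"
  shows "f \<in> Lp_fun p M" "pnorm p M f \<le> c"
proof -
  interpret prob_space M by fact
  have 1: "(\<lambda>_. 1) \<in> Lp_fun p M" "pnorm p M (\<lambda>_. 1) = 1"
    using assms by (auto simp: Lp_fun_def pnorm_def prob_space)
  show "f \<in> Lp_fun p M" "pnorm p M f \<le> c"
    using Lp_fun_mono[OF 1(1) assms(2), of c] assms 1 by auto
qed

text \<open>Hoelder's inequality against the constant 1, whose norm is at most 1 on a probability
  space; p = 1, which has no finite conjugate exponent, is immediate.\<close>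

lemma Lp_fun_integrable1:
  assumes "prob_space M" "p \<ge> 1" "f \<in> Lp_fun p M"
  shows "integrable M f" "(LINT x|M. cmod (f x)) \<le> pnorm p M f"
proof -
  interpret prob_space M by fact
  have "integrable M f \<and> (LINT x|M. cmod (f x)) \<le> pnorm p M f"
  proof (cases "p = 1")
    case True
    thus ?thesis using assms(3) by (auto simp: Lp_fun_def pnorm_def integrable_norm_iff)
  next
    case False
    define q where "q = p / (p - 1)"
    have pq: "p > 1" "1 / p + 1 / q = 1" using False assms(2) by (auto simp: q_def field_simps)
    have q: "q > 0" using pq by (simp add: q_def)
    have 1: "(\<lambda>_. 1) \<in> Lp_fun q M" "pnorm q M (\<lambda>_. 1) \<le> 1"
      using bounded_Lp_fun[OF assms(1), of "\<lambda>_. 1" 1 q] q by auto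
    have F: "(\<lambda>x. complex_of_real (cmod (f x))) \<in> Lp_fun p M" "pnorm p M (\<lambda>x. complex_of_real (cmod (f x))) = pnorm p M f"
      using assms(3) by (auto simp: Lp_fun_def pnorm_def)
    have i: "integrable M f" using Lp_Holder(1)[OF pq assms(3) 1(1)] by simp
    have "cmod (LINT x|M. complex_of_real (cmod (f x))) \<le> pnorm p M f * pnorm q M (\<lambda>_. 1)"
      using Lp_Holder(2)[OF pq F(1) 1(1)] F(2) by simp
    also have "\<dots> \<le> pnorm p M f" using 1(2) by (simp add: mult_left_le)
    also have "cmod (LINT x|M. complex_of_real (cmod (f x))) = (LINT x|M. cmod (f x))"
      unfolding integral_complex_of_real by simp
    finally show ?thesis using i by simp
  qed
  thus "integrable M f" "(LINT x|M. cmod (f x)) \<le> pnorm p M f" by auto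
qed

section \<open>Dominated convergence, density of simple functions and completeness\<close>

lemma Lp_dominated_convergence:
  assumes "p > 0" "g \<in> Lp_fun p M" "\<And>n. f n \<in> borel_measurable M" "h \<in> borel_measurable M"
    and lim: "AE x in M. (\<lambda>n. f n x) \<longlonglongrightarrow> h x"
    and dom: "\<And>n. AE x in M. cmod (f n x - h x) \<le> cmod (g x)"
  shows "(\<lambda>n. pnorm p M (\<lambda>x. f n x - h x)) \<longlonglongrightarrow> 0"
proof -
  note [measurable] = assms(3,4)
  have "(\<lambda>n. LINT x|M. cmod (f n x - h x) powr p) \<longlonglongrightarrow> (LINT x|M. 0)"
  proof (rule integral_dominated_convergence)
    show "integrable M (\<lambda>x. cmod (g x) powr p)" by (rule Lp_fun_integrable[OF assms(2)])
    show "AE x in M. (\<lambda>n. cmod (f n x - h x) powr p) \<longlonglongrightarrow> 0"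
      using lim
    proof eventually_elim
      case (elim x)
      have "(\<lambda>n. cmod (f n x - h x)) \<longlonglongrightarrow> 0" using elim by (simp add: LIM_zero tendsto_norm_zero)
      hence "(\<lambda>n. cmod (f n x - h x) powr p) \<longlonglongrightarrow> 0 powr p"
        using assms(1) by (intro tendsto_powr') auto
      thus ?case by simp
    qed
    show "AE x in M. norm (cmod (f n x - h x) powr p) \<le> cmod (g x) powr p" for n
      using dom[of n] by eventually_elim (use assms(1) in \<open>auto intro: powr_mono2\<close>)
  qed auto
  hence "(\<lambda>n. (LINT x|M. cmod (f n x - h x) powr p) powr (1/p)) \<longlonglongrightarrow> 0 powr (1/p)"
    using assms(1) by (intro tendsto_powr') auto
  thus ?thesis by (simp add: pnorm_def)
qed

lemma simple_dense_Lp: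
  assumes "p > 0" and f: "f \<in> Lp_fun p M"
  obtains s where "\<And>n. simple_function M (s n)" "\<And>n. s n \<in> Lp_fun p M"
    "(\<lambda>n. pnorm p M (\<lambda>x. s n x - f x)) \<longlonglongrightarrow> 0"
proof -
  note fm = Lp_fun_measurable[OF f]
  obtain s where s: "\<And>n. simple_function M (s n)" "\<And>x. x \<in> space M \<Longrightarrow> (\<lambda>n. s n x) \<longlonglongrightarrow> f x"
     "\<And>n x. x \<in> space M \<Longrightarrow> cmod (s n x) \<le> 2 * cmod (f x)"
    using borel_measurable_implies_sequence_metric[OF fm, of 0] unfolding dist_0_norm dist_norm diff_0_right by metis
  note sm = borel_measurable_simple_function[OF s(1)]
  have "s n \<in> Lp_fun p M" for n
    using Lp_fun_mono(1)[OF f sm, of n 2] s(3) assms(1) by auto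
  moreover have "(\<lambda>n. pnorm p M (\<lambda>x. s n x - f x)) \<longlonglongrightarrow> 0"
  \<comment> \<open>3 = 2 + 1: \<open>s n\<close> is bounded by 2|f|, hence its distance to f by
    3|f|.\<close>
  proof (rule Lp_dominated_convergence[OF assms(1) Lp_fun_cmult[OF f, of 3] sm fm])
    show "AE x in M. (\<lambda>n. s n x) \<longlonglongrightarrow> f x" using s(2) by auto
    show "AE x in M. cmod (s n x - f x) \<le> cmod (3 * f x)" for n
    proof (rule AE_I2)
      fix x assume "x \<in> space M"
      hence "cmod (s n x - f x) \<le> 2 * cmod (f x) + cmod (f x)"
        using s(3)[of x n] norm_triangle_ineq4[of "s n x" "f x"] by linarith
      thus "cmod (s n x - f x) \<le> cmod (3 * f x)" by (simp add: norm_mult)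
    qed
  qed
  ultimately show ?thesis using s(1) that by blast
qed


text \<open>Riesz--Fischer: along a subsequence with increments below \<open>(1/2)^k\<close> the
  increments are absolutely summable almost everywhere, which defines the limit g; Fatou's lemma
  then gives convergence of the whole sequence in norm.\<close>

lemma Lp_complete:
  assumes "p \<ge> 1" and f: "\<And>n. f n \<in> Lp_fun p M"
    and Cauchy: "\<And>e. e > 0 \<Longrightarrow> \<exists>N. \<forall>m\<ge>N. \<forall>n\<ge>N. pnorm p M (\<lambda>x. f m x - f n x) < e"
  obtains g where "g \<in> Lp_fun p M" "(\<lambda>n. pnorm p M (\<lambda>x. f n x - g x)) \<longlonglongrightarrow> 0"
proof -
  note [measurable] = Lp_fun_measurable[OF f]
  have "\<exists>N. \<forall>m\<ge>N. \<forall>n\<ge>N. pnorm p M (\<lambda>x. f m x - f n x) < (1/2) ^ k" for k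
    by (rule Cauchy) simp
  then obtain N where N: "\<And>k m n. m \<ge> N k \<Longrightarrow> n \<ge> N k \<Longrightarrow> pnorm p M (\<lambda>x. f m x - f n x) < (1/2) ^ k"
    by metis
  \<comment> \<open>The sum puts both \<open>r k\<close> and \<open>r (Suc k)\<close> beyond
    \<open>N k\<close>; the summand k gives \<open>r k \<ge> k\<close>, which the Fatou argument
    needs.\<close>
  define r where "r k = (\<Sum>j\<le>k. N j) + k" for k
  have rN: "r k \<ge> N k" for k
    unfolding r_def using member_le_sum[of k "{..k}" N] by simp
  have rS: "r (Suc k) \<ge> N k" for k using rN[of k] by (simp add: r_def)
  define D where "D k x = f (r (Suc k)) x - f (r k) x" for k x
  have [measurable]: "D k \<in> borel_measurable M" for k unfolding D_def by measurable
  have DL: "D k \<in> Lp_fun p M" for k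
    unfolding D_def by (rule pnorm_triangle_diff(1)[OF assms(1) f f])
  have Dn: "pnorm p M (D k) \<le> (1/2) ^ k" for k
    unfolding D_def using N[OF rS rN] by (intro less_imp_le) blast
  define S where "S n x = (\<Sum>k<n. cmod (D k x))" for n x
  have [measurable]: "S n \<in> borel_measurable M" for n unfolding S_def by measurable
  have S0: "S n x \<ge> 0" for n x unfolding S_def by (intro sum_nonneg) auto
  have Sn: "integrable M (\<lambda>x. S n x powr p)" "(LINT x|M. S n x powr p) \<le> 2 powr p" for n
  proof -
    have A: "(\<lambda>x. complex_of_real (cmod (D k x))) \<in> Lp_fun p M" "pnorm p M (\<lambda>x. complex_of_real (cmod (D k x))) = pnorm p M (D k)" for k
      using DL[of k] by (auto simp: Lp_fun_def pnorm_def)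
    have "pnorm p M (\<lambda>x. complex_of_real (S n x)) \<le> (\<Sum>k<n. pnorm p M (D k))"
         "(\<lambda>x. complex_of_real (S n x)) \<in> Lp_fun p M"
      using pnorm_sum[OF assms(1), of "{..<n}" "\<lambda>k x. complex_of_real (cmod (D k x))" M] A
      by (auto simp: S_def)
    moreover have "(\<Sum>k<n. pnorm p M (D k)) \<le> (\<Sum>k<n. (1/2) ^ k)" by (intro sum_mono Dn)
    moreover have "(\<Sum>k<n. (1/2::real) ^ k) \<le> 2" by (simp add: sum_gp_strict)
    ultimately have "pnorm p M (\<lambda>x. complex_of_real (S n x)) \<le> 2" 
      and L: "(\<lambda>x. complex_of_real (S n x)) \<in> Lp_fun p M" by auto
    moreover have "cmod (complex_of_real (S n x)) = S n x" for x using S0[of n x] by simp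
    ultimately show "(LINT x|M. S n x powr p) \<le> 2 powr p" "integrable M (\<lambda>x. S n x powr p)"
      using assms(1) Lp_fun_integrable[OF L] by (simp_all add: pnorm_le_iff)
  qed
  have "(\<integral>\<^sup>+x. (SUP n. ennreal (S n x powr p)) \<partial>M) = (SUP n. \<integral>\<^sup>+x. ennreal (S n x powr p) \<partial>M)"
  proof (intro nn_integral_monotone_convergence_SUP)
    show "incseq (\<lambda>n x. ennreal (S n x powr p))"
      using S0 assms(1) by (intro incseq_SucI le_funI ennreal_leI powr_mono2) (auto simp: S_def)
  qed auto
  also have "\<dots> \<le> ennreal (2 powr p)"
  proof (intro SUP_least)
    fix n
    have "(\<integral>\<^sup>+x. ennreal (S n x powr p) \<partial>M) = ennreal (LINT x|M. S n x powr p)"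
      by (rule nn_integral_eq_integral[OF Sn(1)]) auto
    thus "(\<integral>\<^sup>+x. ennreal (S n x powr p) \<partial>M) \<le> ennreal (2 powr p)"
      using Sn(2)[of n] by (simp add: ennreal_leI)
  qed
  finally have fin: "(\<integral>\<^sup>+x. (SUP n. ennreal (S n x powr p)) \<partial>M) \<le> ennreal (2 powr p)" .
  hence "(\<integral>\<^sup>+x. (SUP n. ennreal (S n x powr p)) \<partial>M) \<noteq> \<infinity>" by (auto simp: top_unique)
  hence AEf: "AE x in M. (SUP n. ennreal (S n x powr p)) \<noteq> \<infinity>"
    by (intro nn_integral_noteq_infinite) auto
  have conv: "AE x in M. summable (\<lambda>k. cmod (D k x))"
    using AEf
  proof eventually_elim
    case (elim x)
    then obtain c where c: "(SUP n. ennreal (S n x powr p)) = ennreal c" "c \<ge> 0"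
      by (cases "SUP n. ennreal (S n x powr p)") auto
    have "S n x \<le> c powr (1/p)" for n
    proof -
      have "ennreal (S n x powr p) \<le> ennreal c"
        unfolding c(1)[symmetric] by (rule SUP_upper) auto
      hence "S n x powr p \<le> c" using c(2) by simp
      hence "(S n x powr p) powr (1/p) \<le> c powr (1/p)" using assms(1) by (intro powr_mono2) auto
      thus ?thesis using assms(1) S0[of n x] by (simp add: powr_powr)
    qed
    thus "summable (\<lambda>k. cmod (D k x))"
      unfolding S_def by (intro summableI_nonneg_bounded) auto
  qed
  define g where "g x = lim (\<lambda>k. f (r k) x)" for x
  have [measurable]: "g \<in> borel_measurable M" unfolding g_def
    by (rule borel_measurable_lim_metric) (rule Lp_fun_measurable[OF f])
  have tel: "f (r n) x = f (r 0) x + (\<Sum>k<n. D k x)" for n x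
    by (induction n) (auto simp: D_def)
  have lim: "AE x in M. (\<lambda>k. f (r k) x) \<longlonglongrightarrow> g x"
    using conv
  proof eventually_elim
    case (elim x)
    hence "summable (\<lambda>k. D k x)" by (rule summable_norm_cancel)
    hence "convergent (\<lambda>n. \<Sum>k<n. D k x)" by (simp add: summable_iff_convergent)
    hence "convergent (\<lambda>n. f (r 0) x + (\<Sum>k<n. D k x))" by (intro convergent_add convergent_const)
    hence "convergent (\<lambda>n. f (r n) x)" by (simp flip: tel)
    thus ?case by (simp add: g_def convergent_LIMSEQ_iff)
  qed
  \<comment> \<open>Fatou along the subsequence: |f n - g| powr p is almost everywhere the limit of
    the same expression with \<open>f (r (k + K))\<close> for g, and each of those has integral at
    most e powr p.\<close>
  have close: "(\<lambda>x. f n x - g x) \<in> Lp_fun p M \<and> pnorm p M (\<lambda>x. f n x - g x) \<le> e"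
    if N': "\<And>m. m \<ge> K \<Longrightarrow> pnorm p M (\<lambda>x. f n x - f m x) \<le> e" and "e > 0" for K n e
  proof -
    have "(\<integral>\<^sup>+x. ennreal (cmod (f n x - g x) powr p) \<partial>M) \<le> (\<integral>\<^sup>+x. liminf (\<lambda>k. ennreal (cmod (f n x - f (r (k + K)) x) powr p)) \<partial>M)"
    proof (rule nn_integral_mono_AE)
      show "AE x in M. ennreal (cmod (f n x - g x) powr p) \<le> liminf (\<lambda>k. ennreal (cmod (f n x - f (r (k + K)) x) powr p))"
        using lim
      proof eventually_elim
        case (elim x)
        have "(\<lambda>k. f (r (k + K)) x) \<longlonglongrightarrow> g x" by (rule LIMSEQ_ignore_initial_segment[OF elim])
        hence "(\<lambda>k. cmod (f n x - f (r (k + K)) x) powr p) \<longlonglongrightarrow> cmod (f n x - g x) powr p"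
          using assms(1) by (intro tendsto_powr' tendsto_intros) auto
        hence "(\<lambda>k. ennreal (cmod (f n x - f (r (k + K)) x) powr p)) \<longlonglongrightarrow> ennreal (cmod (f n x - g x) powr p)"
          by (intro tendsto_ennrealI)
        from lim_imp_Liminf[OF trivial_limit_sequentially this] show ?case by (rule eq_refl[OF sym])
      qed
    qed
    also have "\<dots> \<le> liminf (\<lambda>k. \<integral>\<^sup>+x. ennreal (cmod (f n x - f (r (k + K)) x) powr p) \<partial>M)"
      by (rule nn_integral_liminf) measurable
    also have "\<dots> \<le> ennreal (e powr p)"
    proof (intro Liminf_le always_eventually allI)
      fix k
      have "r (k + K) \<ge> K" by (simp add: r_def)
      have i: "integrable M (\<lambda>x. cmod (f n x - f (r (k + K)) x) powr p)"
        by (rule Lp_fun_integrable[OF pnorm_triangle_diff(1)[OF assms(1) f f]])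
      have "(LINT x|M. cmod (f n x - f (r (k + K)) x) powr p) \<le> e powr p"
        using N'[OF \<open>r (k + K) \<ge> K\<close>] assms(1) \<open>e > 0\<close> by (simp add: pnorm_le_iff)
      thus "(\<integral>\<^sup>+x. ennreal (cmod (f n x - f (r (k + K)) x) powr p) \<partial>M) \<le> ennreal (e powr p)"
        by (subst nn_integral_eq_integral[OF i]) (auto intro: ennreal_leI)
    qed simp
    finally have *: "(\<integral>\<^sup>+x. ennreal (cmod (f n x - g x) powr p) \<partial>M) \<le> ennreal (e powr p)" .
    hence "(\<integral>\<^sup>+x. ennreal (cmod (f n x - g x) powr p) \<partial>M) < \<infinity>"
      by (auto intro: le_less_trans)
    hence i: "integrable M (\<lambda>x. cmod (f n x - g x) powr p)"
      by (intro integrableI_bounded) auto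
    have "ennreal (LINT x|M. cmod (f n x - g x) powr p) \<le> ennreal (e powr p)"
      using * by (subst (asm) nn_integral_eq_integral[OF i]) auto
    hence "(LINT x|M. cmod (f n x - g x) powr p) \<le> e powr p" by (simp add: ennreal_le_iff)
    thus ?thesis using i assms(1) \<open>e > 0\<close> by (simp add: pnorm_le_iff Lp_fun_def)
  qed
  have close': "\<exists>K. \<forall>n\<ge>K. (\<lambda>x. f n x - g x) \<in> Lp_fun p M \<and> pnorm p M (\<lambda>x. f n x - g x) \<le> e" if "e > 0" for e
  proof -
    obtain K where K: "\<forall>m\<ge>K. \<forall>n\<ge>K. pnorm p M (\<lambda>x. f m x - f n x) < e"
      using Cauchy \<open>e > 0\<close> by blast
    show ?thesis
    proof (intro exI[of _ K] allI impI)
      fix n assume "n \<ge> K"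
      show "(\<lambda>x. f n x - g x) \<in> Lp_fun p M \<and> pnorm p M (\<lambda>x. f n x - g x) \<le> e"
        by (rule close[of K]) (use K \<open>n \<ge> K\<close> \<open>e > 0\<close> in \<open>auto intro: less_imp_le\<close>)
    qed
  qed
  obtain n where n: "(\<lambda>x. f n x - g x) \<in> Lp_fun p M" using close'[of 1] by auto
  have "(\<lambda>x. f n x - (f n x - g x)) \<in> Lp_fun p M"
    by (rule pnorm_triangle_diff(1)[OF assms(1) f n])
  hence "g \<in> Lp_fun p M" by simp
  moreover have "(\<lambda>n. pnorm p M (\<lambda>x. f n x - g x)) \<longlonglongrightarrow> 0"
  proof (rule LIMSEQ_I)
    fix e :: real assume "e > 0"
    thus "\<exists>K. \<forall>n\<ge>K. norm (pnorm p M (\<lambda>x. f n x - g x) - 0) < e"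
      using close'[of "e/2"] by force
  qed
  ultimately show ?thesis using that by blast
qed

section \<open>Fourier coefficients and trigonometric polynomials on the circle\<close>

lemma prob_space_circle: "prob_space circle"
proof -
  have "prob_space (uniform_measure lborel {-pi..pi})"
    by (rule prob_space_uniform_measure) auto
  thus ?thesis unfolding circle_def
    by (rule prob_space.prob_space_distr) (use cis_measurable_sphere in simp)
qed

interpretation circle: prob_space circle
  by (rule prob_space_circle)

text \<open>The bridge between the parametrised integral in \<open>fourier\<close> and the measure
  \<open>circle\<close>; it lets the coefficients \<open>fcoef\<close> be treated as integrals over
  \<open>circle\<close>.\<close>

lemma integral_circle:
  fixes f :: "complex \<Rightarrow> complex"
  assumes [measurable]: "f \<in> borel_measurable circle"
  shows "(LINT z|circle. f z) = (1 / (2 * pi)) * (LINT t:{-pi..pi}|lborel. f (cis t))"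
proof -
  have cm [measurable]: "cis \<in> uniform_measure lborel {-pi..pi} \<rightarrow>\<^sub>M restrict_space borel (sphere 0 1)"
    using cis_measurable_sphere by simp
  have fm [measurable]: "f \<in> borel_measurable (restrict_space borel (sphere 0 1))"
    using assms by (simp add: measurable_cong_sets[OF sets_circle refl])
  have [measurable]: "(\<lambda>t. f (cis t)) \<in> borel_measurable lborel"
    using measurable_compose[OF cis_measurable_sphere fm] by simp
  have "(LINT z|circle. f z) = (LINT t|uniform_measure lborel {-pi..pi}. f (cis t))"
    unfolding circle_def by (rule integral_distr) measurable
  also have "uniform_measure lborel {-pi..pi} = density lborel (\<lambda>t. ennreal (indicator {-pi..pi} t / (2 * pi)))"
    unfolding uniform_measure_def
    by (rule arg_cong[where f="density lborel"])
       (auto simp: indicator_def divide_ennreal[symmetric] intro!: ext)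
  also have "(LINT t|density lborel (\<lambda>t. ennreal (indicator {-pi..pi} t / (2 * pi))). f (cis t)) =
      (LINT t|lborel. (indicator {-pi..pi} t / (2 * pi)) *\<^sub>R f (cis t))"
    by (rule integral_density) auto
  also have "\<dots> = (LINT t|lborel. (1 / (2 * pi)) *\<^sub>R (indicator {-pi..pi} t *\<^sub>R f (cis t)))"
    by (intro Bochner_Integration.integral_cong) auto
  also have "\<dots> = (1 / (2 * pi)) * (LINT t:{-pi..pi}|lborel. f (cis t))"
    unfolding set_lebesgue_integral_def by (subst integral_scaleR_right) (simp add: scaleR_conv_of_real)
  finally show ?thesis .
qed

lemma measurable_circle_continuous:
  fixes f :: "complex \<Rightarrow> 'b::topological_space"
  assumes "continuous_on (sphere 0 1) f"
  shows "f \<in> borel_measurable circle"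
  using borel_measurable_continuous_on_restrict[OF assms]
  by (simp add: measurable_cong_sets[OF sets_circle refl])

definition zchar :: "int \<Rightarrow> complex \<Rightarrow> complex" where
  "zchar k z = z powi k"

lemma zchar_0 [simp]: "zchar 0 z = 1"
  by (simp add: zchar_def)

lemma continuous_on_zchar: "continuous_on (sphere 0 1) (zchar k)"
  unfolding zchar_def by (intro continuous_intros) auto

lemma zchar_measurable [measurable]: "zchar k \<in> borel_measurable circle"
  by (rule measurable_circle_continuous[OF continuous_on_zchar])

lemma norm_zchar [simp]: "cmod z = 1 \<Longrightarrow> cmod (zchar k z) = 1"
  by (simp add: zchar_def norm_power_int)

lemma zchar_add:
  assumes "cmod z = 1"
  shows "zchar (k + l) z = zchar k z * zchar l z"
proof -
  have "z \<noteq> 0" using assms by auto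
  thus ?thesis by (simp add: zchar_def power_int_add)
qed

lemma zchar_uminus:
  assumes "cmod z = 1"
  shows "zchar (- k) z = cnj (zchar k z)"
proof -
  have "zchar k z * cnj (zchar k z) = 1"
    using assms by (simp add: complex_norm_square[symmetric])
  hence "inverse (zchar k z) = cnj (zchar k z)" by (rule inverse_unique)
  thus ?thesis by (simp add: zchar_def power_int_minus)
qed

lemma zchar_mult_cnj: "cmod z = 1 \<Longrightarrow> zchar k (z * cnj w) = zchar k z * cnj (zchar k w)"
  by (simp add: zchar_def power_int_mult_distrib)

lemma integral_zchar: "(LINT z|circle. zchar k z) = (if k = 0 then 1 else 0)"
proof (cases "k = 0")
  case True
  thus ?thesis using circle.prob_space by simp
next
  case False
  have [simp]: "zchar k (cis t) = cis (of_int k * t)" for t by (simp add: zchar_def cis_power_int)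
  define F where "F t = cis (of_int k * t) / (\<i> * of_int k)" for t :: real
  have "(LINT t|lborel. indicator {-pi..pi} t *\<^sub>R cis (of_int k * t)) = F pi - F (- pi)"
  proof (rule integral_FTC_Icc)
    fix x :: real
    show "(F has_vector_derivative cis (of_int k * x)) (at x within {-pi..pi})"
      unfolding F_def cis_conv_exp using False
      by (auto intro!: derivative_eq_intros has_vector_derivative_real_field simp: field_simps)
  qed (auto intro!: continuous_intros)
  also have "\<dots> = 0"
  proof -
    have "cis (of_int k * pi) = cis (- (of_int k * pi))"
      by (simp add: complex_eq_iff sin_times_pi_eq_0)
    thus ?thesis by (simp add: F_def)
  qed
  finally show ?thesis using False
    by (simp add: integral_circle set_lebesgue_integral_def)
qed

definition fcoef :: "(complex \<Rightarrow> complex) \<Rightarrow> int \<Rightarrow> complex" where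
  "fcoef f k = (LINT z|circle. f z * zchar (- k) z)"

lemma fourier_abs_L0:
  assumes "f \<in> borel_measurable circle"
  shows "fourier (abs_L0 f) k = fcoef f k"
proof -
  have "(\<lambda>z. f z * zchar (- k) z) \<in> borel_measurable circle" using assms by measurable
  from integral_circle[OF this]
  have "fcoef f k = (1 / (2 * pi)) * (LINT t:{-pi..pi}|lborel. f (cis t) * cis (- (of_int k * t)))"
    by (simp add: fcoef_def zchar_def cis_power_int)
  moreover have "ae_eq f f" using assms by (simp add: ae_eq_def)
  ultimately show ?thesis by (simp add: fourier.abs_eq eq_onp_def)
qed

lemma AE_circle_norm: "AE z in circle. cmod z = 1"
  by (rule AE_I2) simp

lemma integrable_mult_zchar:
  assumes "integrable circle f"
  shows "integrable circle (\<lambda>z. f z * zchar k z)"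
  by (rule Bochner_Integration.integrable_bound[OF assms])
     (use borel_measurable_integrable[OF assms] AE_circle_norm in \<open>auto simp: norm_mult\<close>)

lemma fcoef_add:
  assumes "integrable circle f" "integrable circle g"
  shows "fcoef (\<lambda>z. f z + g z) k = fcoef f k + fcoef g k"
  using assms by (simp add: fcoef_def ring_distribs integrable_mult_zchar)

lemma fcoef_diff:
  assumes "integrable circle f" "integrable circle g"
  shows "fcoef (\<lambda>z. f z - g z) k = fcoef f k - fcoef g k"
  using assms by (simp add: fcoef_def ring_distribs integrable_mult_zchar)

lemma fcoef_cmult: "fcoef (\<lambda>z. c * f z) k = c * fcoef f k"
  by (simp add: fcoef_def mult.assoc)

lemma fcoef_cong:
  assumes "\<And>z. cmod z = 1 \<Longrightarrow> f z = g z"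
  shows "fcoef f k = fcoef g k"
  unfolding fcoef_def by (intro Bochner_Integration.integral_cong) (auto simp: assms)

lemma fcoef_zchar_mult: "fcoef (\<lambda>z. zchar j z * f z) k = fcoef f (k - j)"
  unfolding fcoef_def
  by (intro Bochner_Integration.integral_cong) (auto simp: zchar_add[of _ j "-k", simplified])

lemma fcoef_zchar: "fcoef (zchar j) k = (if k = j then 1 else 0)"
proof -
  have "fcoef (zchar j) k = (LINT z|circle. zchar (j - k) z)"
    unfolding fcoef_def
    by (intro Bochner_Integration.integral_cong) (auto simp: zchar_add[of _ j "-k", symmetric])
  thus ?thesis by (auto simp: integral_zchar)
qed

lemma norm_fcoef_le:
  assumes "p \<ge> 1" "f \<in> Lp_fun p circle"
  shows "cmod (fcoef f k) \<le> pnorm p circle f"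
proof -
  have "cmod (fcoef f k) \<le> (LINT z|circle. cmod (f z * zchar (- k) z))"
    unfolding fcoef_def by (rule integral_norm_bound)
  also have "\<dots> = (LINT z|circle. cmod (f z))"
    by (intro Bochner_Integration.integral_cong) (auto simp: norm_mult)
  also have "\<dots> \<le> pnorm p circle f"
    by (rule Lp_fun_integrable1[OF prob_space_circle assms])
  finally show ?thesis .
qed

lemmas Lp_circle_integrable = Lp_fun_integrable1(1)[OF prob_space_circle]

section \<open>Trigonometric polynomials\<close>

inductive trig :: "(complex \<Rightarrow> complex) \<Rightarrow> bool" where
  trig_zero: "trig (\<lambda>_. 0)"
| trig_add_zchar: "trig f \<Longrightarrow> trig (\<lambda>z. f z + c * zchar k z)"

lemma trig_add:
  assumes "trig g" "trig f"
  shows "trig (\<lambda>z. f z + g z)"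
  using assms(1)
proof induction
  case trig_zero
  thus ?case using assms by simp
next
  case (trig_add_zchar g c k)
  thus ?case using trig.trig_add_zchar[of "\<lambda>z. f z + g z" c k] by (simp add: add.assoc)
qed

lemma trig_cmult: "trig f \<Longrightarrow> trig (\<lambda>z. c * f z)"
proof (induction rule: trig.induct)
  case (trig_add_zchar f d k)
  thus ?case using trig.trig_add_zchar[of "\<lambda>z. c * f z" "c * d" k] by (simp add: algebra_simps)
qed (simp add: trig_zero)

lemma trig_zchar: "trig (\<lambda>z. c * zchar k z)"
  using trig_add_zchar[OF trig_zero, of c k] by simp

lemma trig_sum: "finite I \<Longrightarrow> (\<And>i. i \<in> I \<Longrightarrow> trig (f i)) \<Longrightarrow> trig (\<lambda>z. \<Sum>i\<in>I. f i z)"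
  by (induction I rule: finite_induct) (auto simp: trig_zero trig_add)

text \<open>Equality is claimed on the circle only: at z = 0 the product of \<open>zchar 1\<close>
  and \<open>zchar (-1)\<close> is 0 whereas \<open>zchar 0\<close> is 1, so the product of two
  members of \<open>trig\<close> need not be a member.\<close>

lemma trig_zchar_mult:
  assumes "trig f"
  shows "\<exists>g. trig g \<and> (\<forall>z. cmod z = 1 \<longrightarrow> g z = zchar j z * f z)"
  using assms
proof induction
  case trig_zero
  show ?case by (rule exI[of _ "\<lambda>_. 0"]) (simp add: trig.trig_zero)
next
  case (trig_add_zchar f c k)
  then obtain g where "trig g" "\<forall>z. cmod z = 1 \<longrightarrow> g z = zchar j z * f z" by blast
  thus ?case using trig.trig_add_zchar[of g c "j + k"]
    by (intro exI[of _ "\<lambda>z. g z + c * zchar (j + k) z"]) (auto simp: zchar_add algebra_simps)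
qed

lemma trig_mult:
  assumes "trig g" "trig f"
  shows "\<exists>h. trig h \<and> (\<forall>z. cmod z = 1 \<longrightarrow> h z = f z * g z)"
  using assms(1)
proof induction
  case trig_zero
  show ?case by (rule exI[of _ "\<lambda>_. 0"]) (simp add: trig.trig_zero)
next
  case (trig_add_zchar g c k)
  then obtain h where h: "trig h" "\<forall>z. cmod z = 1 \<longrightarrow> h z = f z * g z" by blast
  obtain u where u: "trig u" "\<forall>z. cmod z = 1 \<longrightarrow> u z = zchar k z * f z"
    using trig_zchar_mult[OF assms(2)] by blast
  show ?case
    by (rule exI[of _ "\<lambda>z. h z + c * u z"]) (auto simp: h u algebra_simps intro!: trig_add trig_cmult)
qed

lemma trig_continuous: "trig f \<Longrightarrow> continuous_on (sphere 0 1) f"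
  by (induction rule: trig.induct) (auto intro!: continuous_intros continuous_on_zchar)

lemma trig_measurable: "trig f \<Longrightarrow> f \<in> borel_measurable circle"
  by (rule measurable_circle_continuous[OF trig_continuous])

lemma bounded_continuous_circle:
  fixes f :: "complex \<Rightarrow> complex"
  assumes "continuous_on (sphere 0 1) f"
  obtains B where "B \<ge> 0" "\<And>z. cmod z = 1 \<Longrightarrow> cmod (f z) \<le> B"
proof -
  have "bounded (f ` sphere 0 1)"
    by (intro compact_imp_bounded compact_continuous_image assms) auto
  then obtain B where B: "\<forall>z\<in>sphere 0 1. cmod (f z) \<le> B" by (auto simp: bounded_iff)
  show ?thesis by (rule that[of "max B 0"]) (use B in \<open>auto simp: le_max_iff_disj\<close>)
qed

lemma Lp_circle_bounded:
  assumes "f \<in> borel_measurable circle" "\<And>z. cmod z = 1 \<Longrightarrow> cmod (f z) \<le> c" "p > 0"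
  shows "f \<in> Lp_fun p circle" "pnorm p circle f \<le> c"
proof -
  have "0 \<le> c" using order_trans[OF norm_ge_zero assms(2)[of 1]] by simp
  moreover have "AE z in circle. cmod (f z) \<le> c" by (rule AE_I2) (use assms(2) in simp)
  ultimately show "f \<in> Lp_fun p circle" "pnorm p circle f \<le> c"
    using bounded_Lp_fun[OF prob_space_circle assms(1) _ assms(3)] by auto
qed

lemma Lp_circle_continuous:
  assumes "continuous_on (sphere 0 1) f" "p > 0"
  shows "f \<in> Lp_fun p circle"
  using bounded_continuous_circle[OF assms(1)] Lp_circle_bounded(1)[OF measurable_circle_continuous[OF assms(1)] _ assms(2)]
  by metis

lemma trig_Lp: "trig f \<Longrightarrow> p > 0 \<Longrightarrow> f \<in> Lp_fun p circle"
  by (rule Lp_circle_continuous[OF trig_continuous])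

lemma pnorm_zchar_le: "p > 0 \<Longrightarrow> pnorm p circle (zchar k) \<le> 1"
  by (rule Lp_circle_bounded(2)) auto

lemma zchar_Lp: "p > 0 \<Longrightarrow> zchar k \<in> Lp_fun p circle"
  by (rule Lp_circle_continuous[OF continuous_on_zchar])

text \<open>On the circle cnj z = 1/z, so Re z = (z + 1/z)/2 and Im z = (z - 1/z)/(2\<i>) are
  trigonometric polynomials; this gives the coefficients in \<open>h\<close>, and
  \<open>trig_mult\<close> handles products.\<close>

lemma real_polynomial_trig:
  fixes f :: "complex \<Rightarrow> real"
  assumes "real_polynomial_function f"
  shows "\<exists>g. trig g \<and> (\<forall>z. cmod z = 1 \<longrightarrow> g z = of_real (f z))"
  using assms
proof induction
  case (linear f)
  then interpret bounded_linear f .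
  define a b where "a = f 1" and "b = f \<i>"
  have "f z = Re z * a + Im z * b" for z
  proof -
    have "z = Re z *\<^sub>R 1 + Im z *\<^sub>R \<i>" by (simp add: complex_eq_iff)
    hence "f z = f (Re z *\<^sub>R 1 + Im z *\<^sub>R \<i>)" by simp
    also have "\<dots> = Re z *\<^sub>R f 1 + Im z *\<^sub>R f \<i>" by (simp only: add scaleR)
    finally show ?thesis by (simp add: a_def b_def)
  qed
  define h where "h z = ((a - \<i> * b) / 2) * zchar 1 z + ((a + \<i> * b) / 2) * zchar (-1) z" for z
  have "h z = complex_of_real (Re z * a + Im z * b)" if "cmod z = 1" for z
    using that unfolding h_def zchar_uminus[OF that] by (simp add: zchar_def complex_eq_iff field_simps)
  moreover have "trig h" unfolding h_def by (rule trig_add[OF trig_zchar trig_zchar])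
  ultimately show ?case using \<open>\<And>z. f z = Re z * a + Im z * b\<close> by (intro exI[of _ h]) simp
next
  case (const c)
  show ?case using trig_zchar[of "of_real c" 0] by (intro exI[of _ "\<lambda>z. of_real c * zchar 0 z"]) auto
next
  case (add f g)
  then obtain F G where "trig F" "trig G" "\<forall>z. cmod z = 1 \<longrightarrow> F z = of_real (f z)" "\<forall>z. cmod z = 1 \<longrightarrow> G z = of_real (g z)" by blast
  thus ?case by (intro exI[of _ "\<lambda>z. F z + G z"]) (auto intro!: trig_add)
next
  case (mult f g)
  then obtain F G where FG: "trig F" "trig G" "\<forall>z. cmod z = 1 \<longrightarrow> F z = of_real (f z)" "\<forall>z. cmod z = 1 \<longrightarrow> G z = of_real (g z)" by blast
  then obtain h where "trig h" "\<forall>z. cmod z = 1 \<longrightarrow> h z = F z * G z" using trig_mult by blast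
  thus ?case using FG by (intro exI[of _ h]) auto
qed

text \<open>Stone--Weierstrass for the real and the imaginary part, each up to e/2.\<close>

lemma trig_dense_continuous:
  fixes f :: "complex \<Rightarrow> complex"
  assumes "continuous_on (sphere 0 1) f" "e > 0"
  obtains g where "trig g" "\<And>z. cmod z = 1 \<Longrightarrow> cmod (f z - g z) \<le> e"
proof -
  have "\<exists>h. trig h \<and> (\<forall>z. cmod z = 1 \<longrightarrow> cmod (of_real (u z) - h z) \<le> e / 2)"
    if cu: "continuous_on (sphere 0 1) u" for u :: "complex \<Rightarrow> real"
  proof -
    obtain r where r: "real_polynomial_function r" "\<And>z. z \<in> sphere 0 1 \<Longrightarrow> \<bar>u z - r z\<bar> < e / 2"
      by (rule Stone_Weierstrass_real_polynomial_function[of "sphere 0 1" u "e/2"])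
         (use cu \<open>e > 0\<close> in auto)
    obtain h where h: "trig h" "\<forall>z. cmod z = 1 \<longrightarrow> h z = of_real (r z)" using real_polynomial_trig[OF r(1)] by blast
    have "cmod (of_real (u z) - h z) \<le> e / 2" if "cmod z = 1" for z
    proof -
      have "cmod (of_real (u z) - h z) = \<bar>u z - r z\<bar>"
        using h(2) that by (simp flip: of_real_diff)
      thus ?thesis using r(2)[of z] that by simp
    qed
    thus ?thesis using h(1) by blast
  qed
  from this[of "\<lambda>z. Re (f z)"] this[of "\<lambda>z. Im (f z)"] obtain h1 h2 where
    h: "trig h1" "trig h2" "\<And>z. cmod z = 1 \<Longrightarrow> cmod (of_real (Re (f z)) - h1 z) \<le> e / 2"
       "\<And>z. cmod z = 1 \<Longrightarrow> cmod (of_real (Im (f z)) - h2 z) \<le> e / 2"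
    using assms by (auto intro: continuous_intros)
  show ?thesis
  proof (rule that)
    show "trig (\<lambda>z. h1 z + \<i> * h2 z)" by (intro trig_add trig_cmult h)
    fix z :: complex assume z: "cmod z = 1"
    have "f z - (h1 z + \<i> * h2 z) = (of_real (Re (f z)) - h1 z) + \<i> * (of_real (Im (f z)) - h2 z)"
      by (subst complex_eq[of "f z"]) (simp add: algebra_simps)
    also have "cmod \<dots> \<le> cmod (of_real (Re (f z)) - h1 z) + cmod (\<i> * (of_real (Im (f z)) - h2 z))"
      by (rule norm_triangle_ineq)
    also have "\<dots> \<le> e / 2 + e / 2" unfolding norm_mult using h(3,4)[OF z] by (intro add_mono) auto
    finally show "cmod (f z - (h1 z + \<i> * h2 z)) \<le> e" by simp
  qed
qed

section \<open>Density of trigonometric polynomials in \<open>L\<^sup>p\<close>\<close>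

definition trig_approx :: "real \<Rightarrow> (complex \<Rightarrow> complex) \<Rightarrow> bool" where
  "trig_approx p f \<longleftrightarrow> f \<in> Lp_fun p circle \<and>
     (\<forall>e>0. \<exists>g. trig g \<and> pnorm p circle (\<lambda>z. f z - g z) < e)"

lemma trig_approx_continuous:
  assumes "p \<ge> 1" "continuous_on (sphere 0 1) f"
  shows "trig_approx p f"
  unfolding trig_approx_def
proof safe
  show "f \<in> Lp_fun p circle" using assms by (intro Lp_circle_continuous) auto
  fix e :: real assume "e > 0"
  obtain g where g: "trig g" "\<And>z. cmod z = 1 \<Longrightarrow> cmod (f z - g z) \<le> e / 2"
    using trig_dense_continuous[OF assms(2), of "e/2"] \<open>e > 0\<close> by auto
  have "continuous_on (sphere 0 1) (\<lambda>z. f z - g z)"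
    by (intro continuous_intros assms trig_continuous g)
  hence "pnorm p circle (\<lambda>z. f z - g z) \<le> e / 2"
    by (intro Lp_circle_bounded(2) measurable_circle_continuous) (use g assms in auto)
  thus "\<exists>g. trig g \<and> pnorm p circle (\<lambda>z. f z - g z) < e" using g \<open>e > 0\<close> by (intro exI[of _ g]) auto
qed

text \<open>The closure step that is reused at every stage: from continuous functions to indicators
  of compact sets, then of measurable sets, then to simple functions and to all of
  \<open>L\<^sup>p\<close>.\<close>

lemma trig_approx_close:
  assumes "p \<ge> 1" "f \<in> Lp_fun p circle"
    and "\<And>e. e > 0 \<Longrightarrow> \<exists>h. trig_approx p h \<and> pnorm p circle (\<lambda>z. f z - h z) < e"
  shows "trig_approx p f"
  unfolding trig_approx_def
proof safe
  fix e :: real assume "e > 0"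
  obtain h where h: "trig_approx p h" "pnorm p circle (\<lambda>z. f z - h z) < e / 2"
    using assms(3)[of "e/2"] \<open>e > 0\<close> by auto
  obtain g where g: "trig g" "pnorm p circle (\<lambda>z. h z - g z) < e / 2"
    using h(1) \<open>e > 0\<close> half_gt_zero unfolding trig_approx_def by blast
  have L: "h \<in> Lp_fun p circle" "g \<in> Lp_fun p circle"
    using h(1) trig_Lp[OF g(1)] assms(1) by (auto simp: trig_approx_def)
  have "pnorm p circle (\<lambda>z. (f z - h z) + (h z - g z)) \<le> pnorm p circle (\<lambda>z. f z - h z) + pnorm p circle (\<lambda>z. h z - g z)"
    by (intro pnorm_triangle pnorm_triangle_diff assms L)
  also have "\<dots> < e" using h(2) g(2) by simp
  finally show "\<exists>g. trig g \<and> pnorm p circle (\<lambda>z. f z - g z) < e" using g(1) by auto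
qed (use assms in auto)

lemma trig_approx_add:
  assumes "p \<ge> 1" "trig_approx p f" "trig_approx p g"
  shows "trig_approx p (\<lambda>z. f z + g z)"
  unfolding trig_approx_def
proof safe
  show "(\<lambda>z. f z + g z) \<in> Lp_fun p circle"
    using assms by (intro pnorm_triangle) (auto simp: trig_approx_def)
  fix e :: real assume "e > 0"
  obtain u where u: "trig u" "pnorm p circle (\<lambda>z. f z - u z) < e / 2"
    using assms(2) \<open>e > 0\<close> half_gt_zero unfolding trig_approx_def by blast
  obtain v where v: "trig v" "pnorm p circle (\<lambda>z. g z - v z) < e / 2"
    using assms(3) \<open>e > 0\<close> half_gt_zero unfolding trig_approx_def by blast
  have L: "u \<in> Lp_fun p circle" "v \<in> Lp_fun p circle" "f \<in> Lp_fun p circle" "g \<in> Lp_fun p circle"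
    using trig_Lp[OF u(1)] trig_Lp[OF v(1)] assms by (auto simp: trig_approx_def)
  have "pnorm p circle (\<lambda>z. (f z - u z) + (g z - v z)) \<le> pnorm p circle (\<lambda>z. f z - u z) + pnorm p circle (\<lambda>z. g z - v z)"
    by (intro pnorm_triangle pnorm_triangle_diff assms L)
  also have "\<dots> < e" using u(2) v(2) by simp
  also have "(\<lambda>z. (f z - u z) + (g z - v z)) = (\<lambda>z. (f z + g z) - (u z + v z))" by (auto simp: algebra_simps)
  finally show "\<exists>h. trig h \<and> pnorm p circle (\<lambda>z. f z + g z - h z) < e"
    using trig_add[OF v(1) u(1)] by blast
qed

lemma trig_approx_cmult:
  assumes "p \<ge> 1" "trig_approx p f"
  shows "trig_approx p (\<lambda>z. c * f z)"
  unfolding trig_approx_def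
proof safe
  show "(\<lambda>z. c * f z) \<in> Lp_fun p circle"
    using assms by (intro Lp_fun_cmult) (auto simp: trig_approx_def)
  fix e :: real assume "e > 0"
  hence "e / (cmod c + 1) > 0" by (simp add: add_nonneg_pos)
  then obtain u where u: "trig u" "pnorm p circle (\<lambda>z. f z - u z) < e / (cmod c + 1)"
    using assms(2) unfolding trig_approx_def by blast
  have "pnorm p circle (\<lambda>z. c * f z - c * u z) = cmod c * pnorm p circle (\<lambda>z. f z - u z)"
    using pnorm_cmult[of p circle c "\<lambda>z. f z - u z"] assms(1) by (simp add: algebra_simps)
  also have "\<dots> \<le> cmod c * (e / (cmod c + 1))" using u(2) by (intro mult_left_mono) auto
  also have "\<dots> < e"
  proof -
    have "cmod c + 1 > 0" by (simp add: add_nonneg_pos)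
    thus ?thesis using \<open>e > 0\<close> by (simp add: field_simps)
  qed
  finally show "\<exists>h. trig h \<and> pnorm p circle (\<lambda>z. c * f z - h z) < e"
    using trig_cmult[OF u(1)] by blast
qed

text \<open>The continuous cut-offs max 0 (1 - n dist(z, K)) are bounded by 1 and decrease to the
  indicator of K.\<close>

lemma trig_approx_compact:
  assumes "p \<ge> 1" "compact K"
  shows "trig_approx p (\<lambda>z. indicator (K \<inter> sphere 0 1) z)"
proof (cases "K = {}")
  \<comment> \<open>The empty set is separate because \<open>infdist\<close> to it is 0 by
    convention, so that the cut-offs would be constantly 1.\<close>
  case True
  thus ?thesis using trig_approx_continuous[OF assms(1), of "\<lambda>_. 0"] by simp
next
  case False
  define u where "u n z = complex_of_real (max 0 (1 - real n * infdist z K))" for n z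
  have cu: "continuous_on A (u n)" for A n
    unfolding u_def by (intro continuous_intros continuous_on_infdist)
  have lim: "(\<lambda>n. u n z) \<longlonglongrightarrow> indicator (K \<inter> sphere 0 1) z" if "cmod z = 1" for z
  proof (cases "z \<in> K")
    case True
    thus ?thesis using that by (simp add: u_def indicator_def)
  next
    case F: False
    have "infdist z K > 0"
      using F False assms(2) by (metis compact_imp_closed in_closed_iff_infdist_zero infdist_nonneg less_eq_real_def)
    hence "\<forall>\<^sub>F n in sequentially. u n z = 0"
    proof -
      obtain m where m: "real m * infdist z K > 1" using reals_Archimedean3[OF \<open>infdist z K > 0\<close>] by blast
      have "real n * infdist z K \<ge> real m * infdist z K" if "n \<ge> m" for n
        using that by (intro mult_right_mono infdist_nonneg) auto
      thus ?thesis using m by (intro eventually_sequentiallyI[of m]) (force simp: u_def)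
    qed
    thus ?thesis using F by (simp add: tendsto_eventually)
  qed
  have [measurable]: "K \<inter> sphere 0 1 \<in> sets circle"
    unfolding sets_circle sets_restrict_space using assms(2) by (auto simp: compact_imp_closed borel_closed)
  have ub: "cmod (u n z) \<le> 1" for n z
    unfolding u_def using infdist_nonneg[of z K] by (auto simp: norm_of_real intro!: abs_leI mult_nonneg_nonneg)
  have im: "(\<lambda>z. indicator (K \<inter> sphere 0 1) z :: complex) \<in> borel_measurable circle" by measurable
  have conv: "(\<lambda>n. pnorm p circle (\<lambda>z. u n z - indicator (K \<inter> sphere 0 1) z)) \<longlonglongrightarrow> 0"
  proof (rule Lp_dominated_convergence[where g = "\<lambda>_. 2"])
    show "(\<lambda>_. 2) \<in> Lp_fun p circle" using assms(1) by (intro Lp_circle_continuous) auto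
    show "u n \<in> borel_measurable circle" for n by (rule measurable_circle_continuous[OF cu])
    show "AE z in circle. (\<lambda>n. u n z) \<longlonglongrightarrow> indicator (K \<inter> sphere 0 1) z"
      by (rule AE_I2) (use lim in auto)
    show "AE z in circle. cmod (u n z - indicator (K \<inter> sphere 0 1) z) \<le> cmod 2" for n
    proof (rule AE_I2)
      fix z
      have "cmod (u n z - indicator (K \<inter> sphere 0 1) z) \<le> cmod (u n z) + cmod (indicator (K \<inter> sphere 0 1) z)"
        by (rule norm_triangle_ineq4)
      also have "\<dots> \<le> 1 + 1" by (intro add_mono ub) (auto simp: indicator_def)
      finally show "cmod (u n z - indicator (K \<inter> sphere 0 1) z) \<le> cmod 2" by simp
    qed
  qed (use assms(1) im in auto)
  show ?thesis
  proof (rule trig_approx_close[OF assms(1)])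
    show "(\<lambda>z. indicator (K \<inter> sphere 0 1) z) \<in> Lp_fun p circle"
      by (rule Lp_circle_bounded(1)[OF im, of 1]) (use assms(1) in \<open>auto simp: indicator_def\<close>)
    fix e :: real assume "e > 0"
    hence "\<forall>\<^sub>F n in sequentially. pnorm p circle (\<lambda>z. u n z - indicator (K \<inter> sphere 0 1) z) < e"
      using conv by (rule order_tendstoD(2)[rotated])
    then obtain n where "pnorm p circle (\<lambda>z. u n z - indicator (K \<inter> sphere 0 1) z) < e"
      by (meson eventually_happens trivial_limit_sequentially)
    moreover have "pnorm p circle (\<lambda>z. indicator (K \<inter> sphere 0 1) z - u n z) = pnorm p circle (\<lambda>z. u n z - indicator (K \<inter> sphere 0 1) z)"
      using pnorm_uminus[of p circle "\<lambda>z. u n z - indicator (K \<inter> sphere 0 1) z"] by simp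
    ultimately show "\<exists>h. trig_approx p h \<and> pnorm p circle (\<lambda>z. indicator (K \<inter> sphere 0 1) z - h z) < e"
      using trig_approx_continuous[OF assms(1) cu] by (intro exI[of _ "u n"]) auto
  qed
qed

text \<open>Inner regularity gives a compact K inside B with measure of B - K below e powr p, and
  the distance between the two indicators is that measure to the power 1/p.\<close>

lemma trig_approx_indicator:
  assumes "p \<ge> 1" and B: "B \<in> sets circle"
  shows "trig_approx p (\<lambda>z. indicator B z)"
proof (rule trig_approx_close[OF assms(1)])
  have im: "(\<lambda>z. indicator B z :: complex) \<in> borel_measurable circle" using B by measurable
  show "(\<lambda>z. indicator B z) \<in> Lp_fun p circle"
    by (rule Lp_circle_bounded(1)[OF im, of 1]) (use assms(1) in \<open>auto simp: indicator_def\<close>)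
  fix e :: real assume "e > 0"
  \<comment> \<open>Inner regularity concerns measures on the Borel sets of a whole space, so the
    measure is pushed forward from the circle to the plane.\<close>
  define M where "M = distr circle borel (\<lambda>z. z)"
  have idm: "(\<lambda>z. z) \<in> circle \<rightarrow>\<^sub>M (borel :: complex measure)"
    by (rule measurable_circle_continuous) (intro continuous_intros)
  obtain B' where B': "B' \<in> sets borel" "B = B' \<inter> sphere 0 1" 
    using B unfolding sets_circle sets_restrict_space by auto
  have Bb: "B \<in> sets borel" unfolding B'(2) using B'(1) by (intro sets.Int) (auto simp: borel_closed)
  have Bs: "B \<subseteq> sphere 0 1" using B' by auto
  have em: "emeasure M A = emeasure circle A" if "A \<in> sets borel" "A \<subseteq> sphere 0 1" for A
  proof -
    have "emeasure M A = emeasure circle (A \<inter> sphere 0 1)"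
      unfolding M_def using that(1) by (subst emeasure_distr[OF idm]) auto
    also have "A \<inter> sphere 0 1 = A" using that by auto
    finally show ?thesis .
  qed
  interpret M: prob_space M unfolding M_def by (rule circle.prob_space_distr[OF idm])
  have sup: "emeasure M B = (SUP K \<in> {K. K \<subseteq> B \<and> compact K}. emeasure M K)"
    by (rule inner_regular[OF _ _ Bb]) (use M.emeasure_finite in \<open>simp_all add: M_def\<close>)
  have "\<exists>K. K \<subseteq> B \<and> compact K \<and> measure circle (B - K) < e powr p"
  \<comment> \<open>If B itself is small, K = {} will do. Otherwise the difference inside
    \<open>ennreal\<close> below is nonnegative and is not truncated to 0.\<close>
  proof (cases "measure circle B < e powr p")
    case True
    thus ?thesis by (intro exI[of _ "{}"]) auto
  next
    case False
    have ep: "e powr p > 0" using \<open>e > 0\<close> by simp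
    have "ennreal (measure circle B - e powr p) < emeasure M B"
      unfolding em[OF Bb Bs] circle.emeasure_eq_measure using ep False by (simp add: ennreal_less_iff)
    then obtain K where K: "K \<subseteq> B" "compact K" "ennreal (measure circle B - e powr p) < emeasure M K"
      unfolding sup less_SUP_iff by blast
    have Kb: "K \<in> sets borel" using K(2) by (simp add: compact_imp_closed borel_closed)
    have "measure circle B - e powr p < measure circle K"
      using K(3) False unfolding em[OF Kb order.trans[OF K(1) Bs]] circle.emeasure_eq_measure
      by (simp add: ennreal_less_iff)
    moreover have "K \<in> sets circle" 
    proof -
      have "K = K \<inter> sphere 0 1" using K(1) Bs by auto
      thus ?thesis unfolding sets_circle sets_restrict_space using Kb by blast
    qed
    hence "measure circle (B - K) = measure circle B - measure circle K"
      by (intro circle.finite_measure_Diff B K(1))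
    ultimately show ?thesis using K by auto
  qed
  then obtain K where K: "K \<subseteq> B" "compact K" "measure circle (B - K) < e powr p" by blast
  have KI: "K \<inter> sphere 0 1 = K" using K(1) Bs by auto
  have "pnorm p circle (\<lambda>z. indicator B z - indicator K z) = measure circle (B - K) powr (1 / p)"
  proof -
    have "(LINT z|circle. cmod (indicator B z - indicator K z) powr p) = (LINT z|circle. indicator (B - K) z)"
      using K(1) assms(1) by (intro Bochner_Integration.integral_cong) (auto simp: indicator_def)
    also have "\<dots> = measure circle (B - K)" using sets.sets_into_space[OF B]
      by (simp add: Int_absorb2 subset_iff)
    finally show ?thesis by (simp add: pnorm_def)
  qed
  also have "\<dots> < (e powr p) powr (1 / p)" using K(3) assms(1) by (intro powr_less_mono2) auto
  also have "\<dots> = e" using assms(1) \<open>e > 0\<close> by (simp add: powr_powr)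
  finally show "\<exists>h. trig_approx p h \<and> pnorm p circle (\<lambda>z. indicator B z - h z) < e"
    using trig_approx_compact[OF assms(1) K(2)] unfolding KI by blast
qed

lemma trig_approx_simple:
  assumes "p \<ge> 1" "simple_function circle f"
  shows "trig_approx p f"
proof -
  have fin: "finite (f ` sphere 0 1)" using simple_functionD(1)[OF assms(2)] by simp
  have S: "f -` {c} \<inter> sphere 0 1 \<in> sets circle" for c using simple_functionD(2)[OF assms(2), of "{c}"] by simp
  have sum: "trig_approx p (\<lambda>z. \<Sum>c\<in>C. c * indicator (f -` {c} \<inter> sphere 0 1) z)" if "finite C" for C
    using that
  proof induction
    case empty
    show ?case using trig_approx_continuous[OF assms(1), of "\<lambda>_. 0"] by simp
  next
    case (insert c C)
    thus ?case
      using trig_approx_add[OF assms(1) trig_approx_cmult[OF assms(1) trig_approx_indicator[OF assms(1) S]] insert.IH]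
      by (simp only: sum.insert[OF insert.hyps(1,2)])
  qed
  have eq: "(\<Sum>c\<in>f ` sphere 0 1. c * indicator (f -` {c} \<inter> sphere 0 1) z) = f z" if "cmod z = 1" for z
  proof -
    have "(\<Sum>c\<in>f ` sphere 0 1. c * indicator (f -` {c} \<inter> sphere 0 1) z) = (\<Sum>c\<in>f ` sphere 0 1. if c = f z then c else 0)"
      using that by (intro sum.cong) (auto simp: indicator_def)
    also have "\<dots> = f z" using fin that by (subst sum.delta) auto
    finally show ?thesis .
  qed
  have fm: "f \<in> borel_measurable circle" by (rule borel_measurable_simple_function[OF assms(2)])
  show ?thesis
  proof (rule trig_approx_close[OF assms(1)])
    let ?h = "\<lambda>z. \<Sum>c\<in>f ` sphere 0 1. c * indicator (f -` {c} \<inter> sphere 0 1) z"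
    have hL: "?h \<in> Lp_fun p circle" using sum[OF fin] by (simp add: trig_approx_def)
    show "f \<in> Lp_fun p circle"
      by (rule Lp_fun_mono(1)[OF hL fm, of 1]) (use eq assms(1) in auto)
    fix e :: real assume "e > 0"
    have "pnorm p circle (\<lambda>z. f z - ?h z) = pnorm p circle (\<lambda>z. 0)"
      by (rule pnorm_cong_AE) (use fm Lp_fun_measurable[OF hL] eq in auto)
    thus "\<exists>h. trig_approx p h \<and> pnorm p circle (\<lambda>z. f z - h z) < e"
      using sum[OF fin] \<open>e > 0\<close> by (intro exI[of _ ?h]) auto
  qed
qed

theorem trig_dense_Lp:
  assumes "p \<ge> 1" "f \<in> Lp_fun p circle" "e > 0"
  obtains g where "trig g" "pnorm p circle (\<lambda>z. f z - g z) < e"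
proof -
  have "trig_approx p f"
  proof (rule trig_approx_close[OF assms(1,2)])
    fix e :: real assume "e > 0"
    have p0: "p > 0" using assms(1) by simp
    obtain s where s: "\<And>n. simple_function circle (s n)" "(\<lambda>n. pnorm p circle (\<lambda>x. s n x - f x)) \<longlonglongrightarrow> 0"
      using simple_dense_Lp[OF p0 assms(2)] by metis
    have "\<forall>\<^sub>F n in sequentially. pnorm p circle (\<lambda>z. s n z - f z) < e"
      using s(2) \<open>e > 0\<close> by (rule order_tendstoD(2))
    then obtain n where "pnorm p circle (\<lambda>z. s n z - f z) < e"
      by (meson eventually_happens trivial_limit_sequentially)
    moreover have "pnorm p circle (\<lambda>z. f z - s n z) = pnorm p circle (\<lambda>z. s n z - f z)"
      using pnorm_uminus[of p circle "\<lambda>z. s n z - f z"] by simp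
    ultimately show "\<exists>h. trig_approx p h \<and> pnorm p circle (\<lambda>z. f z - h z) < e"
      using trig_approx_simple[OF assms(1) s(1)] by (intro exI[of _ "s n"]) auto
  qed
  thus ?thesis using assms(3) that by (auto simp: trig_approx_def)
qed

section \<open>Fejer means\<close>

definition fejer_coef :: "nat \<Rightarrow> int \<Rightarrow> real" where
  "fejer_coef N k = (if \<bar>k\<bar> \<le> int N then 1 - of_int \<bar>k\<bar> / (real N + 1) else 0)"

definition fejer :: "nat \<Rightarrow> (complex \<Rightarrow> complex) \<Rightarrow> complex \<Rightarrow> complex" where
  "fejer N f z = (\<Sum>k\<in>{- int N..int N}. of_real (fejer_coef N k) * fcoef f k * zchar k z)"

text \<open>A squared modulus, hence visibly nonnegative; \<open>fejer_kernel_eq\<close> recovers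
  the triangular weights of \<open>fejer_coef\<close>.\<close>

definition fejer_kernel :: "nat \<Rightarrow> complex \<Rightarrow> real" where
  "fejer_kernel N u = (cmod (\<Sum>j\<le>N. zchar (int j) u))\<^sup>2 / (real N + 1)"

lemma fejer_coef_0 [simp]: "fejer_coef N 0 = 1"
  by (simp add: fejer_coef_def)

lemma fejer_coef_bounds: "0 \<le> fejer_coef N k" "fejer_coef N k \<le> 1"
  by (auto simp: fejer_coef_def field_simps)

lemma fejer_coef_lim: "(\<lambda>N. fejer_coef N k) \<longlonglongrightarrow> 1"
proof -
  have "(\<lambda>N. 1 - of_int \<bar>k\<bar> / (real N + 1)) \<longlonglongrightarrow> 1 - 0"
    by (intro tendsto_intros tendsto_divide_0[OF tendsto_const] filterlim_at_top_imp_at_infinity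
        filterlim_tendsto_add_at_top[OF tendsto_const filterlim_real_sequentially, THEN filterlim_cong[THEN iffD1, rotated -1]])
       (auto simp: add.commute)
  moreover have "\<forall>\<^sub>F N in sequentially. 1 - of_int \<bar>k\<bar> / (real N + 1) = fejer_coef N k"
    by (rule eventually_sequentiallyI[of "nat \<bar>k\<bar>"]) (auto simp: fejer_coef_def)
  ultimately show ?thesis by (simp add: filterlim_cong)
qed

lemma sum_symmetric_interval:
  fixes g :: "int \<Rightarrow> 'a::comm_monoid_add"
  shows "(\<Sum>k\<in>{- int N..int N}. g k) = g 0 + (\<Sum>j\<in>{1..N}. g (int j) + g (- int j))"
proof (induction N)
  case (Suc N)
  have "{- int (Suc N)..int (Suc N)} = insert (int (Suc N)) (insert (- int (Suc N)) {- int N..int N})"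
    by auto
  hence "(\<Sum>k\<in>{- int (Suc N)..int (Suc N)}. g k) = g (int (Suc N)) + (g (- int (Suc N)) + (\<Sum>k\<in>{- int N..int N}. g k))"
    by (simp add: sum.insert del: of_nat_Suc)
  thus ?case unfolding Suc.IH by (simp add: add_ac)
qed simp

text \<open>Exactly N + 1 - |k| pairs i, j \<le> N have difference k. Passing to N + 1 adds a row, a
  column and the corner (N + 1, N + 1), which together contain each difference k with |k| \<le> N +
  1 once.\<close>

lemma sum_difference_Fejer:
  fixes g :: "int \<Rightarrow> complex"
  shows "(\<Sum>i\<le>N. \<Sum>j\<le>N. g (int i - int j)) =
    (\<Sum>k\<in>{- int N..int N}. of_real (real N + 1 - of_int \<bar>k\<bar>) * g k)"
proof (induction N)
  case (Suc N)
  have A: "(\<Sum>j\<le>N. g (int (Suc N) - int j)) = (\<Sum>j\<in>{1..Suc N}. g (int j))"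
    by (rule sum.reindex_bij_witness[where i="\<lambda>j. Suc N - j" and j="\<lambda>j. Suc N - j"]) (auto simp: of_nat_diff)
  have B: "(\<Sum>i\<le>N. g (int i - int (Suc N))) = (\<Sum>j\<in>{1..Suc N}. g (- int j))"
    by (rule sum.reindex_bij_witness[where i="\<lambda>j. Suc N - j" and j="\<lambda>j. Suc N - j"]) (auto simp: of_nat_diff)
  have "(\<Sum>i\<le>Suc N. \<Sum>j\<le>Suc N. g (int i - int j)) =
      (\<Sum>i\<le>N. \<Sum>j\<le>N. g (int i - int j)) + (\<Sum>i\<le>N. g (int i - int (Suc N))) + (\<Sum>j\<le>N. g (int (Suc N) - int j)) + g 0"
    by (simp add: sum.distrib)
  also have "\<dots> = (\<Sum>k\<in>{- int N..int N}. of_real (real N + 1 - of_int \<bar>k\<bar>) * g k)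
     + (g 0 + (\<Sum>j\<in>{1..Suc N}. g (int j) + g (- int j)))"
    unfolding Suc.IH A B by (simp add: sum.distrib)
  also have "(g 0 + (\<Sum>j\<in>{1..Suc N}. g (int j) + g (- int j))) = (\<Sum>k\<in>{- int (Suc N)..int (Suc N)}. g k)"
    by (rule sum_symmetric_interval[symmetric])
  also have "(\<Sum>k\<in>{- int N..int N}. of_real (real N + 1 - of_int \<bar>k\<bar>) * g k) =
      (\<Sum>k\<in>{- int (Suc N)..int (Suc N)}. of_real (real N + 1 - of_int \<bar>k\<bar>) * g k)"
  proof (rule sum.mono_neutral_left)
    \<comment> \<open>Enlarging the range is harmless: at |k| = N + 1 the old weight N + 1 - |k| is
      0.\<close>
    show "\<forall>k\<in>{- int (Suc N)..int (Suc N)} - {- int N..int N}. of_real (real N + 1 - of_int \<bar>k\<bar>) * g k = 0"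
    proof
      fix k assume "k \<in> {- int (Suc N)..int (Suc N)} - {- int N..int N}"
      hence "\<bar>k\<bar> = int (Suc N)" by auto
      thus "of_real (real N + 1 - of_int \<bar>k\<bar>) * g k = 0" by simp
    qed
  qed auto
  also have "(\<Sum>k\<in>{- int (Suc N)..int (Suc N)}. of_real (real N + 1 - of_int \<bar>k\<bar>) * g k) + (\<Sum>k\<in>{- int (Suc N)..int (Suc N)}. g k)
     = (\<Sum>k\<in>{- int (Suc N)..int (Suc N)}. of_real (real (Suc N) + 1 - of_int \<bar>k\<bar>) * g k)"
    unfolding sum.distrib[symmetric] by (intro sum.cong refl) (simp add: algebra_simps)
  finally show ?case .
qed simp

lemma fejer_kernel_eq:
  assumes "cmod u = 1"
  shows "of_real (fejer_kernel N u) = (\<Sum>k\<in>{- int N..int N}. of_real (fejer_coef N k) * zchar k u)"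
proof -
  have "of_real ((cmod (\<Sum>j\<le>N. zchar (int j) u))\<^sup>2) = (\<Sum>i\<le>N. zchar (int i) u) * cnj (\<Sum>j\<le>N. zchar (int j) u)"
    by (rule complex_norm_square)
  also have "\<dots> = (\<Sum>i\<le>N. \<Sum>j\<le>N. zchar (int i - int j) u)"
  proof -
    have "zchar (i - j) u = zchar i u * cnj (zchar j u)" for i j
      using zchar_add[OF assms, of i "- j"] zchar_uminus[OF assms, of j] by simp
    thus ?thesis by (simp add: sum_product)
  qed
  also have "\<dots> = (\<Sum>k\<in>{- int N..int N}. of_real (real N + 1 - of_int \<bar>k\<bar>) * zchar k u)"
    by (rule sum_difference_Fejer)
  finally have "of_real (fejer_kernel N u) = (\<Sum>k\<in>{- int N..int N}. of_real (real N + 1 - of_int \<bar>k\<bar>) * zchar k u) / (real N + 1)"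
    unfolding fejer_kernel_def of_real_divide by (simp only: of_real_add of_real_of_nat_eq of_real_1)
  also have "\<dots> = (\<Sum>k\<in>{- int N..int N}. of_real (fejer_coef N k) * zchar k u)"
    unfolding sum_divide_distrib
  proof (intro sum.cong refl)
    fix k assume "k \<in> {- int N..int N}"
    hence "fejer_coef N k = (real N + 1 - of_int \<bar>k\<bar>) / (real N + 1)"
      by (auto simp: fejer_coef_def diff_divide_distrib)
    thus "of_real (real N + 1 - of_int \<bar>k\<bar>) * zchar k u / (real N + 1) = of_real (fejer_coef N k) * zchar k u"
      by simp
  qed
  finally show ?thesis .
qed

lemma trig_fejer: "trig (fejer N f)"
  unfolding fejer_def by (intro trig_sum trig_zchar) auto

lemma fejer_add:
  assumes "integrable circle f" "integrable circle g"
  shows "fejer N (\<lambda>z. f z + g z) z = fejer N f z + fejer N g z"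
  by (simp add: fejer_def fcoef_add[OF assms] sum.distrib[symmetric] algebra_simps)

lemma fejer_diff:
  assumes "integrable circle f" "integrable circle g"
  shows "fejer N (\<lambda>z. f z - g z) z = fejer N f z - fejer N g z"
  by (simp add: fejer_def fcoef_diff[OF assms] sum_subtractf[symmetric] algebra_simps)

lemma fcoef_sum_zchar:
  assumes "finite K"
  shows "fcoef (\<lambda>z. \<Sum>j\<in>K. c j * zchar j z) k = (if k \<in> K then c k else 0)"
  using assms
proof (induction K rule: finite_induct)
  case empty
  show ?case by (simp add: fcoef_def)
next
  case (insert j K)
  have "fcoef (\<lambda>z. \<Sum>j\<in>insert j K. c j * zchar j z) k = fcoef (\<lambda>z. c j * zchar j z + (\<Sum>j\<in>K. c j * zchar j z)) k"
    using insert.hyps by simp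
  also have "\<dots> = fcoef (\<lambda>z. c j * zchar j z) k + fcoef (\<lambda>z. \<Sum>j\<in>K. c j * zchar j z) k"
    by (intro fcoef_add Lp_circle_integrable[of 1] trig_Lp trig_sum trig_zchar insert.hyps) auto
  finally show ?case using insert by (auto simp: fcoef_cmult fcoef_zchar)
qed

lemma fcoef_fejer: "fcoef (fejer N f) k = of_real (fejer_coef N k) * fcoef f k"
  unfolding fejer_def by (subst fcoef_sum_zchar) (auto simp: fejer_coef_def)

section \<open>Contractivity and convergence of the Fejer means\<close>

lemma fejer_kernel_nonneg: "fejer_kernel N u \<ge> 0"
  by (simp add: fejer_kernel_def)

text \<open>The Fejer mean as a convolution. By \<open>fejer_kernel_eq\<close> the kernel is a
  finite sum, and on the circle the character at z * cnj w splits into a factor in z and the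
  conjugate character in w, so each term contributes one Fourier coefficient.\<close>

lemma integrable_fejer_kernel_mult:
  assumes "cmod z = 1" "integrable circle g"
  shows "integrable circle (\<lambda>w. g w * of_real (fejer_kernel N (z * cnj w)))"
    and "(LINT w|circle. g w * of_real (fejer_kernel N (z * cnj w))) = fejer N g z"
proof -
  have eq: "g w * of_real (fejer_kernel N (z * cnj w)) =
      (\<Sum>k\<in>{- int N..int N}. of_real (fejer_coef N k) * zchar k z * (g w * zchar (- k) w))" if "cmod w = 1" for w
  proof -
    have "cmod (z * cnj w) = 1" using assms that by (simp add: norm_mult)
    from fejer_kernel_eq[OF this] show ?thesis
      by (simp add: sum_distrib_left zchar_mult_cnj[OF assms(1)] zchar_uminus[OF that] mult_ac)
  qed
  have i: "integrable circle (\<lambda>w. \<Sum>k\<in>{- int N..int N}. of_real (fejer_coef N k) * zchar k z * (g w * zchar (- k) w))"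
    by (intro Bochner_Integration.integrable_sum integrable_mult_right integrable_mult_zchar assms)
  show "integrable circle (\<lambda>w. g w * of_real (fejer_kernel N (z * cnj w)))"
    using i by (subst Bochner_Integration.integrable_cong[OF refl eq]) auto
  have "(LINT w|circle. g w * of_real (fejer_kernel N (z * cnj w))) =
      (LINT w|circle. (\<Sum>k\<in>{- int N..int N}. of_real (fejer_coef N k) * zchar k z * (g w * zchar (- k) w)))"
    by (intro Bochner_Integration.integral_cong) (auto simp: eq)
  also have "\<dots> = (\<Sum>k\<in>{- int N..int N}. LINT w|circle. of_real (fejer_coef N k) * zchar k z * (g w * zchar (- k) w))"
    by (intro Bochner_Integration.integral_sum integrable_mult_right integrable_mult_zchar assms)
  also have "\<dots> = fejer N g z"
    unfolding integral_mult_right_zero fejer_def fcoef_def by (simp add: mult_ac)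
  finally show "(LINT w|circle. g w * of_real (fejer_kernel N (z * cnj w))) = fejer N g z" .
qed

lemma integral_fejer_kernel:
  assumes "cmod z = 1"
  shows "integrable circle (\<lambda>w. fejer_kernel N (z * cnj w))" "(LINT w|circle. fejer_kernel N (z * cnj w)) = 1"
proof -
  have "fejer N (\<lambda>_. 1) z = 1"
  proof -
    have "zchar 0 = (\<lambda>_. 1)" by (rule ext) simp
    hence "fcoef (\<lambda>_. 1) k = (if k = 0 then 1 else 0)" for k using fcoef_zchar[of 0 k] by simp
    hence "fejer N (\<lambda>_. 1) z = (\<Sum>k\<in>{- int N..int N}. if k = 0 then 1 else 0)"
      unfolding fejer_def by (intro sum.cong) auto
    thus ?thesis by simp
  qed
  moreover have "(LINT w|circle. complex_of_real (fejer_kernel N (z * cnj w))) = fejer N (\<lambda>_. 1) z"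
    using integrable_fejer_kernel_mult(2)[OF assms, of "\<lambda>_. 1"] by simp
  ultimately have "complex_of_real (LINT w|circle. fejer_kernel N (z * cnj w)) = 1" by simp
  thus "(LINT w|circle. fejer_kernel N (z * cnj w)) = 1" using of_real_eq_1_iff by blast
  show "integrable circle (\<lambda>w. fejer_kernel N (z * cnj w))"
    using integrable_fejer_kernel_mult(1)[OF assms, of "\<lambda>_. 1"] by (simp add: complex_of_real_integrable_eq)
qed

text \<open>A convex function lies above its tangent at y; here this is Young's inequality for u and
  y powr (p - 1). It supplies the supporting line for Jensen's inequality.\<close>

lemma powr_tangent_le:
  fixes u y p :: real
  assumes "p \<ge> 1" "u \<ge> 0" "y \<ge> 0"
  shows "y powr p + p * y powr (p - 1) * (u - y) \<le> u powr p"
proof (cases "p = 1 \<or> y = 0")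
  case True
  thus ?thesis using assms by auto
next
  case False
  define q where "q = p / (p - 1)"
  have pq: "p > 1" "q > 1" "1 / p + 1 / q = 1" "(p - 1) * q = p"
    using False assms by (auto simp: q_def field_simps)
  have "u * y powr (p - 1) \<le> u powr p / p + (y powr (p - 1)) powr q / q"
    by (rule Youngs_inequality) (use pq assms in auto)
  also have "(y powr (p - 1)) powr q = y powr p" using pq by (simp add: powr_powr)
  also have "1 / q = 1 - 1 / p" using pq by simp
  hence "y powr p / q = y powr p * (1 - 1 / p)" by (metis times_divide_eq_right mult.right_neutral)
  finally have "p * (u * y powr (p - 1)) \<le> p * (u powr p / p + y powr p * (1 - 1 / p))"
    using pq(1) by (intro mult_left_mono) auto
  also have "\<dots> = u powr p + (p - 1) * y powr p" using pq(1) by (simp add: field_simps)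
  finally have *: "p * (u * y powr (p - 1)) \<le> u powr p + (p - 1) * y powr p" .
  have "y powr (p - 1) * y = y powr p" 
    using powr_add[of y "p - 1" 1] assms False by simp
  moreover have "p * y powr (p - 1) * (u - y) = p * (u * y powr (p - 1)) - p * (y powr (p - 1) * y)"
    "(p - 1) * y powr p = p * y powr p - y powr p"
    by (simp_all only: left_diff_distrib right_diff_distrib mult_ac mult_1_left)
  ultimately show ?thesis using * by simp
qed

text \<open>Jensen's inequality for the probability measure with density the Fejer kernel. The right-hand
  side is again a Fejer mean, so that integrating it over the circle needs no Fubini theorem.\<close>

lemma fejer_powr_le:
  assumes "p \<ge> 1" and f: "f \<in> Lp_fun p circle" and z: "cmod z = 1"
  shows "cmod (fejer N f z) powr p \<le> Re (fejer N (\<lambda>w. of_real (cmod (f w) powr p)) z)"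
proof -
  let ?k = "\<lambda>w. fejer_kernel N (z * cnj w)"
  note fi = Lp_circle_integrable[OF assms(1) f]
  note pi = Lp_fun_integrable[OF f]
  have i1: "integrable circle (\<lambda>w. cmod (f w) * ?k w)"
    using integrable_norm[OF integrable_fejer_kernel_mult(1)[OF z fi, of N]]
    by (simp add: norm_mult fejer_kernel_nonneg)
  have pi': "integrable circle (\<lambda>w. complex_of_real (cmod (f w) powr p))" using pi by (simp add: complex_of_real_integrable_eq)
  have i2: "integrable circle (\<lambda>w. cmod (f w) powr p * ?k w)"
    using integrable_fejer_kernel_mult(1)[OF z pi', of N] by (simp flip: of_real_mult add: complex_of_real_integrable_eq)
  define y where "y = (LINT w|circle. cmod (f w) * ?k w)"
  have y0: "y \<ge> 0" unfolding y_def by (intro integral_nonneg_AE) (auto simp: fejer_kernel_nonneg)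
  have "cmod (fejer N f z) \<le> (LINT w|circle. cmod (f w * of_real (?k w)))"
    unfolding integrable_fejer_kernel_mult(2)[OF z fi, symmetric] by (rule integral_norm_bound)
  also have "\<dots> = y" by (simp add: y_def norm_mult fejer_kernel_nonneg)
  finally have "cmod (fejer N f z) powr p \<le> y powr p" using assms(1) by (intro powr_mono2) auto
  \<comment> \<open>The added term integrates to p * y powr (p - 1) * (y - y) = 0, because y is the
    kernel average of |f|; now the tangent inequality applies pointwise.\<close>
  also have "y powr p = (LINT w|circle. y powr p * ?k w + p * y powr (p - 1) * (cmod (f w) * ?k w - y * ?k w))"
    using i1 integral_fejer_kernel[OF z, of N] by (simp add: y_def[symmetric])
  also have "\<dots> \<le> (LINT w|circle. cmod (f w) powr p * ?k w)"
  proof (rule integral_mono)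
    fix w
    have "(y powr p + p * y powr (p - 1) * (cmod (f w) - y)) * ?k w \<le> cmod (f w) powr p * ?k w"
      using y0 assms(1) by (intro mult_right_mono powr_tangent_le fejer_kernel_nonneg) auto
    thus "y powr p * ?k w + p * y powr (p - 1) * (cmod (f w) * ?k w - y * ?k w) \<le> cmod (f w) powr p * ?k w"
      by (simp add: algebra_simps)
  qed (use i1 i2 integral_fejer_kernel[OF z, of N] in auto)
  also have "complex_of_real (LINT w|circle. cmod (f w) powr p * ?k w) = fejer N (\<lambda>w. of_real (cmod (f w) powr p)) z"
    unfolding integrable_fejer_kernel_mult(2)[OF z pi', symmetric] by (simp flip: integral_complex_of_real)
  hence "(LINT w|circle. cmod (f w) powr p * ?k w) = Re (fejer N (\<lambda>w. of_real (cmod (f w) powr p)) z)"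
    by (metis Re_complex_of_real)
  finally show ?thesis .
qed

lemma fejer_Lp: "p > 0 \<Longrightarrow> fejer N f \<in> Lp_fun p circle"
  by (rule trig_Lp[OF trig_fejer])

text \<open>The mean of a Fejer mean is its coefficient of index 0, which carries weight 1; so the
  right-hand side of \<open>fejer_powr_le\<close> integrates to the integral of |f| powr p.\<close>

theorem pnorm_fejer_le:
  assumes "p \<ge> 1" and f: "f \<in> Lp_fun p circle"
  shows "pnorm p circle (fejer N f) \<le> pnorm p circle f"
proof -
  let ?g = "\<lambda>w. complex_of_real (cmod (f w) powr p)"
  have p0: "p > 0" using assms by simp
  have gi: "integrable circle (fejer N ?g)"
    by (rule Lp_circle_integrable[of 1]) (auto intro: fejer_Lp)
  have "(LINT z|circle. cmod (fejer N f z) powr p) \<le> (LINT z|circle. Re (fejer N ?g z))"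
    by (intro integral_mono_AE Lp_fun_integrable fejer_Lp p0 integrable_Re gi)
       (rule AE_I2, use fejer_powr_le[OF assms] in simp)
  also have "\<dots> = Re (LINT z|circle. fejer N ?g z)" using gi by simp
  also have "(LINT z|circle. fejer N ?g z) = fcoef (fejer N ?g) 0" by (simp add: fcoef_def)
  also have "\<dots> = fcoef ?g 0" by (simp add: fcoef_fejer)
  also have "\<dots> = complex_of_real (LINT z|circle. cmod (f z) powr p)" by (simp add: fcoef_def)
  finally show ?thesis using p0 unfolding pnorm_le_iff[OF p0 pnorm_nonneg] by (simp add: pnorm_powr)
qed

lemma fejer_tendsto_trig:
  assumes "p \<ge> 1" "trig g"
  shows "(\<lambda>N. pnorm p circle (\<lambda>z. g z - fejer N g z)) \<longlonglongrightarrow> 0"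
  using assms(2)
proof induction
  case trig_zero
  have "fejer N (\<lambda>_. 0) z = 0" for N z by (simp add: fejer_def fcoef_def)
  thus ?case by simp
next
  case (trig_add_zchar g c k)
  have p0: "p > 0" using assms by simp
  have eq: "(\<lambda>z. (g z + c * zchar k z) - fejer N (\<lambda>z. g z + c * zchar k z) z) =
      (\<lambda>z. (g z - fejer N g z) + c * (1 - of_real (fejer_coef N k)) * zchar k z)" for N
  proof
    fix z
    have "fejer N (\<lambda>z. g z + c * zchar k z) z = fejer N g z + fejer N (\<lambda>z. c * zchar k z) z"
      by (intro fejer_add Lp_circle_integrable[of 1] trig_Lp trig_zchar trig_add_zchar.hyps) auto
    also have "fejer N (\<lambda>z. c * zchar k z) z = (\<Sum>j\<in>{- int N..int N}. if j = k then of_real (fejer_coef N k) * c * zchar k z else 0)"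
      unfolding fejer_def by (intro sum.cong) (auto simp: fcoef_cmult fcoef_zchar)
    also have "\<dots> = of_real (fejer_coef N k) * c * zchar k z"
      by (auto simp: fejer_coef_def)
    finally show "(g z + c * zchar k z) - fejer N (\<lambda>z. g z + c * zchar k z) z = (g z - fejer N g z) + c * (1 - of_real (fejer_coef N k)) * zchar k z"
      by (simp add: algebra_simps)
  qed
  have le: "pnorm p circle (\<lambda>z. (g z + c * zchar k z) - fejer N (\<lambda>z. g z + c * zchar k z) z) \<le>
     pnorm p circle (\<lambda>z. g z - fejer N g z) + cmod c * (1 - fejer_coef N k)" for N
  proof -
    have "pnorm p circle (\<lambda>z. (g z - fejer N g z) + c * (1 - of_real (fejer_coef N k)) * zchar k z) \<le>
       pnorm p circle (\<lambda>z. g z - fejer N g z) + pnorm p circle (\<lambda>z. c * (1 - of_real (fejer_coef N k)) * zchar k z)"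
      by (intro pnorm_triangle pnorm_triangle_diff assms trig_Lp trig_fejer trig_zchar p0 trig_add_zchar.hyps)
    also have "pnorm p circle (\<lambda>z. c * (1 - of_real (fejer_coef N k)) * zchar k z) = cmod (c * (1 - of_real (fejer_coef N k))) * pnorm p circle (zchar k)"
      by (rule pnorm_cmult[OF p0])
    also have "cmod (c * (1 - of_real (fejer_coef N k))) = cmod c * (1 - fejer_coef N k)"
    proof -
      have "1 - complex_of_real (fejer_coef N k) = complex_of_real (1 - fejer_coef N k)" by simp
      thus ?thesis using fejer_coef_bounds(2)[of N k] by (simp only: norm_mult norm_of_real)
    qed
    also have "cmod c * (1 - fejer_coef N k) * pnorm p circle (zchar k) \<le> cmod c * (1 - fejer_coef N k) * 1"
      using fejer_coef_bounds(2)[of N k] by (intro mult_left_mono pnorm_zchar_le p0) auto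
    finally show ?thesis unfolding eq by simp
  qed
  show ?case
  proof (rule tendsto_sandwich[OF _ _ tendsto_const])
    show "(\<lambda>N. pnorm p circle (\<lambda>z. g z - fejer N g z) + cmod c * (1 - fejer_coef N k)) \<longlonglongrightarrow> 0"
      using tendsto_add[OF trig_add_zchar.IH tendsto_mult_left[OF tendsto_diff[OF tendsto_const fejer_coef_lim], of "cmod c" 1 k]] by simp
  qed (use le in auto)
qed

theorem fejer_tendsto:
  assumes "p \<ge> 1" "f \<in> Lp_fun p circle"
  shows "(\<lambda>N. pnorm p circle (\<lambda>z. f z - fejer N f z)) \<longlonglongrightarrow> 0"
proof (rule LIMSEQ_I)
  fix e :: real assume "e > 0"
  have p0: "p > 0" using assms by simp
  obtain g where g: "trig g" "pnorm p circle (\<lambda>z. f z - g z) < e / 3"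
    using trig_dense_Lp[OF assms, of "e/3"] \<open>e > 0\<close> by auto
  have "\<forall>\<^sub>F N in sequentially. pnorm p circle (\<lambda>z. g z - fejer N g z) < e / 3"
    by (rule order_tendstoD(2)[OF fejer_tendsto_trig[OF assms(1) g(1)]]) (use \<open>e > 0\<close> in simp)
  then obtain K where K: "\<And>N. N \<ge> K \<Longrightarrow> pnorm p circle (\<lambda>z. g z - fejer N g z) < e / 3"
    by (auto simp: eventually_sequentially)
  have gL: "g \<in> Lp_fun p circle" by (rule trig_Lp[OF g(1) p0])
  note d = pnorm_triangle_diff(1)[OF assms(1)]
  have "norm (pnorm p circle (\<lambda>z. f z - fejer N f z) - 0) < e" if "N \<ge> K" for N
  proof -
    \<comment> \<open>The last term is a Fejer mean of f - g and hence no larger than f - g, so the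
      approximation error is counted twice: three thirds of e in all.\<close>
    have dec: "f z - fejer N f z = ((f z - g z) + (g z - fejer N g z)) - fejer N (\<lambda>w. f w - g w) z" for z
      using fejer_diff[OF Lp_circle_integrable[OF assms(1,2)] Lp_circle_integrable[OF assms(1) gL]] by simp
    have "pnorm p circle (\<lambda>z. f z - fejer N f z) \<le> pnorm p circle (\<lambda>z. (f z - g z) + (g z - fejer N g z)) + pnorm p circle (fejer N (\<lambda>w. f w - g w))"
      unfolding dec by (intro pnorm_triangle_diff pnorm_triangle assms d gL fejer_Lp p0)
    also have "\<dots> \<le> (pnorm p circle (\<lambda>z. f z - g z) + pnorm p circle (\<lambda>z. g z - fejer N g z)) + pnorm p circle (\<lambda>z. f z - g z)"
      by (intro add_mono pnorm_triangle pnorm_fejer_le assms d gL fejer_Lp p0)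
    also have "\<dots> < e" using g(2) K[OF that] by simp
    finally show ?thesis by simp
  qed
  thus "\<exists>K. \<forall>N\<ge>K. norm (pnorm p circle (\<lambda>z. f z - fejer N f z) - 0) < e" by blast
qed

text \<open>All Fejer means of f vanish, and they converge to f.\<close>

theorem fcoef_unique:
  assumes "f \<in> Lp_fun p circle" "p \<ge> 1" "\<And>k. fcoef f k = 0"
  shows "AE z in circle. f z = 0"
proof -
  have "fejer N f z = 0" for N z by (simp add: fejer_def assms(3))
  with fejer_tendsto[OF assms(2,1)] have "pnorm p circle f = 0" by (simp add: LIMSEQ_const_iff)
  thus ?thesis using assms by (intro pnorm_eq_0_AE) auto
qed

section \<open>Riesz--Thorin interpolation\<close>

text \<open>Hadamard's three lines theorem. Dividing by M0 powr (1 - z) * M1 powr z normalises both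
  edges to 1, and the factor exp (e * (z^2 - 1)) forces decay as |Im z| grows, so that the maximum
  principle on a rectangle suffices. Finally e tends to 0.\<close>

lemma three_lines:
  assumes hol: "\<Phi> holomorphic_on UNIV"
    and bnd: "\<And>z. 0 \<le> Re z \<Longrightarrow> Re z \<le> 1 \<Longrightarrow> cmod (\<Phi> z) \<le> K"
    and M: "M0 > 0" "M1 > 0" "\<And>y. cmod (\<Phi> (Complex 0 y)) \<le> M0" "\<And>y. cmod (\<Phi> (Complex 1 y)) \<le> M1"
    and t: "0 \<le> t" "t \<le> 1"
  shows "cmod (\<Phi> (of_real t)) \<le> M0 powr (1 - t) * M1 powr t"
proof -
  have K0: "K \<ge> 0" using order_trans[OF norm_ge_zero bnd[of 0]] by simp
  define l0 l1 where "l0 = ln M0" and "l1 = ln M1"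
  define D where "D = exp (\<bar>l0\<bar> + \<bar>l1\<bar>)"
  have main: "cmod (\<Phi> (of_real t)) \<le> exp ((1 - t) * l0 + t * l1) * exp (e * (1 - t\<^sup>2))" if "e > 0" for e
  proof -
    define \<Psi> where "\<Psi> z = \<Phi> z * exp ((z - 1) * of_real l0 - z * of_real l1 + of_real e * (z\<^sup>2 - 1))" for z
    have nPsi: "cmod (\<Psi> z) = cmod (\<Phi> z) * exp ((Re z - 1) * l0 - Re z * l1 + e * ((Re z)\<^sup>2 - (Im z)\<^sup>2 - 1))" for z
      by (simp add: \<Psi>_def norm_mult norm_exp_eq_Re power2_eq_square)
    \<comment> \<open>On the horizontal edges |\<Psi>| is at most K * D * exp (-x) with x = e * R^2,
      and K * D \<le> x makes this at most x * exp (-x) \<le> 1. The added 1 keeps R positive when K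
      = 0.\<close>
    define R where "R = sqrt (K * D / e) + 1"
    have R: "R > 0" "e * R\<^sup>2 \<ge> K * D"
    proof -
      have "sqrt (K * D / e) \<ge> 0" using K0 that by (simp add: D_def)
      thus "R > 0" unfolding R_def by linarith
      have "K * D / e = (sqrt (K * D / e))\<^sup>2" using K0 that by (simp add: D_def)
      also have "\<dots> \<le> R\<^sup>2" unfolding R_def using \<open>sqrt (K * D / e) \<ge> 0\<close> by (intro power_mono) auto
      finally show "e * R\<^sup>2 \<ge> K * D" using that by (simp add: field_simps)
    qed
    define S where "S = cbox (Complex 0 (- R)) (Complex 1 R)"
    have "cmod (\<Psi> (of_real t)) \<le> 1"
    proof (rule maximum_modulus_frontier[where S = S and f = \<Psi> and \<xi> = "of_real t"])
      have hol': "\<Psi> holomorphic_on UNIV" unfolding \<Psi>_def by (intro holomorphic_intros hol)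
      show "\<Psi> holomorphic_on interior S" by (rule holomorphic_on_subset[OF hol']) auto
      show "continuous_on (closure S) \<Psi>"
        by (rule continuous_on_subset[OF holomorphic_on_imp_continuous_on[OF hol']]) auto
      show "bounded S" by (simp add: S_def)
      show "of_real t \<in> S" using t R by (simp add: S_def in_cbox_complex_iff)
      fix z assume "z \<in> frontier S"
      hence z: "0 \<le> Re z" "Re z \<le> 1" "\<bar>Im z\<bar> \<le> R" "Re z = 0 \<or> Re z = 1 \<or> \<bar>Im z\<bar> = R"
        by (auto simp: S_def frontier_cbox in_cbox_complex_iff in_box_complex_iff)
      from z(4) consider "Re z = 0" | "Re z = 1" | "\<bar>Im z\<bar> = R" by blast
      thus "cmod (\<Psi> z) \<le> 1"
      proof cases
        case 1
        hence "z = Complex 0 (Im z)" by (simp add: complex_eq_iff)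
        hence "cmod (\<Phi> z) \<le> M0" using M(3) by metis
        hence "cmod (\<Psi> z) \<le> M0 * exp (- l0)"
          unfolding nPsi using M(1) that 1 by (intro mult_mono) (auto simp: algebra_simps intro!: add_nonneg_nonneg)
        also have "\<dots> = 1" using M(1) by (simp add: l0_def exp_minus)
        finally show ?thesis .
      next
        case 2
        hence "z = Complex 1 (Im z)" by (simp add: complex_eq_iff)
        hence "cmod (\<Phi> z) \<le> M1" using M(4) by metis
        hence "cmod (\<Psi> z) \<le> M1 * exp (- l1)"
          unfolding nPsi using M(2) that 2 by (intro mult_mono) (auto simp: algebra_simps)
        also have "\<dots> = 1" using M(2) by (simp add: l1_def exp_minus)
        finally show ?thesis .
      next
        case 3
        hence im: "(Im z)\<^sup>2 = R\<^sup>2" by (metis power2_abs)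
        have "(Re z)\<^sup>2 \<le> 1" using z by (simp add: power_le_one)
        hence a: "e * ((Re z)\<^sup>2 - (Im z)\<^sup>2 - 1) \<le> - (e * R\<^sup>2)" 
          unfolding im using that mult_left_mono[of "(Re z)\<^sup>2" 1 e] by (simp add: algebra_simps)
        have b: "(Re z - 1) * l0 \<le> \<bar>l0\<bar>" 
        proof -
          have "\<bar>(Re z - 1) * l0\<bar> \<le> 1 * \<bar>l0\<bar>" unfolding abs_mult using z by (intro mult_right_mono) auto
          thus ?thesis by linarith
        qed
        have c: "- (Re z * l1) \<le> \<bar>l1\<bar>"
        proof -
          have "\<bar>Re z * l1\<bar> \<le> 1 * \<bar>l1\<bar>" unfolding abs_mult using z by (intro mult_right_mono) auto
          thus ?thesis by linarith
        qed
        have "cmod (\<Psi> z) \<le> K * exp ((\<bar>l0\<bar> + \<bar>l1\<bar>) + - (e * R\<^sup>2))"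
          unfolding nPsi using a b c K0 z by (intro mult_mono bnd) auto
        also have "\<dots> = K * D * exp (- (e * R\<^sup>2))" by (simp add: D_def mult_exp_exp)
        also have "\<dots> \<le> (e * R\<^sup>2) * exp (- (e * R\<^sup>2))" using R by (intro mult_right_mono) auto
        also have "\<dots> \<le> exp (e * R\<^sup>2) * exp (- (e * R\<^sup>2))"
        proof (rule mult_right_mono)
          show "e * R\<^sup>2 \<le> exp (e * R\<^sup>2)" using exp_ge_add_one_self[of "e * R\<^sup>2"] by linarith
        qed simp
        also have "\<dots> = 1" by (simp add: mult_exp_exp)
        finally show ?thesis .
      qed
    qed
    hence *: "cmod (\<Phi> (of_real t)) * exp ((t - 1) * l0 - t * l1 + e * (t\<^sup>2 - 1)) \<le> 1" by (simp add: nPsi)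
    have "cmod (\<Phi> (of_real t)) = cmod (\<Phi> (of_real t)) * exp ((t - 1) * l0 - t * l1 + e * (t\<^sup>2 - 1)) * (exp ((1 - t) * l0 + t * l1) * exp (e * (1 - t\<^sup>2)))"
      unfolding mult.assoc mult_exp_exp by (simp add: algebra_simps)
    also have "\<dots> \<le> 1 * (exp ((1 - t) * l0 + t * l1) * exp (e * (1 - t\<^sup>2)))"
      by (intro mult_right_mono *) auto
    finally show ?thesis by simp
  qed
  have "((\<lambda>e. exp ((1 - t) * l0 + t * l1) * exp (e * (1 - t\<^sup>2))) \<longlongrightarrow> exp ((1 - t) * l0 + t * l1) * exp (0 * (1 - t\<^sup>2))) (at_right 0)"
    by (intro tendsto_intros)
  moreover have "\<forall>\<^sub>F e in at_right 0. cmod (\<Phi> (of_real t)) \<le> exp ((1 - t) * l0 + t * l1) * exp (e * (1 - t\<^sup>2))"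
    using main by (auto simp: eventually_at_right_field intro!: exI[of _ 1])
  ultimately have "cmod (\<Phi> (of_real t)) \<le> exp ((1 - t) * l0 + t * l1) * exp (0 * (1 - t\<^sup>2))"
    by (intro tendsto_lowerbound[where F="at_right 0"]) auto
  also have "\<dots> = M0 powr (1 - t) * M1 powr t"
    using M by (simp add: powr_def l0_def l1_def exp_add)
  finally show ?thesis .
qed

text \<open>The setting for Riesz--Thorin: on a finite measure space simple functions lie in every
  \<open>L\<^sup>p\<close>, and the analytic family below becomes a finite sum. \<open>cong\<close>
  expresses that only values on the space count, which permits the expansion over level
  sets.\<close>

locale simple_bilinear = finite_measure M for M :: "'a measure" +
  fixes B :: "('a \<Rightarrow> complex) \<Rightarrow> ('a \<Rightarrow> complex) \<Rightarrow> complex"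
  assumes add_left: "\<And>f f' g. simple_function M f \<Longrightarrow> simple_function M f' \<Longrightarrow> simple_function M g \<Longrightarrow> B (\<lambda>x. f x + f' x) g = B f g + B f' g"
    and add_right: "\<And>f g g'. simple_function M f \<Longrightarrow> simple_function M g \<Longrightarrow> simple_function M g' \<Longrightarrow> B f (\<lambda>x. g x + g' x) = B f g + B f g'"
    and scale_left: "\<And>c f g. simple_function M f \<Longrightarrow> simple_function M g \<Longrightarrow> B (\<lambda>x. c * f x) g = c * B f g"
    and scale_right: "\<And>c f g. simple_function M f \<Longrightarrow> simple_function M g \<Longrightarrow> B f (\<lambda>x. c * g x) = c * B f g"
    and cong: "\<And>f f' g g'. (\<And>x. x \<in> space M \<Longrightarrow> f x = f' x) \<Longrightarrow> (\<And>x. x \<in> space M \<Longrightarrow> g x = g' x) \<Longrightarrow> B f g = B f' g'"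
begin

lemma simple_sum:
  assumes "finite C" "\<And>c. c \<in> C \<Longrightarrow> simple_function M (S c)"
  shows "simple_function M (\<lambda>x. \<Sum>c\<in>C. a c * S c x :: complex)"
  using assms by (intro simple_function_sum simple_function_mult) auto

lemma simple_smult: "simple_function M f \<Longrightarrow> simple_function M (\<lambda>x. a * f x :: complex)"
  by (intro simple_function_mult) auto

lemma sum_left:
  assumes "finite C" "\<And>c. c \<in> C \<Longrightarrow> simple_function M (S c)" "simple_function M g"
  shows "B (\<lambda>x. \<Sum>c\<in>C. a c * S c x) g = (\<Sum>c\<in>C. a c * B (S c) g)"
  using assms(1,2)
proof (induction C rule: finite_induct)
  case empty
  show ?case using scale_left[of "\<lambda>_. 0" g 0] assms(3) by simp
next
  case (insert c C)
  thus ?case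
    using add_left[of "\<lambda>x. a c * S c x" "\<lambda>x. \<Sum>c\<in>C. a c * S c x" g] scale_left[of "S c" g "a c"] assms(3)
    by (simp add: simple_sum simple_smult)
qed

lemma sum_right:
  assumes "finite C" "\<And>c. c \<in> C \<Longrightarrow> simple_function M (S c)" "simple_function M f"
  shows "B f (\<lambda>x. \<Sum>c\<in>C. a c * S c x) = (\<Sum>c\<in>C. a c * B f (S c))"
  using assms(1,2)
proof (induction C rule: finite_induct)
  case empty
  show ?case using scale_right[of f "\<lambda>_. 0" 0] assms(3) by simp
next
  case (insert c C)
  thus ?case
    using add_right[of f "\<lambda>x. a c * S c x" "\<lambda>x. \<Sum>c\<in>C. a c * S c x"] scale_right[of f "S c" "a c"] assms(3)
    by (simp add: simple_sum simple_smult)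
qed

text \<open>The inner values of B do not depend on u and v. When u and v vary analytically with a
  parameter, so does the whole sum, and bounds on the finitely many values bound it.\<close>

lemma expand:
  fixes f g :: "'a \<Rightarrow> complex"
  assumes f: "simple_function M f" and g: "simple_function M g"
  shows "B (\<lambda>x. u (f x)) (\<lambda>x. v (g x)) =
    (\<Sum>c\<in>f ` space M. \<Sum>d\<in>g ` space M. u c * v d * B (indicator (f -` {c} \<inter> space M)) (indicator (g -` {d} \<inter> space M)))"
proof -
  have ind: "simple_function M (indicator (h -` {c} \<inter> space M) :: 'a \<Rightarrow> complex)" if "simple_function M h" for h c
    by (intro simple_function_indicator simple_functionD(2)[OF that])
  have rep: "w (h x) = (\<Sum>c\<in>h ` space M. w c * indicator (h -` {c} \<inter> space M) x)"
    if "simple_function M h" "x \<in> space M" for h :: "'a \<Rightarrow> complex" and w :: "complex \<Rightarrow> complex" and x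
  proof -
    have "(\<Sum>c\<in>h ` space M. w c * indicator (h -` {c} \<inter> space M) x) = (\<Sum>c\<in>h ` space M. if c = h x then w c else 0)"
      using that by (intro sum.cong) (auto simp: indicator_def)
    thus ?thesis using that simple_functionD(1)[OF that(1)] by simp
  qed
  have fin: "finite (f ` space M)" "finite (g ` space M)" using simple_functionD(1) f g by auto
  have "B (\<lambda>x. u (f x)) (\<lambda>x. v (g x)) =
     B (\<lambda>x. \<Sum>c\<in>f ` space M. u c * indicator (f -` {c} \<inter> space M) x) (\<lambda>x. \<Sum>d\<in>g ` space M. v d * indicator (g -` {d} \<inter> space M) x)"
    by (rule cong) (rule rep[OF f, of _ u] rep[OF g, of _ v]; assumption)+
  also have "\<dots> = (\<Sum>c\<in>f ` space M. u c * B (indicator (f -` {c} \<inter> space M)) (\<lambda>x. \<Sum>d\<in>g ` space M. v d * indicator (g -` {d} \<inter> space M) x))"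
    by (intro sum_left fin ind f simple_sum g)
  also have "\<dots> = (\<Sum>c\<in>f ` space M. u c * (\<Sum>d\<in>g ` space M. v d * B (indicator (f -` {c} \<inter> space M)) (indicator (g -` {d} \<inter> space M))))"
    by (intro sum.cong refl arg_cong2[where f="(*)"] sum_right fin ind f g)
  finally show ?thesis by (simp add: sum_distrib_left mult.assoc)
qed

text \<open>The analytic family of the Riesz--Thorin proof applied to a single value c: the phase of
  c is kept and |c| is raised to the power p * ((1 - z)/p0 + z/p1). The modulus is |c| powr (p/p0)
  on Re z = 0 and |c| powr (p/p1) on Re z = 1, and at the interpolation parameter the value is
  c.\<close>

definition rt_power :: "real \<Rightarrow> real \<Rightarrow> real \<Rightarrow> complex \<Rightarrow> complex \<Rightarrow> complex" where
  "rt_power p p0 p1 z c = (if c = 0 then 0 else sgn c * exp (of_real p * ((1 - z) / of_real p0 + z / of_real p1) * of_real (ln (cmod c))))"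

lemma norm_rt_power:
  "cmod (rt_power p p0 p1 z c) = (if c = 0 then 0 else cmod c powr (p * ((1 - Re z) / p0 + Re z / p1)))"
  by (auto simp: rt_power_def norm_mult norm_sgn norm_exp_eq_Re powr_def)

lemma rt_power_theta:
  assumes "p > 0" "1 / p = (1 - t) / p0 + t / p1"
  shows "rt_power p p0 p1 (of_real t) c = c"
proof (cases "c = 0")
  case False
  have "of_real p * ((1 - of_real t) / of_real p0 + of_real t / of_real p1) = complex_of_real (p * ((1 - t) / p0 + t / p1))"
    by simp
  also have "p * ((1 - t) / p0 + t / p1) = 1" unfolding assms(2)[symmetric] using assms(1) by simp
  finally show ?thesis using False by (simp add: rt_power_def exp_of_real sgn_eq)
qed (simp add: rt_power_def)

lemma pnorm_rt_power:
  assumes "p0 > 0" "p1 > 0" "p > 0" "pnorm p M f = 1"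
  shows "pnorm p0 M (\<lambda>x. rt_power p p0 p1 (Complex 0 y) (f x)) = 1"
    and "pnorm p1 M (\<lambda>x. rt_power p p0 p1 (Complex 1 y) (f x)) = 1"
proof -
  have I: "(LINT x|M. cmod (f x) powr p) = 1" using pnorm_powr[OF assms(3), of M f] assms(4) by simp
  have "cmod (rt_power p p0 p1 (Complex 0 y) c) powr p0 = cmod c powr p"
    "cmod (rt_power p p0 p1 (Complex 1 y) c) powr p1 = cmod c powr p" for c
    using assms by (auto simp: norm_rt_power powr_powr)
  thus "pnorm p0 M (\<lambda>x. rt_power p p0 p1 (Complex 0 y) (f x)) = 1"
    "pnorm p1 M (\<lambda>x. rt_power p p0 p1 (Complex 1 y) (f x)) = 1"
    using I by (simp_all add: pnorm_def)
qed

lemma simple_Lp: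
  assumes "simple_function M f" "p > 0"
  shows "f \<in> Lp_fun p M"
proof -
  have "simple_function M (\<lambda>x. cmod (f x) powr p)" by (rule simple_function_compose1[OF assms(1)])
  hence "integrable M (\<lambda>x. cmod (f x) powr p)"
    by (intro integrable_simple_function) (auto simp: emeasure_eq_measure)
  thus ?thesis using borel_measurable_simple_function[OF assms(1)] by (simp add: Lp_fun_def)
qed

lemma pnorm_simple_0:
  assumes "simple_function M f" "p > 0" "pnorm p M f = 0"
  shows "pnorm p' M f = 0"
proof -
  have "AE x in M. f x = 0" by (rule pnorm_eq_0_AE[OF simple_Lp[OF assms(1,2)] assms(3,2)])
  hence "pnorm p' M f = pnorm p' M (\<lambda>_. 0)"
    using borel_measurable_simple_function[OF assms(1)] by (intro pnorm_cong_AE) auto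
  thus ?thesis by simp
qed

text \<open>After normalising f and g, the three lines theorem is applied to \<Phi>(z) = B (F_z)
  (G_z): on the two edges F_z and G_z have norm 1 in the endpoint spaces, and \<Phi>(t) = B f
  g.\<close>

theorem riesz_thorin:
  assumes pos: "p0 > 0" "p1 > 0" "q0 > 0" "q1 > 0" "p > 0" "q > 0" "M0 > 0" "M1 > 0" and t: "0 \<le> t" "t \<le> 1"
    and p: "1 / p = (1 - t) / p0 + t / p1" and q: "1 / q = (1 - t) / q0 + t / q1"
    and b0: "\<And>f g. simple_function M f \<Longrightarrow> simple_function M g \<Longrightarrow> cmod (B f g) \<le> M0 * pnorm p0 M f * pnorm q0 M g"
    and b1: "\<And>f g. simple_function M f \<Longrightarrow> simple_function M g \<Longrightarrow> cmod (B f g) \<le> M1 * pnorm p1 M f * pnorm q1 M g"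
    and f: "simple_function M f" and g: "simple_function M g"
  shows "cmod (B f g) \<le> M0 powr (1 - t) * M1 powr t * pnorm p M f * pnorm q M g"
proof -
  have normalised: "cmod (B f g) \<le> M0 powr (1 - t) * M1 powr t"
    if f: "simple_function M f" and g: "simple_function M g" and n: "pnorm p M f = 1" "pnorm q M g = 1" for f g
  proof -
    let ?F = "\<lambda>z x. rt_power p p0 p1 z (f x)" and ?G = "\<lambda>z x. rt_power q q0 q1 z (g x)"
    define \<Phi> where "\<Phi> z = B (?F z) (?G z)" for z
    note ex = expand[OF f g]
    have fin: "finite (f ` space M)" "finite (g ` space M)" using simple_functionD(1) f g by auto
    \<comment> \<open>\<open>three_lines\<close> asks for some bound in the whole strip, of any
      size; since f and g take finitely many values, it is enough to bound the family at each
      value.\<close>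
    have rtb: "\<exists>K\<ge>0. \<forall>z. 0 \<le> Re z \<longrightarrow> Re z \<le> 1 \<longrightarrow> cmod (rt_power p p0 p1 z c) \<le> K" if "p > 0" "p0 > 0" "p1 > 0" for p p0 p1 c
    proof (cases "c = 0")
      case False
      show ?thesis
      proof (intro exI[of _ "exp (p * (1 / p0 + 1 / p1) * \<bar>ln (cmod c)\<bar>)"] conjI allI impI)
        fix z assume z: "0 \<le> Re z" "Re z \<le> 1"
        have "p * ((1 - Re z) / p0 + Re z / p1) * ln (cmod c) \<le> p * ((1 - Re z) / p0 + Re z / p1) * \<bar>ln (cmod c)\<bar>"
          using that z by (intro mult_left_mono) (auto intro!: mult_nonneg_nonneg add_nonneg_nonneg)
        also have "\<dots> \<le> p * (1 / p0 + 1 / p1) * \<bar>ln (cmod c)\<bar>"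
          using that z by (intro mult_left_mono mult_right_mono add_mono divide_right_mono) auto
        finally show "cmod (rt_power p p0 p1 z c) \<le> exp (p * (1 / p0 + 1 / p1) * \<bar>ln (cmod c)\<bar>)"
          using False by (simp add: norm_rt_power powr_def)
      qed simp
    qed (auto simp: rt_power_def)
    have "\<exists>K. \<forall>z. 0 \<le> Re z \<longrightarrow> Re z \<le> 1 \<longrightarrow> cmod (\<Phi> z) \<le> K"
    proof -
      obtain Kf where Kf: "\<And>c. Kf c \<ge> 0" "\<And>c z. 0 \<le> Re z \<Longrightarrow> Re z \<le> 1 \<Longrightarrow> cmod (rt_power p p0 p1 z c) \<le> Kf c"
        using rtb[OF pos(5,1,2)] by metis
      obtain Kg where Kg: "\<And>c. Kg c \<ge> 0" "\<And>c z. 0 \<le> Re z \<Longrightarrow> Re z \<le> 1 \<Longrightarrow> cmod (rt_power q q0 q1 z c) \<le> Kg c"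
        using rtb[OF pos(6,3,4)] by metis
      show ?thesis
      proof (intro exI allI impI)
        fix z assume z: "0 \<le> Re z" "Re z \<le> 1"
        show "cmod (\<Phi> z) \<le> (\<Sum>c\<in>f ` space M. \<Sum>d\<in>g ` space M. Kf c * Kg d * cmod (B (indicator (f -` {c} \<inter> space M)) (indicator (g -` {d} \<inter> space M))))"
          unfolding \<Phi>_def ex
          by (intro sum_norm_le) (auto simp: norm_mult intro!: mult_mono mult_nonneg_nonneg Kf Kg z)
      qed
    qed
    then obtain K where K: "\<And>z. 0 \<le> Re z \<Longrightarrow> Re z \<le> 1 \<Longrightarrow> cmod (\<Phi> z) \<le> K" by blast
    have hol_rt: "(\<lambda>z. rt_power p p0 p1 z c) holomorphic_on UNIV" if "p0 > 0" "p1 > 0" for p p0 p1 c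
      using that unfolding rt_power_def by (cases "c = 0") (auto intro!: holomorphic_intros)
    have hol: "\<Phi> holomorphic_on UNIV"
      unfolding \<Phi>_def ex by (intro holomorphic_intros hol_rt pos)
    have sF: "simple_function M (?F z)" "simple_function M (?G z)" for z
      by (rule simple_function_compose1[OF f] simple_function_compose1[OF g])+
    have "cmod (\<Phi> (of_real t)) \<le> M0 powr (1 - t) * M1 powr t"
    proof (rule three_lines[OF hol K pos(7,8) _ _ t])
      show "cmod (\<Phi> (Complex 0 y)) \<le> M0" for y
        using b0[OF sF, of "Complex 0 y" "Complex 0 y"] pnorm_rt_power(1)[OF pos(1,2,5) n(1)] pnorm_rt_power(1)[OF pos(3,4,6) n(2)]
        by (simp add: \<Phi>_def)
      show "cmod (\<Phi> (Complex 1 y)) \<le> M1" for y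
        using b1[OF sF, of "Complex 1 y" "Complex 1 y"] pnorm_rt_power(2)[OF pos(1,2,5) n(1)] pnorm_rt_power(2)[OF pos(3,4,6) n(2)]
        by (simp add: \<Phi>_def)
    qed auto
    thus ?thesis by (simp add: \<Phi>_def rt_power_theta[OF pos(5) p] rt_power_theta[OF pos(6) q])
  qed
  show ?thesis
  proof (cases "pnorm p M f = 0 \<or> pnorm q M g = 0")
    \<comment> \<open>Normalisation is impossible here, but a simple function of norm 0 has norm 0
      for every exponent, so \<open>b0\<close> makes the left-hand side 0.\<close>
    case True
    hence "pnorm p0 M f = 0 \<or> pnorm q0 M g = 0"
      using pnorm_simple_0[OF f pos(5)] pnorm_simple_0[OF g pos(6)] by blast
    thus ?thesis using b0[OF f g] True by auto
  next
    case False
    define a b where "a = pnorm p M f" and "b = pnorm q M g"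
    have ab: "a > 0" "b > 0" using False pnorm_nonneg[of p M f] pnorm_nonneg[of q M g] by (auto simp: a_def b_def less_le)
    let ?f = "\<lambda>x. of_real (1 / a) * f x" and ?g = "\<lambda>x. of_real (1 / b) * g x"
    have s: "simple_function M ?f" "simple_function M ?g" by (intro simple_smult f g)+
    have "pnorm p M ?f = 1" "pnorm q M ?g = 1"
      unfolding pnorm_cmult[OF pos(5)] pnorm_cmult[OF pos(6)] a_def[symmetric] b_def[symmetric]
      using ab by (simp_all add: norm_divide)
    hence "cmod (B ?f ?g) \<le> M0 powr (1 - t) * M1 powr t"
      by (rule normalised[OF s])
    moreover have "B ?f ?g = of_real (1 / a) * (of_real (1 / b) * B f g)"
      by (simp only: scale_left[OF f s(2)] scale_right[OF f g])
    hence "cmod (B ?f ?g) = cmod (B f g) / (a * b)" using ab by (simp add: norm_mult norm_divide)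
    ultimately have "cmod (B f g) / (a * b) \<le> M0 powr (1 - t) * M1 powr t" by (simp only:)
    hence "cmod (B f g) \<le> M0 powr (1 - t) * M1 powr t * (a * b)" using ab by (simp add: pos_divide_le_eq)
    thus ?thesis by (simp add: a_def b_def mult.assoc)
  qed
qed

end

text \<open>The extremal test function |h| powr (p - 1) * cnj (sgn h) has integral n powr p against
  h and q-norm n powr (p - 1), where n is the norm of h. As h is in \<open>L\<^sup>p\<close>, n is
  finite and the quotient gives n \<le> C.\<close>

lemma Lp_dual_bound:
  assumes "p > 1" "1 / p + 1 / q = 1" and h: "h \<in> Lp_fun p M" and "C \<ge> 0"
    and C: "\<And>g. g \<in> Lp_fun q M \<Longrightarrow> cmod (LINT x|M. h x * g x) \<le> C * pnorm q M g"
  shows "pnorm p M h \<le> C"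
proof (cases "pnorm p M h = 0")
  case False
  define n where "n = pnorm p M h"
  have n: "n > 0" using False pnorm_nonneg[of p M h] by (simp add: n_def less_le)
  have pq: "(p - 1) * q = p" "q > 0" "p / q = p - 1"
  proof -
    have "inverse q = 1 - 1 / p" using assms by (simp add: inverse_eq_divide)
    hence "inverse q = (p - 1) / p" using assms by (simp add: diff_divide_distrib)
    hence "q = inverse ((p - 1) / p)" by (metis inverse_inverse_eq)
    hence q: "q = p / (p - 1)" by simp
    show "(p - 1) * q = p" "q > 0" "p / q = p - 1" using assms by (auto simp: q)
  qed
  note [measurable] = Lp_fun_measurable[OF h]
  define g where "g x = of_real (cmod (h x) powr (p - 1)) * cnj (sgn (h x))" for x
  have ng: "cmod (g x) = cmod (h x) powr (p - 1)" for x
    by (cases "h x = 0") (auto simp: g_def norm_mult norm_sgn)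
  have ngq: "cmod (g x) powr q = cmod (h x) powr p" for x unfolding ng powr_powr pq(1) ..
  have [measurable]: "(\<lambda>x. cnj (sgn (h x))) \<in> borel_measurable M"
    unfolding sgn_eq by (intro borel_measurable_continuous_on[where f=cnj]) (auto intro!: continuous_intros)
  have gm: "g \<in> borel_measurable M" unfolding g_def by measurable
  have gL: "g \<in> Lp_fun q M" using gm Lp_fun_integrable[OF h] by (simp add: Lp_fun_def ngq)
  have gn: "pnorm q M g = n powr (p - 1)"
  proof -
    have "pnorm q M g = (n powr p) powr (1 / q)"
      using pnorm_powr[of p M h] assms by (simp add: pnorm_def[of q] ngq n_def)
    thus ?thesis using pq(3) by (simp add: powr_powr)
  qed
  have "h x * g x = of_real (cmod (h x) powr p)" for x
  proof (cases "h x = 0")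
    case False
    have "h x * cnj (sgn (h x)) = of_real (cmod (h x))"
      using False by (simp add: sgn_eq complex_norm_square[symmetric] power2_eq_square)
    moreover have "cmod (h x) powr p = cmod (h x) powr (p - 1) * cmod (h x)"
      using False powr_add[of "cmod (h x)" "p - 1" 1] by simp
    ultimately show ?thesis by (simp add: g_def mult_ac)
  qed (use assms in \<open>simp add: g_def\<close>)
  hence "(LINT x|M. h x * g x) = of_real (n powr p)"
    using pnorm_powr[of p M h] assms by (simp add: n_def)
  hence "n powr p \<le> C * n powr (p - 1)" using C[OF gL] by (simp add: gn)
  moreover have "n powr p = n * n powr (p - 1)" using n powr_add[of n "p - 1" 1] by (simp add: mult.commute)
  ultimately show ?thesis using n by (simp add: n_def)
qed (use assms in simp)

section \<open>Fourier multipliers\<close>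

lemma fcoef_cnj: "fcoef (\<lambda>z. cnj (f z)) k = cnj (fcoef f (- k))"
proof -
  have "fcoef (\<lambda>z. cnj (f z)) k = (LINT z|circle. cnj (f z * zchar k z))"
    unfolding fcoef_def by (intro Bochner_Integration.integral_cong) (auto simp: zchar_uminus)
  thus ?thesis unfolding Bochner_Integration.integral_cnj by (simp add: fcoef_def)
qed

text \<open>\<open>l = 1\<close> with weights \<open>- fejer_coef N\<close> gives
  \<open>f - fejer N f\<close>, and \<open>l = 0\<close> on \<open>{0..int N}\<close> gives
  \<open>analytic_fejer\<close>. That the weights are real is what \<open>form_hermitian\<close>
  rests on.\<close>

locale multiplier =
  fixes l :: real and K :: "int set" and \<kappa> :: "int \<Rightarrow> real"
  assumes fin: "finite K"
begin

definition mult_op :: "(complex \<Rightarrow> complex) \<Rightarrow> complex \<Rightarrow> complex" where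
  "mult_op f z = of_real l * f z + (\<Sum>k\<in>K. of_real (\<kappa> k) * fcoef f k * zchar k z)"

definition coeff_sum :: real where "coeff_sum = \<bar>l\<bar> + (\<Sum>k\<in>K. \<bar>\<kappa> k\<bar>)"

text \<open>Each coefficient is at most the norm of f, and characters have norm at most 1. The bound
  grows with K; it serves to extend estimates from simple functions by continuity.\<close>

lemma mult_op_Lp:
  assumes "p \<ge> 1" "f \<in> Lp_fun p circle"
  shows "mult_op f \<in> Lp_fun p circle" "pnorm p circle (mult_op f) \<le> coeff_sum * pnorm p circle f"
proof -
  have p0: "p > 0" using assms by simp
  let ?S = "\<lambda>z. \<Sum>k\<in>K. of_real (\<kappa> k) * fcoef f k * zchar k z"
  have t: "(\<lambda>z. of_real (\<kappa> k) * fcoef f k * zchar k z) \<in> Lp_fun p circle" for k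
    by (intro Lp_fun_cmult zchar_Lp p0)
  have S: "?S \<in> Lp_fun p circle" "pnorm p circle ?S \<le> (\<Sum>k\<in>K. pnorm p circle (\<lambda>z. of_real (\<kappa> k) * fcoef f k * zchar k z))"
    using pnorm_sum[OF assms(1) fin t] by auto
  have l: "(\<lambda>z. of_real l * f z) \<in> Lp_fun p circle" by (intro Lp_fun_cmult assms)
  show "mult_op f \<in> Lp_fun p circle" unfolding mult_op_def by (rule pnorm_triangle(1)[OF assms(1) l S(1)])
  have "pnorm p circle (mult_op f) \<le> pnorm p circle (\<lambda>z. of_real l * f z) + pnorm p circle ?S"
    unfolding mult_op_def by (rule pnorm_triangle(2)[OF assms(1) l S(1)])
  also have "pnorm p circle (\<lambda>z. of_real l * f z) = \<bar>l\<bar> * pnorm p circle f"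
    by (simp add: pnorm_cmult[OF p0])
  also have "pnorm p circle ?S \<le> (\<Sum>k\<in>K. \<bar>\<kappa> k\<bar> * pnorm p circle f)"
  proof (rule order_trans[OF S(2)], rule sum_mono)
    fix k
    have "pnorm p circle (\<lambda>z. of_real (\<kappa> k) * fcoef f k * zchar k z) = \<bar>\<kappa> k\<bar> * cmod (fcoef f k) * pnorm p circle (zchar k)"
      by (simp only: pnorm_cmult[OF p0] norm_mult norm_of_real)
    also have "\<dots> \<le> \<bar>\<kappa> k\<bar> * pnorm p circle f * 1"
      by (intro mult_mono mult_left_mono norm_fcoef_le assms pnorm_zchar_le p0 mult_nonneg_nonneg) auto
    finally show "pnorm p circle (\<lambda>z. of_real (\<kappa> k) * fcoef f k * zchar k z) \<le> \<bar>\<kappa> k\<bar> * pnorm p circle f" by simp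
  qed
  finally show "pnorm p circle (mult_op f) \<le> coeff_sum * pnorm p circle f"
    by (simp add: coeff_sum_def ring_distribs sum_distrib_right)
qed

lemma coeff_sum_nonneg: "coeff_sum \<ge> 0"
  unfolding coeff_sum_def by (intro add_nonneg_nonneg sum_nonneg) auto

lemma mult_op_add:
  assumes "integrable circle f" "integrable circle g"
  shows "mult_op (\<lambda>z. f z + g z) z = mult_op f z + mult_op g z"
  by (simp add: mult_op_def fcoef_add[OF assms] sum.distrib[symmetric] algebra_simps)

lemma mult_op_diff:
  assumes "integrable circle f" "integrable circle g"
  shows "mult_op (\<lambda>z. f z - g z) z = mult_op f z - mult_op g z"
  by (simp add: mult_op_def fcoef_diff[OF assms] sum_subtractf left_diff_distrib right_diff_distrib)

lemma mult_op_cmult: "mult_op (\<lambda>z. c * f z) z = c * mult_op f z"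
  by (simp add: mult_op_def fcoef_cmult sum_distrib_left algebra_simps)

text \<open>Bilinear, with no conjugate on g, to match \<open>simple_bilinear\<close> and
  \<open>Lp_dual_bound\<close>; hence the conjugations in the symmetry statement below.\<close>

definition form :: "(complex \<Rightarrow> complex) \<Rightarrow> (complex \<Rightarrow> complex) \<Rightarrow> complex" where
  "form f g = (LINT z|circle. mult_op f z * g z)"

definition bounded_by :: "real \<Rightarrow> real \<Rightarrow> bool" where
  "bounded_by p C \<longleftrightarrow> (\<forall>f\<in>Lp_fun p circle. pnorm p circle (mult_op f) \<le> C * pnorm p circle f)"

lemma form_eq:
  assumes "p > 1" "1 / p + 1 / q = 1" and f: "f \<in> Lp_fun p circle" and g: "g \<in> Lp_fun q circle"
  shows "form f g = of_real l * (LINT z|circle. f z * g z) + (\<Sum>k\<in>K. of_real (\<kappa> k) * fcoef f k * fcoef g (- k))"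
proof -
  have q: "q \<ge> 1" using conj_exponent_gt_1[OF assms(1,2)] by simp
  note gi = Lp_circle_integrable[OF q g]
  have i1: "integrable circle (\<lambda>z. of_real l * (f z * g z))"
    by (intro integrable_mult_right Lp_Holder(1)[OF assms])
  have i2: "integrable circle (\<lambda>z. of_real (\<kappa> k) * fcoef f k * (g z * zchar k z))" for k
    by (intro integrable_mult_right integrable_mult_zchar gi)
  have "form f g = (LINT z|circle. of_real l * (f z * g z) + (\<Sum>k\<in>K. of_real (\<kappa> k) * fcoef f k * (g z * zchar k z)))"
    unfolding form_def mult_op_def by (simp add: ring_distribs sum_distrib_left sum_distrib_right mult_ac)
  also have "\<dots> = (LINT z|circle. of_real l * (f z * g z)) + (LINT z|circle. (\<Sum>k\<in>K. of_real (\<kappa> k) * fcoef f k * (g z * zchar k z)))"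
    by (intro Bochner_Integration.integral_add Bochner_Integration.integrable_sum i1 i2)
  also have "(LINT z|circle. (\<Sum>k\<in>K. of_real (\<kappa> k) * fcoef f k * (g z * zchar k z))) = (\<Sum>k\<in>K. LINT z|circle. of_real (\<kappa> k) * fcoef f k * (g z * zchar k z))"
    by (intro Bochner_Integration.integral_sum i2)
  also have "\<dots> = (\<Sum>k\<in>K. of_real (\<kappa> k) * fcoef f k * fcoef g (- k))"
    by (simp add: fcoef_def)
  finally show ?thesis by simp
qed

text \<open>Conjugation turns the coefficient of index k into the conjugate of the one of index -k
  and leaves the real weights alone.\<close>

lemma form_hermitian:
  assumes "p > 1" "1 / p + 1 / q = 1" and f: "f \<in> Lp_fun p circle" and g: "g \<in> Lp_fun q circle"
  shows "form g (\<lambda>z. cnj (f z)) = cnj (form f (\<lambda>z. cnj (g z)))"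
proof -
  have q: "q > 1" "1 / q + 1 / p = 1" using conj_exponent_gt_1[OF assms(1,2)] assms(2) by auto
  have "(LINT z|circle. g z * cnj (f z)) = (LINT z|circle. cnj (f z * cnj (g z)))" by (simp add: mult.commute)
  also have "\<dots> = cnj (LINT z|circle. f z * cnj (g z))" by (rule Bochner_Integration.integral_cnj)
  finally show ?thesis
    by (simp add: form_eq[OF assms(1,2) f Lp_fun_cnj[OF g]] form_eq[OF q g Lp_fun_cnj[OF f]] fcoef_cnj mult_ac)
qed

text \<open>Self-adjointness moves the operator from f in \<open>L\<^sup>q\<close> to the test
  function in \<open>L\<^sup>p\<close>, where the bound is known.\<close>

lemma bounded_by_dual:
  assumes "p > 1" "1 / p + 1 / q = 1" "C \<ge> 0" and b: "bounded_by p C"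
  shows "bounded_by q C"
  unfolding bounded_by_def
proof
  fix f assume f: "f \<in> Lp_fun q circle"
  have q: "q > 1" "1 / q + 1 / p = 1" using conj_exponent_gt_1[OF assms(1,2)] assms(2) by auto
  show "pnorm q circle (mult_op f) \<le> C * pnorm q circle f"
  proof (rule Lp_dual_bound[OF q])
    show "mult_op f \<in> Lp_fun q circle" by (rule mult_op_Lp(1)) (use q f in auto)
    show "C * pnorm q circle f \<ge> 0" using assms(3) by simp
    fix g assume g: "g \<in> Lp_fun p circle"
    note g' = Lp_fun_cnj[OF g] and f' = Lp_fun_cnj[OF f]
    have og: "mult_op (\<lambda>z. cnj (g z)) \<in> Lp_fun p circle" by (rule mult_op_Lp(1)) (use assms g' in auto)
    have "form f (\<lambda>z. cnj (cnj (g z))) = cnj (form (\<lambda>z. cnj (g z)) (\<lambda>z. cnj (f z)))"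
      by (rule form_hermitian[OF assms(1,2) g' f])
    hence "cmod (LINT z|circle. mult_op f z * g z) = cmod (LINT z|circle. mult_op (\<lambda>z. cnj (g z)) z * cnj (f z))"
      by (simp add: form_def flip: form_def)
    also have "\<dots> \<le> pnorm p circle (mult_op (\<lambda>z. cnj (g z))) * pnorm q circle (\<lambda>z. cnj (f z))"
      by (rule Lp_Holder(2)[OF assms(1,2) og f'])
    also have "\<dots> \<le> (C * pnorm p circle (\<lambda>z. cnj (g z))) * pnorm q circle (\<lambda>z. cnj (f z))"
      using b g' unfolding bounded_by_def by (intro mult_right_mono) auto
    finally show "cmod (LINT z|circle. mult_op f z * g z) \<le> C * pnorm q circle f * pnorm p circle g"
      by (simp add: pnorm_cnj mult_ac)
  qed
qed

text \<open>Simple functions approximate f and g in their norms. The crude constant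
  \<open>coeff_sum\<close> multiplies only the approximation errors, so it disappears in the limit
  and C survives unchanged.\<close>

lemma bounded_by_simple:
  assumes "p > 1" "1 / p + 1 / q = 1" "C \<ge> 0"
    and b: "\<And>f g. simple_function circle f \<Longrightarrow> simple_function circle g \<Longrightarrow> cmod (form f g) \<le> C * pnorm p circle f * pnorm q circle g"
  shows "bounded_by p C"
  unfolding bounded_by_def
proof
  fix f assume f: "f \<in> Lp_fun p circle"
  have p1: "p \<ge> 1" "p > 0" using assms by auto
  have "q > 1" by (rule conj_exponent_gt_1[OF assms(1,2)])
  hence q1: "q \<ge> 1" "q > 0" by auto
  show "pnorm p circle (mult_op f) \<le> C * pnorm p circle f"
  proof (rule Lp_dual_bound[OF assms(1,2)])
    show "mult_op f \<in> Lp_fun p circle" by (rule mult_op_Lp(1)[OF p1(1) f])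
    show "C * pnorm p circle f \<ge> 0" using assms(3) by simp
    fix g assume g: "g \<in> Lp_fun q circle"
    obtain s where s: "\<And>n. simple_function circle (s n)" "\<And>n. s n \<in> Lp_fun p circle" "(\<lambda>n. pnorm p circle (\<lambda>x. s n x - f x)) \<longlonglongrightarrow> 0"
      using simple_dense_Lp[OF p1(2) f] by metis
    obtain t where t: "\<And>n. simple_function circle (t n)" "\<And>n. t n \<in> Lp_fun q circle" "(\<lambda>n. pnorm q circle (\<lambda>x. t n x - g x)) \<longlonglongrightarrow> 0"
      using simple_dense_Lp[OF q1(2) g] by metis
    define a b where "a n = pnorm p circle (\<lambda>x. s n x - f x)" and "b n = pnorm q circle (\<lambda>x. t n x - g x)" for n
    let ?F = "pnorm p circle f" and ?G = "pnorm q circle g"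
    have fb: "cmod (form u v) \<le> coeff_sum * pnorm p circle u * pnorm q circle v" if "u \<in> Lp_fun p circle" "v \<in> Lp_fun q circle" for u v
    proof -
      have "cmod (form u v) \<le> pnorm p circle (mult_op u) * pnorm q circle v"
        unfolding form_def by (rule Lp_Holder(2)[OF assms(1,2) mult_op_Lp(1)[OF p1(1) that(1)] that(2)])
      also have "\<dots> \<le> coeff_sum * pnorm p circle u * pnorm q circle v"
        by (intro mult_right_mono mult_op_Lp p1 that) auto
      finally show ?thesis .
    qed
    have "cmod (form f g) \<le> C * (?F + a n) * (?G + b n) + (coeff_sum * a n * ?G + coeff_sum * (?F + a n) * b n)" for n
    proof -
      note i = Lp_circle_integrable[OF p1(1)]
      note H = Lp_Holder(1)[OF assms(1,2)]
      note os = mult_op_Lp(1)[OF p1(1) s(2)[of n]] and of = mult_op_Lp(1)[OF p1(1) f]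
      have sf: "(\<lambda>x. s n x - f x) \<in> Lp_fun p circle" by (rule pnorm_triangle_diff(1)[OF p1(1) s(2) f])
      have tg: "(\<lambda>x. t n x - g x) \<in> Lp_fun q circle" by (rule pnorm_triangle_diff(1)[OF q1(1) t(2) g])
      have e1: "form (\<lambda>x. s n x - f x) g = form (s n) g - form f g"
      proof -
        have "form (\<lambda>x. s n x - f x) g = (LINT z|circle. mult_op (s n) z * g z - mult_op f z * g z)"
          unfolding form_def mult_op_diff[OF i[OF s(2)] i[OF f]] by (simp add: left_diff_distrib)
        also have "\<dots> = form (s n) g - form f g"
          unfolding form_def by (intro Bochner_Integration.integral_diff H os of g)
        finally show ?thesis .
      qed
      have e2: "form (s n) (\<lambda>x. t n x - g x) = form (s n) (t n) - form (s n) g"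
        unfolding form_def right_diff_distrib by (intro Bochner_Integration.integral_diff H os t(2) g)
      have sn: "pnorm p circle (s n) \<le> ?F + a n"
        using pnorm_triangle(2)[OF p1(1) f sf] by (simp add: a_def)
      have tn: "pnorm q circle (t n) \<le> ?G + b n"
        using pnorm_triangle(2)[OF q1(1) g tg] by (simp add: b_def)
      have "form f g = form (s n) (t n) - (form (\<lambda>x. s n x - f x) g + form (s n) (\<lambda>x. t n x - g x))"
        by (simp add: e1 e2)
      hence "cmod (form f g) \<le> cmod (form (s n) (t n)) + cmod (form (\<lambda>x. s n x - f x) g + form (s n) (\<lambda>x. t n x - g x))"
        using norm_triangle_ineq4 by metis
      also have "\<dots> \<le> C * pnorm p circle (s n) * pnorm q circle (t n) + (coeff_sum * a n * ?G + coeff_sum * pnorm p circle (s n) * b n)"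
        unfolding a_def b_def
        by (intro add_mono b s t order_trans[OF norm_triangle_ineq] fb sf g tg)
      also have "\<dots> \<le> C * (?F + a n) * (?G + b n) + (coeff_sum * a n * ?G + coeff_sum * (?F + a n) * b n)"
        using sn tn assms(3) coeff_sum_nonneg
        by (intro add_mono mult_mono mult_nonneg_nonneg order_refl add_nonneg_nonneg) (auto simp: a_def b_def)
      finally show ?thesis .
    qed
    moreover have "(\<lambda>n. C * (?F + a n) * (?G + b n) + (coeff_sum * a n * ?G + coeff_sum * (?F + a n) * b n)) \<longlonglongrightarrow>
       C * (?F + 0) * (?G + 0) + (coeff_sum * 0 * ?G + coeff_sum * (?F + 0) * 0)"
      using s(3) t(3) unfolding a_def[symmetric] b_def[symmetric] by (intro tendsto_intros)
    ultimately have "cmod (form f g) \<le> C * (?F + 0) * (?G + 0) + (coeff_sum * 0 * ?G + coeff_sum * (?F + 0) * 0)"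
      by (intro LIMSEQ_le_const) auto
    thus "cmod (LINT z|circle. mult_op f z * g z) \<le> C * ?F * ?G" by (simp add: form_def)
  qed
qed

text \<open>Riesz--Thorin for \<open>form\<close>. Since 1/q = 1 - 1/p, the conjugate exponents 2,
  s, q are interpolated with the same t as 2, r, p.\<close>

lemma bounded_by_interpolate:
  assumes r: "2 \<le> r" "0 \<le> t" "t \<le> 1" "1 / p = (1 - t) / 2 + t / r" "C0 > 0" "C1 > 0"
    and b0: "bounded_by 2 C0" and b1: "bounded_by r C1"
  shows "bounded_by p (C0 powr (1 - t) * C1 powr t)"
proof -
  define q s where "q = p / (p - 1)" and "s = r / (r - 1)"
  have rs: "1 / r + 1 / s = 1" "s > 0" using r by (auto simp: s_def field_simps)
  have p1: "0 < 1 / p" "1 / p \<le> 1 / 2"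
  proof -
    have "t / r \<le> t / 2" using r by (intro divide_left_mono) auto
    moreover have "(1 - t) / 2 = 1 / 2 - t / 2" by (simp add: diff_divide_distrib)
    ultimately show "1 / p \<le> 1 / 2" using r(4) by linarith
    have "(1 - t) / 2 + t / r > 0"
    proof (cases "t = 0")
      case False
      hence "t / r > 0" using r by simp
      moreover have "(1 - t) / 2 \<ge> 0" using r by simp
      ultimately show ?thesis by linarith
    qed simp
    thus "0 < 1 / p" using r by simp
  qed
  hence p: "p > 0" by simp
  hence p2: "p \<ge> 2" using p1(2) by (simp add: field_simps)
  have pq: "1 / p + 1 / q = 1" "q > 0" using p2 by (auto simp: q_def field_simps)
  have "1 / q = 1 - ((1 - t) / 2 + t / r)" using pq(1) r(4) by simp
  also have "\<dots> = (1 - t) / 2 + t * (1 - 1 / r)" by (simp add: field_simps)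
  also have "1 - 1 / r = 1 / s" using rs by simp
  finally have qeq: "1 / q = (1 - t) / 2 + t / s" by simp
  interpret simple_bilinear circle form
  proof
    fix f f' g g' :: "complex \<Rightarrow> complex" and c :: complex
    have S: "h \<in> Lp_fun 2 circle" if "simple_function circle h" for h
      using trig_approx_simple[OF _ that, of 2] by (auto simp: trig_approx_def)
    note i = Lp_circle_integrable[of 2, OF _ S]
    have H: "integrable circle (\<lambda>z. mult_op u z * v z)" if "simple_function circle u" "simple_function circle v" for u v
      by (rule Lp_Holder(1)[of 2 2]) (use mult_op_Lp(1)[of 2] S that in auto)
    {
      assume "simple_function circle f" "simple_function circle f'" "simple_function circle g"
      thus "form (\<lambda>x. f x + f' x) g = form f g + form f' g"
        unfolding form_def by (simp add: mult_op_add i H ring_distribs)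
    next
      assume "simple_function circle f" "simple_function circle g" "simple_function circle g'"
      thus "form f (\<lambda>x. g x + g' x) = form f g + form f g'"
        unfolding form_def by (simp add: H ring_distribs)
    next
      show "form (\<lambda>x. c * f x) g = c * form f g" unfolding form_def mult_op_cmult by (simp add: mult.assoc)
    next
      show "form f (\<lambda>x. c * g x) = c * form f g" unfolding form_def by (simp add: mult.left_commute)
    next
      assume eq: "\<And>x. x \<in> space circle \<Longrightarrow> f x = f' x" "\<And>x. x \<in> space circle \<Longrightarrow> g x = g' x"
      have "fcoef f k = fcoef f' k" for k using eq(1) by (intro fcoef_cong) simp
      thus "form f g = form f' g'"
        unfolding form_def mult_op_def using eq by (intro Bochner_Integration.integral_cong) auto
    }
  qed
  show ?thesis
  proof (rule bounded_by_simple[OF _ pq(1)])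
    show "p > 1" using p2 by simp
    show "C0 powr (1 - t) * C1 powr t \<ge> 0" by simp
    fix f g :: "complex \<Rightarrow> complex" assume fg: "simple_function circle f" "simple_function circle g"
    have bnd: "cmod (form f g) \<le> C * pnorm u circle f * pnorm v circle g"
      if "bounded_by u C" "u > 1" "1 / u + 1 / v = 1" "v > 0" "simple_function circle f" "simple_function circle g" for u v C and f g :: "complex \<Rightarrow> complex"
    proof -
      have L: "f \<in> Lp_fun u circle" "g \<in> Lp_fun v circle" using that by (auto intro: simple_Lp)
      have "cmod (form f g) \<le> pnorm u circle (mult_op f) * pnorm v circle g"
        unfolding form_def by (rule Lp_Holder(2)) (use that L mult_op_Lp(1)[of u] in auto)
      also have "\<dots> \<le> C * pnorm u circle f * pnorm v circle g"
        using that(1) L unfolding bounded_by_def by (intro mult_right_mono) auto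
      finally show ?thesis .
    qed
    show "cmod (form f g) \<le> C0 powr (1 - t) * C1 powr t * pnorm p circle f * pnorm q circle g"
      by (rule riesz_thorin[OF _ _ _ _ _ _ _ _ r(2,3) r(4) qeq bnd[OF b0] bnd[OF b1] fg])
         (use r rs p pq in auto)
  qed
qed

text \<open>Write f as its modes in K plus a remainder h whose coefficients in K vanish. The
  operator multiplies h by l and the mode k by l + \<kappa> k, and all these pieces are orthogonal,
  so Pythagoras (\<open>pyth\<close>) before and after gives the bound.\<close>

lemma bounded_by_L2:
  assumes "\<bar>l\<bar> \<le> 1" "\<And>k. k \<in> K \<Longrightarrow> \<bar>l + \<kappa> k\<bar> \<le> 1"
  shows "bounded_by 2 1"
  unfolding bounded_by_def
proof
  fix f assume f: "f \<in> Lp_fun 2 circle"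
  have pyth: "(LINT z|circle. cmod (h z + (\<Sum>k\<in>K. c k * zchar k z)) powr 2) = (LINT z|circle. cmod (h z) powr 2) + (\<Sum>k\<in>K. (cmod (c k))\<^sup>2)"
    if h: "h \<in> Lp_fun 2 circle" and h0: "\<And>k. k \<in> K \<Longrightarrow> fcoef h k = 0" for h c
  proof -
    define u where "u z = (\<Sum>k\<in>K. c k * zchar k z)" for z
    have uL: "u \<in> Lp_fun 2 circle" unfolding u_def by (intro trig_Lp trig_sum trig_zchar fin) auto
    have e: "complex_of_real (cmod (v z) powr 2) = v z * cnj (v z)" for v and z :: complex
      by (simp add: complex_norm_square[symmetric] del: of_real_power)
    have cu: "(LINT z|circle. v z * cnj (u z)) = (\<Sum>k\<in>K. cnj (c k) * fcoef v k)" if v: "v \<in> Lp_fun 2 circle" for v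
    proof -
      have "(LINT z|circle. v z * cnj (u z)) = (LINT z|circle. (\<Sum>k\<in>K. cnj (c k) * (v z * zchar (- k) z)))"
        by (intro Bochner_Integration.integral_cong) (auto simp: u_def zchar_uminus sum_distrib_left mult_ac)
      also have "\<dots> = (\<Sum>k\<in>K. LINT z|circle. cnj (c k) * (v z * zchar (- k) z))"
        by (intro Bochner_Integration.integral_sum integrable_mult_right integrable_mult_zchar Lp_circle_integrable[OF _ v]) auto
      finally show ?thesis by (simp add: fcoef_def)
    qed
    have hu: "(LINT z|circle. h z * cnj (u z)) = 0" using cu[OF h] h0 by simp
    have uh: "(LINT z|circle. u z * cnj (h z)) = 0"
    proof -
      have "(LINT z|circle. u z * cnj (h z)) = (LINT z|circle. cnj (h z * cnj (u z)))" by (simp add: mult.commute)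
      thus ?thesis using hu unfolding Bochner_Integration.integral_cnj by simp
    qed
    have uu: "(LINT z|circle. u z * cnj (u z)) = (\<Sum>k\<in>K. of_real ((cmod (c k))\<^sup>2))"
    proof -
      have "fcoef u k = (if k \<in> K then c k else 0)" for k unfolding u_def by (rule fcoef_sum_zchar[OF fin])
      thus ?thesis unfolding cu[OF uL] complex_norm_square by (intro sum.cong) (auto simp: mult.commute)
    qed
    note H = Lp_Holder(1)[of 2 2, OF _ _ _ Lp_fun_cnj]
    have i: "integrable circle (\<lambda>z. h z * cnj (h z))" "integrable circle (\<lambda>z. h z * cnj (u z))"
      "integrable circle (\<lambda>z. u z * cnj (h z))" "integrable circle (\<lambda>z. u z * cnj (u z))"
      using H h uL by auto
    have "complex_of_real (LINT z|circle. cmod (h z + u z) powr 2) = (LINT z|circle. (h z + u z) * cnj (h z + u z))"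
      unfolding e[symmetric, of "\<lambda>z. h z + u z"] by (rule integral_complex_of_real[symmetric])
    also have "\<dots> = (LINT z|circle. h z * cnj (h z)) + (LINT z|circle. h z * cnj (u z)) + (LINT z|circle. u z * cnj (h z)) + (LINT z|circle. u z * cnj (u z))"
      using i by (simp add: ring_distribs add_ac)
    also have "\<dots> = complex_of_real ((LINT z|circle. cmod (h z) powr 2) + (\<Sum>k\<in>K. (cmod (c k))\<^sup>2))"
      unfolding hu uh uu e[symmetric, of h] integral_complex_of_real by simp
    finally show ?thesis unfolding u_def of_real_eq_iff .
  qed
  define h where "h z = f z + (\<Sum>k\<in>K. (- fcoef f k) * zchar k z)" for z
  have sL: "(\<lambda>z. \<Sum>k\<in>K. c k * zchar k z) \<in> Lp_fun 2 circle" for c by (intro trig_Lp trig_sum trig_zchar fin) auto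
  have hL: "h \<in> Lp_fun 2 circle" unfolding h_def by (rule pnorm_triangle(1)[OF _ f sL]) simp
  have h0: "fcoef h k = 0" if "k \<in> K" for k
  proof -
    have "fcoef h k = fcoef f k + fcoef (\<lambda>z. \<Sum>k\<in>K. (- fcoef f k) * zchar k z) k"
      unfolding h_def by (intro fcoef_add Lp_circle_integrable[of 2] f sL) auto
    thus ?thesis using that by (simp only: fcoef_sum_zchar[OF fin]) simp
  qed
  have f_eq: "f z = h z + (\<Sum>k\<in>K. fcoef f k * zchar k z)" for z by (simp add: h_def sum_negf)
  have Tf_eq: "mult_op f z = of_real l * h z + (\<Sum>k\<in>K. (of_real (l + \<kappa> k) * fcoef f k) * zchar k z)" for z
    unfolding mult_op_def by (subst f_eq[of z]) (simp add: ring_distribs sum.distrib sum_distrib_left mult_ac)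
  have lh: "(\<lambda>z. of_real l * h z) \<in> Lp_fun 2 circle" by (rule Lp_fun_cmult[OF hL])
  have lh0: "fcoef (\<lambda>z. of_real l * h z) k = 0" if "k \<in> K" for k using h0[OF that] by (simp add: fcoef_cmult)
  have sq: "x\<^sup>2 \<le> 1" if "\<bar>x\<bar> \<le> 1" for x :: real using power_mono[OF that, of 2] by simp
  have "(LINT z|circle. cmod (mult_op f z) powr 2) = l\<^sup>2 * (LINT z|circle. cmod (h z) powr 2) + (\<Sum>k\<in>K. (l + \<kappa> k)\<^sup>2 * (cmod (fcoef f k))\<^sup>2)"
    unfolding Tf_eq by (subst pyth[OF lh lh0]) (auto simp: norm_mult power_mult_distrib simp flip: of_real_add)
  also have "\<dots> \<le> 1 * (LINT z|circle. cmod (h z) powr 2) + (\<Sum>k\<in>K. 1 * (cmod (fcoef f k))\<^sup>2)"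
    by (intro add_mono mult_right_mono sum_mono sq assms integral_nonneg_AE) auto
  also have "\<dots> = (LINT z|circle. cmod (f z) powr 2)"
  proof -
    have "(LINT z|circle. cmod (f z) powr 2) = (LINT z|circle. cmod (h z + (\<Sum>k\<in>K. fcoef f k * zchar k z)) powr 2)"
      by (intro Bochner_Integration.integral_cong) (simp_all only: f_eq[symmetric])
    thus ?thesis using pyth[OF hL h0, of "fcoef f"] by simp
  qed
  also have "\<dots> = pnorm 2 circle f powr 2" by (rule pnorm_powr[symmetric]) simp
  finally have "pnorm 2 circle (mult_op f) \<le> pnorm 2 circle f"
    by (rule pnorm_le_iff[THEN iffD2, rotated 2]) simp_all
  thus "pnorm 2 circle (mult_op f) \<le> 1 * pnorm 2 circle f" by simp
qed

end

text \<open>As r tends to infinity, t tends to 1 - 2/p; this is the origin of the exponent in the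
  essential norm estimate.\<close>

lemma interpolation_parameter:
  fixes p r :: real
  assumes "2 < p" "p < r"
  defines "t \<equiv> (1 / 2 - 1 / p) / (1 / 2 - 1 / r)"
  shows "0 \<le> t" "t \<le> 1" "1 / p = (1 - t) / 2 + t / r"
proof -
  have "1 / r < 1 / 2" "1 / p < 1 / 2" using assms(1,2) by (auto intro!: divide_strict_left_mono)
  hence pos: "1 / 2 - 1 / r > 0" "1 / 2 - 1 / p > 0" by auto
  have "1 / r < 1 / p" using assms(1,2) by (intro divide_strict_left_mono) auto
  thus "0 \<le> t" "t \<le> 1"
    using pos unfolding t_def by (auto simp only: divide_le_eq_1_pos intro!: divide_nonneg_pos)
  have "t * (1 / 2 - 1 / r) = 1 / 2 - 1 / p"
    using pos nonzero_divide_eq_eq[of "1 / 2 - 1 / r" "1 / 2 - 1 / p" t] unfolding t_def by linarith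
  moreover have "t * (1 / 2 - 1 / r) = t / 2 - t / r" "(1 - t) / 2 = 1 / 2 - t / 2"
    by (simp_all only: right_diff_distrib diff_divide_distrib times_divide_eq_right mult_1_right)
  ultimately show "1 / p = (1 - t) / 2 + t / r" by linarith
qed

text \<open>Interpolating between the exponents 2 and r and letting r tend to infinity avoids the
  endpoint exponent infinity.\<close>

theorem pnorm_diff_fejer_le:
  assumes "p > 1" "f \<in> Lp_fun p circle"
  shows "pnorm p circle (\<lambda>z. f z - fejer N f z) \<le> 2 powr \<bar>1 - 2 / p\<bar> * pnorm p circle f"
proof -
  interpret multiplier 1 "{- int N..int N}" "\<lambda>k. - fejer_coef N k" by unfold_locales simp
  have mult_op_eq: "mult_op f = (\<lambda>z. f z - fejer N f z)" for f
    by (rule ext) (simp add: mult_op_def fejer_def sum_negf)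
  have two: "bounded_by 2 1"
    by (rule bounded_by_L2) (use fejer_coef_bounds in auto)
  have r2: "bounded_by r 2" if "r \<ge> 1" for r
    unfolding bounded_by_def
  proof
    fix f assume f: "f \<in> Lp_fun r circle"
    have "pnorm r circle (\<lambda>z. f z - fejer N f z) \<le> pnorm r circle f + pnorm r circle (fejer N f)"
      by (rule pnorm_triangle_diff(2)[OF that f fejer_Lp]) (use that in simp)
    also have "\<dots> \<le> 2 * pnorm r circle f" using pnorm_fejer_le[OF that f, of N] by simp
    finally show "pnorm r circle (mult_op f) \<le> 2 * pnorm r circle f" by (simp add: mult_op_eq)
  qed
  have ge2: "bounded_by p (2 powr (1 - 2 / p))" if "p \<ge> 2" for p
  proof (cases "p = 2")
    case True
    thus ?thesis using two by simp
  next
    case False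
    hence p: "p > 2" using that by simp
    show ?thesis unfolding bounded_by_def
    proof
      fix f assume f: "f \<in> Lp_fun p circle"
      define t where "t r = (1 / 2 - 1 / p) / (1 / 2 - 1 / r)" for r
      have "pnorm p circle (mult_op f) \<le> 2 powr (t r) * pnorm p circle f" if "r > p" for r
      proof -
        have "bounded_by p (1 powr (1 - t r) * 2 powr t r)"
          using that p interpolation_parameter[OF p that]
          by (intro bounded_by_interpolate[of r] two r2) (auto simp: t_def)
        thus ?thesis using f by (simp add: bounded_by_def)
      qed
      hence ev: "\<forall>\<^sub>F r in at_top. pnorm p circle (mult_op f) \<le> 2 powr (t r) * pnorm p circle f"
        by (intro eventually_mono[OF eventually_gt_at_top[of p]])
      have "((\<lambda>r. 2 powr (t r) * pnorm p circle f) \<longlongrightarrow> 2 powr ((1 / 2 - 1 / p) / (1 / 2 - 0)) * pnorm p circle f) at_top"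
        unfolding t_def
        by (intro tendsto_intros tendsto_divide_0[OF tendsto_const] filterlim_at_top_imp_at_infinity filterlim_ident) auto
      hence "pnorm p circle (mult_op f) \<le> 2 powr ((1 / 2 - 1 / p) / (1 / 2 - 0)) * pnorm p circle f"
        using ev by (rule tendsto_lowerbound) simp
      moreover have "(1 / 2 - 1 / p) / (1 / 2 - 0) = 1 - 2 / p" using p by (simp add: field_simps)
      ultimately show "pnorm p circle (mult_op f) \<le> 2 powr (1 - 2 / p) * pnorm p circle f"
        by (simp only:)
    qed
  qed
  have "bounded_by p (2 powr \<bar>1 - 2 / p\<bar>)"
  proof (cases "p \<ge> 2")
    case True
    hence "\<bar>1 - 2 / p\<bar> = 1 - 2 / p" by simp
    thus ?thesis using ge2[OF True] by simp
  next
    case False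
    \<comment> \<open>The conjugate exponent satisfies 1 - 2/q = |1 - 2/p|, so duality carries the
      constant over unchanged.\<close>
    define q where "q = p / (p - 1)"
    have pq: "1 / q + 1 / p = 1" "q \<ge> 2" using False assms by (auto simp: q_def field_simps)
    have "1 - 2 / q = \<bar>1 - 2 / p\<bar>"
    proof -
      have "2 / q = 2 * (1 / q)" by simp
      also have "1 / q = 1 - 1 / p" using pq(1) by simp
      also have "2 * (1 - 1 / p) = 2 - 2 / p" by simp
      finally have "2 / q = 2 - 2 / p" .
      moreover have "2 / p \<ge> 1" using False assms by simp
      ultimately show ?thesis by simp
    qed
    thus ?thesis using bounded_by_dual[OF _ pq(1) _ ge2[OF pq(2)]] pq(2) by simp
  qed
  thus ?thesis using assms(2) by (simp add: bounded_by_def mult_op_eq)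
qed

section \<open>The theorem of M. Riesz\<close>

text \<open>A relation and not a function: that every f in \<open>L\<^sup>p\<close> has an analytic
  part in \<open>L\<^sup>p\<close> is the theorem to be proved.\<close>

definition analytic_part :: "(complex \<Rightarrow> complex) \<Rightarrow> (complex \<Rightarrow> complex) \<Rightarrow> bool" where
  "analytic_part f u \<longleftrightarrow> (\<forall>k. fcoef u k = (if k \<ge> 0 then fcoef f k else 0))"

text \<open>Frequencies add under multiplication. For the Fejer means of f this is a finite
  computation; it passes to f because multiplication by the bounded g is continuous in norm.\<close>

lemma fcoef_bounded_mult_eq_0:
  assumes "p \<ge> 1" and g: "g \<in> borel_measurable circle" "AE z in circle. cmod (g z) \<le> B" "B \<ge> 0" and f: "f \<in> Lp_fun p circle"
    and g0: "\<And>k. k < m \<Longrightarrow> fcoef g k = 0" and f0: "\<And>k. k < n \<Longrightarrow> fcoef f k = 0" and k: "k < m + n"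
  shows "fcoef (\<lambda>z. g z * f z) k = 0"
proof -
  have p0: "p > 0" using assms by simp
  have gf: "(\<lambda>z. g z * h z) \<in> Lp_fun p circle \<and> pnorm p circle (\<lambda>z. g z * h z) \<le> B * pnorm p circle h" if "h \<in> Lp_fun p circle" for h
  proof -
    note [measurable] = g(1) Lp_fun_measurable[OF that]
    have "(\<lambda>z. g z * h z) \<in> borel_measurable circle" by measurable
    moreover have "AE z in circle. cmod (g z * h z) \<le> B * cmod (h z)"
      using g(2) by eventually_elim (auto simp: norm_mult intro: mult_right_mono)
    ultimately show ?thesis using Lp_fun_mono[OF that _ _ p0 g(3), of "\<lambda>z. g z * h z"] by auto
  qed
  have gi: "integrable circle g"
    by (rule Lp_circle_integrable[of 1 g]) (use bounded_Lp_fun(1)[OF prob_space_circle g(1,2) _ g(3), of 1] in auto)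
  have z: "fcoef (\<lambda>z. g z * fejer N f z) k = 0" for N
  proof -
    have "fcoef (\<lambda>z. g z * fejer N f z) k = (LINT z|circle. (\<Sum>j\<in>{- int N..int N}. of_real (fejer_coef N j) * fcoef f j * (g z * zchar (- (k - j)) z)))"
      unfolding fcoef_def fejer_def
    proof (intro Bochner_Integration.integral_cong refl)
      fix z assume "z \<in> space circle"
      hence e: "zchar (- (k - j)) z = zchar j z * zchar (- k) z" for j
        using zchar_add[of z j "- k"] by simp
      show "g z * (\<Sum>j = - int N..int N. of_real (fejer_coef N j) * (LINT z|circle. f z * zchar (- j) z) * zchar j z) * zchar (- k) z =
        (\<Sum>j = - int N..int N. of_real (fejer_coef N j) * (LINT z|circle. f z * zchar (- j) z) * (g z * zchar (- (k - j)) z))"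
        unfolding sum_distrib_left sum_distrib_right e by (intro sum.cong refl) (simp only: mult_ac)
    qed
    also have "\<dots> = (\<Sum>j\<in>{- int N..int N}. LINT z|circle. of_real (fejer_coef N j) * fcoef f j * (g z * zchar (- (k - j)) z))"
      by (intro Bochner_Integration.integral_sum integrable_mult_right integrable_mult_zchar gi)
    also have "\<dots> = (\<Sum>j\<in>{- int N..int N}. of_real (fejer_coef N j) * fcoef f j * fcoef g (k - j))"
      unfolding integral_mult_right_zero fcoef_def ..
    also have "\<dots> = 0"
    proof (intro sum.neutral ballI)
      fix j
      \<comment> \<open>Since j + (k - j) = k < m + n, either j < n or k - j < m.\<close>
      show "of_real (fejer_coef N j) * fcoef f j * fcoef g (k - j) = 0"
        using f0[of j] g0[of "k - j"] k by (cases "j < n") auto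
    qed
    finally show ?thesis .
  qed
  have le: "cmod (fcoef (\<lambda>z. g z * f z) k) \<le> B * pnorm p circle (\<lambda>z. f z - fejer N f z)" for N
  proof -
    note fL = fejer_Lp[OF p0, of N f]
    note dL = pnorm_triangle_diff(1)[OF assms(1) f fL]
    have "fcoef (\<lambda>z. g z * f z) k = fcoef (\<lambda>z. g z * f z) k - fcoef (\<lambda>z. g z * fejer N f z) k" by (simp add: z)
    also have "\<dots> = fcoef (\<lambda>z. g z * f z - g z * fejer N f z) k"
      by (rule fcoef_diff[symmetric]) (use gf f fL Lp_circle_integrable[OF assms(1)] in auto)
    also have "(\<lambda>z. g z * f z - g z * fejer N f z) = (\<lambda>z. g z * (f z - fejer N f z))" by (simp add: right_diff_distrib)
    also have "cmod (fcoef (\<lambda>z. g z * (f z - fejer N f z)) k) \<le> pnorm p circle (\<lambda>z. g z * (f z - fejer N f z))"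
      by (rule norm_fcoef_le[OF assms(1)]) (use gf[OF dL] in auto)
    also have "\<dots> \<le> B * pnorm p circle (\<lambda>z. f z - fejer N f z)" using gf[OF dL] by auto
    finally show ?thesis .
  qed
  have "(\<lambda>N. B * pnorm p circle (\<lambda>z. f z - fejer N f z)) \<longlonglongrightarrow> B * 0"
    by (intro tendsto_intros fejer_tendsto assms)
  hence "cmod (fcoef (\<lambda>z. g z * f z) k) \<le> B * 0"
    by (rule LIMSEQ_le_const) (use le in auto)
  thus ?thesis by simp
qed

lemma continuous_fcoef_mult_eq_0:
  assumes g: "continuous_on (sphere 0 1) g" and f: "continuous_on (sphere 0 1) f"
    and "\<And>k. k < m \<Longrightarrow> fcoef g k = 0" "\<And>k. k < n \<Longrightarrow> fcoef f k = 0" "k < m + n"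
  shows "fcoef (\<lambda>z. g z * f z) k = 0"
proof -
  obtain B where B: "B \<ge> 0" "\<And>z. cmod z = 1 \<Longrightarrow> cmod (g z) \<le> B"
    using bounded_continuous_circle[OF g] by blast
  show ?thesis
    by (rule fcoef_bounded_mult_eq_0[of 1 g B f m n])
       (use B assms(3-5) in \<open>auto intro!: measurable_circle_continuous[OF g] Lp_circle_continuous[OF f]\<close>)
qed

lemma trig_analytic_part:
  assumes "trig f"
  obtains u where "trig u" "analytic_part f u"
proof -
  have "\<exists>u. trig u \<and> analytic_part f u"
    using assms
  proof induction
    case trig_zero
    show ?case by (rule exI[of _ "\<lambda>_. 0"]) (auto simp: analytic_part_def trig.trig_zero fcoef_def)
  next
    case (trig_add_zchar f c k)
    then obtain u where u: "trig u" "analytic_part f u" by blast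
    define v where "v z = u z + (if k \<ge> 0 then c else 0) * zchar k z" for z
    have i: "integrable circle h" if "trig h" for h by (rule Lp_circle_integrable[OF _ trig_Lp[OF that], of 1]) auto
    have "fcoef (\<lambda>z. h z + d * zchar k z) j = fcoef h j + d * (if j = k then 1 else 0)" if "trig h" for h d j
      by (subst fcoef_add) (auto intro: i that trig_zchar simp: fcoef_cmult fcoef_zchar)
    hence "analytic_part (\<lambda>z. f z + c * zchar k z) v"
      unfolding v_def analytic_part_def using u trig_add_zchar.hyps by (auto simp: analytic_part_def)
    moreover have "trig v" unfolding v_def by (intro trig.trig_add_zchar u)
    ultimately show ?case by blast
  qed
  thus ?thesis using that by blast
qed

text \<open>Restricted to trigonometric polynomials, where analytic parts exist and squares stay in
  the class; the doubling argument needs both.\<close>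

definition riesz_bound :: "real \<Rightarrow> real \<Rightarrow> bool" where
  "riesz_bound s C \<longleftrightarrow> (\<forall>f u. trig f \<longrightarrow> trig u \<longrightarrow> analytic_part f u \<longrightarrow> pnorm s circle u \<le> C * pnorm s circle f)"

lemma trig_integrable: "trig h \<Longrightarrow> integrable circle h"
  by (rule Lp_circle_integrable[OF _ trig_Lp, of 1]) auto

lemma trig_mult_integrable:
  assumes "trig g" "trig f"
  shows "integrable circle (\<lambda>z. g z * f z)"
proof -
  have "continuous_on (sphere 0 1) (\<lambda>z. g z * f z)" by (intro continuous_intros trig_continuous assms)
  thus ?thesis using Lp_circle_continuous[of "\<lambda>z. g z * f z" 1] by (intro Lp_circle_integrable[of 1]) auto
qed

text \<open>Cauchy--Schwarz for |f| powr s and |g| powr s.\<close>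

lemma pnorm_mult_le:
  assumes "s \<ge> 1" "trig f" "trig g"
  shows "pnorm s circle (\<lambda>z. f z * g z) \<le> pnorm (2 * s) circle f * pnorm (2 * s) circle g"
proof -
  have L: "(\<lambda>z. of_real (cmod (h z) powr s)) \<in> Lp_fun 2 circle"
    "pnorm 2 circle (\<lambda>z. of_real (cmod (h z) powr s)) = pnorm (2 * s) circle h powr s" if "trig h" for h
  proof -
    have e: "cmod (complex_of_real (cmod (h z) powr s)) powr 2 = cmod (h z) powr (2 * s)" for z
      by (simp only: norm_of_real abs_of_nonneg powr_ge_zero powr_powr mult.commute)
    have "h \<in> Lp_fun (2 * s) circle" using trig_Lp[OF that] assms(1) by simp
    hence "integrable circle (\<lambda>z. cmod (h z) powr (2 * s))" by (rule Lp_fun_integrable)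
    moreover have [measurable]: "h \<in> borel_measurable circle" by (rule trig_measurable[OF that])
    ultimately show "(\<lambda>z. of_real (cmod (h z) powr s)) \<in> Lp_fun 2 circle"
      unfolding Lp_fun_def mem_Collect_eq e by simp
    show "pnorm 2 circle (\<lambda>z. of_real (cmod (h z) powr s)) = pnorm (2 * s) circle h powr s"
      unfolding pnorm_def e powr_powr using assms(1) by simp
  qed
  have s0: "s > 0" using assms by simp
  let ?A = "pnorm (2 * s) circle f" and ?B = "pnorm (2 * s) circle g"
  have "complex_of_real (LINT z|circle. cmod (f z * g z) powr s) = (LINT z|circle. of_real (cmod (f z) powr s) * of_real (cmod (g z) powr s))"
    by (simp add: norm_mult powr_mult flip: of_real_mult integral_complex_of_real)
  hence "\<bar>LINT z|circle. cmod (f z * g z) powr s\<bar> = cmod (LINT z|circle. of_real (cmod (f z) powr s) * of_real (cmod (g z) powr s))"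
    by (metis norm_of_real)
  also have "\<dots> \<le> ?A powr s * ?B powr s"
    using Lp_Holder(2)[OF _ _ L(1)[OF assms(2)] L(1)[OF assms(3)]] by (simp add: L(2) assms)
  also have "\<dots> = (?A * ?B) powr s" by (simp add: powr_mult)
  finally have "(LINT z|circle. cmod (f z * g z) powr s) \<le> (?A * ?B) powr s" by linarith
  thus ?thesis by (rule pnorm_le_iff[THEN iffD2, rotated 2]) (use s0 in auto)
qed

text \<open>Cotlar's trick: if u is the analytic part of f and v = f - u, then 2uf - f^2 = u^2 - v^2
  has analytic part u^2, because u^2 is analytic and v^2 is antianalytic with mean zero.\<close>

lemma riesz_bound_double:
  assumes "s \<ge> 1" "C \<ge> 1" and b: "riesz_bound s C"
  shows "riesz_bound (2 * s) (3 * C)"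
  unfolding riesz_bound_def
proof (intro allI impI)
  fix f u assume f: "trig f" and u: "trig u" and fu: "analytic_part f u"
  have s0: "s > 0" using assms by simp
  define v where "v z = f z + (- 1) * u z" for z
  have v: "trig v" unfolding v_def by (intro trig_add trig_cmult f u)
  have u_neg: "fcoef u k = 0" if "k < 0" for k using fu that by (auto simp: analytic_part_def)
  have v_pos: "fcoef v k = 0" if "k \<ge> 0" for k
  proof -
    have "fcoef v k = fcoef f k + fcoef (\<lambda>z. (- 1) * u z) k"
      unfolding v_def by (intro fcoef_add trig_integrable trig_cmult f u)
    thus ?thesis using fu that by (simp only: fcoef_cmult) (simp add: analytic_part_def)
  qed
  have uu: "fcoef (\<lambda>z. u z * u z) k = 0" if "k < 0" for k
    by (rule continuous_fcoef_mult_eq_0[OF trig_continuous[OF u] trig_continuous[OF u] u_neg u_neg]) (use that in auto)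
  have cv: "continuous_on (sphere 0 1) (\<lambda>z. cnj (v z))" by (intro continuous_intros trig_continuous v)
  have vv: "fcoef (\<lambda>z. v z * v z) k = 0" if "k \<ge> 0" for k
  proof -
    \<comment> \<open>v has negative frequencies only, so those of cnj v start at 1 and those of its
      square at 2. In particular the mean of v^2 vanishes, which matters because index 0 belongs to
      the analytic half.\<close>
    have c0: "fcoef (\<lambda>z. cnj (v z)) j = 0" if "j < 1" for j using v_pos[of "- j"] that by (simp add: fcoef_cnj)
    have "fcoef (\<lambda>z. cnj (v z) * cnj (v z)) (- k) = 0"
      by (rule continuous_fcoef_mult_eq_0[OF cv cv c0 c0]) (use that in auto)
    thus ?thesis using fcoef_cnj[of "\<lambda>z. v z * v z" "- k"] by simp
  qed
  obtain a where a: "trig a" "\<And>z. cmod z = 1 \<Longrightarrow> a z = u z * f z" using trig_mult[OF f u] by blast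
  obtain b' where b': "trig b'" "\<And>z. cmod z = 1 \<Longrightarrow> b' z = f z * f z" using trig_mult[OF f f] by blast
  obtain w1 where w1: "trig w1" "analytic_part a w1" using trig_analytic_part[OF a(1)] .
  obtain w2 where w2: "trig w2" "analytic_part b' w2" using trig_analytic_part[OF b'(1)] .
  let ?d = "\<lambda>z. u z * u z - (2 * w1 z - w2 z)"
  have L: "h \<in> Lp_fun q circle" if "trig h" "q > 0" for h q by (rule trig_Lp[OF that])
  have mm: "(\<lambda>z. g z * h z) \<in> borel_measurable circle" if "trig g" "trig h" for g h
    by (intro measurable_circle_continuous continuous_intros trig_continuous that)
  have id: "2 * fcoef a k - fcoef b' k = fcoef (\<lambda>z. u z * u z) k - fcoef (\<lambda>z. v z * v z) k" for k
  proof -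
    have "2 * fcoef a k - fcoef b' k = fcoef (\<lambda>z. 2 * a z - b' z) k"
      using fcoef_diff[OF trig_integrable[OF trig_cmult[OF a(1)]] trig_integrable[OF b'(1)], of 2 k] by (simp add: fcoef_cmult)
    also have "\<dots> = fcoef (\<lambda>z. u z * u z - v z * v z) k"
      by (rule fcoef_cong) (simp add: a(2) b'(2) v_def algebra_simps)
    also have "\<dots> = fcoef (\<lambda>z. u z * u z) k - fcoef (\<lambda>z. v z * v z) k"
      by (intro fcoef_diff trig_mult_integrable u v)
    finally show ?thesis .
  qed
  have wi: "integrable circle (\<lambda>z. 2 * w1 z - w2 z)"
    using trig_integrable[OF w1(1)] trig_integrable[OF w2(1)] by auto
  have d0: "fcoef ?d k = 0" for k
  proof -
    have "fcoef ?d k = fcoef (\<lambda>z. u z * u z) k - (2 * fcoef w1 k - fcoef w2 k)"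
      using fcoef_diff[OF trig_mult_integrable[OF u u] wi, of k]
        fcoef_diff[OF trig_integrable[OF trig_cmult[OF w1(1)]] trig_integrable[OF w2(1)], of 2 k]
      by (simp add: fcoef_cmult)
    thus ?thesis
      using w1(2) w2(2) id[of k] uu[of k] vv[of k] by (auto simp: analytic_part_def)
  qed
  have cont: "continuous_on (sphere 0 1) ?d" by (intro continuous_intros trig_continuous u w1 w2)
  have "AE z in circle. ?d z = 0"
    by (rule fcoef_unique[OF Lp_circle_continuous[OF cont, of 1] _ d0]) auto
  hence "pnorm s circle (\<lambda>z. u z * u z) = pnorm s circle (\<lambda>z. 2 * w1 z - w2 z)"
    by (intro pnorm_cong_AE measurable_circle_continuous continuous_intros trig_continuous u w1 w2) auto
  also have "\<dots> \<le> pnorm s circle (\<lambda>z. 2 * w1 z) + pnorm s circle w2"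
    by (intro pnorm_triangle_diff assms L trig_cmult w1 w2 s0)
  also have "pnorm s circle (\<lambda>z. 2 * w1 z) = 2 * pnorm s circle w1" by (simp add: pnorm_cmult[OF s0])
  also have "2 * pnorm s circle w1 + pnorm s circle w2 \<le> 2 * (C * pnorm s circle a) + C * pnorm s circle b'"
    using b a b' w1 w2 unfolding riesz_bound_def by (intro add_mono mult_left_mono) auto
  also have "pnorm s circle a = pnorm s circle (\<lambda>z. u z * f z)"
    by (rule pnorm_cong_AE[OF trig_measurable[OF a(1)] mm[OF u f]]) (rule AE_I2, use a in auto)
  also have "pnorm s circle b' = pnorm s circle (\<lambda>z. f z * f z)"
    by (rule pnorm_cong_AE[OF trig_measurable[OF b'(1)] mm[OF f f]]) (rule AE_I2, use b' in auto)
  also have "2 * (C * pnorm s circle (\<lambda>z. u z * f z)) + C * pnorm s circle (\<lambda>z. f z * f z) \<le>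
     2 * (C * (pnorm (2 * s) circle u * pnorm (2 * s) circle f)) + C * (pnorm (2 * s) circle f * pnorm (2 * s) circle f)"
    using assms by (intro add_mono mult_left_mono pnorm_mult_le u f) auto
  finally have le: "pnorm s circle (\<lambda>z. u z * u z) \<le> \<dots>" .
  let ?x = "pnorm (2 * s) circle u" and ?y = "pnorm (2 * s) circle f"
  have "pnorm s circle (\<lambda>z. u z * u z) = ?x * ?x"
  proof -
    have "cmod (u z * u z) powr s = cmod (u z) powr (2 * s)" for z
      by (cases "u z = 0") (simp_all add: norm_mult powr_mult powr_add[symmetric])
    hence "pnorm s circle (\<lambda>z. u z * u z) = (LINT z|circle. cmod (u z) powr (2 * s)) powr (1 / s)" by (simp add: pnorm_def)
    also have "\<dots> = (?x powr (2 * s)) powr (1 / s)" using s0 by (simp add: pnorm_powr)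
    also have "\<dots> = ?x * ?x" using s0 by (simp add: powr_powr power2_eq_square)
    finally show ?thesis .
  qed
  with le have q: "?x * ?x \<le> 2 * (C * (?x * ?y)) + C * (?y * ?y)" by simp
  \<comment> \<open>The constant 3: with w = C * ?y \<ge> ?y the inequality \<open>q\<close> reads
    ?x^2 \<le> 2 * w * ?x + w * ?y. If ?x exceeded 3 * w, the right-hand side would be at most 3 * w
    * ?x < ?x^2.\<close>
  show "?x \<le> 3 * C * ?y"
  proof (rule ccontr)
    assume "\<not> ?x \<le> 3 * C * ?y"
    define w where "w = C * ?y"
    have lt: "3 * w < ?x" using \<open>\<not> ?x \<le> 3 * C * ?y\<close> by (simp add: w_def)
    have y0: "?y \<ge> 0" by simp
    have yw: "?y \<le> w" using mult_right_mono[OF assms(2) y0] by (simp add: w_def)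
    have "C * (?y * ?y) = w * ?y" "C * (?x * ?y) = w * ?x" by (simp_all add: w_def)
    moreover have "w * ?y \<le> w * ?x" using lt yw y0 by (intro mult_left_mono) linarith+
    ultimately have "?x * ?x \<le> 3 * w * ?x" using q by linarith
    moreover have "3 * w * ?x < ?x * ?x" using lt yw y0 by (intro mult_strict_right_mono) linarith+
    ultimately show False by simp
  qed
qed

section \<open>Analytic halves of the Fejer means and the boundedness theorem\<close>

abbreviation analytic_fejer :: "nat \<Rightarrow> (complex \<Rightarrow> complex) \<Rightarrow> complex \<Rightarrow> complex" where
  "analytic_fejer N \<equiv> multiplier.mult_op 0 {0..int N} (fejer_coef N)"

abbreviation analytic_fejer_bound :: "real \<Rightarrow> real \<Rightarrow> bool" where
  "analytic_fejer_bound p C \<equiv> \<forall>N. multiplier.bounded_by 0 {0..int N} (fejer_coef N) p C"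

lemma multiplier_analytic_fejer: "multiplier {0..int N}"
  by unfold_locales simp

lemma analytic_fejer_eq:
  "analytic_fejer N f z = (\<Sum>k\<in>{0..int N}. of_real (fejer_coef N k) * fcoef f k * zchar k z)"
  by (simp add: multiplier.mult_op_def[OF multiplier_analytic_fejer])

lemma trig_analytic_fejer: "trig (analytic_fejer N f)"
  unfolding analytic_fejer_eq by (intro trig_sum trig_zchar) auto

lemma fcoef_analytic_fejer:
  "fcoef (analytic_fejer N f) k = (if k \<ge> 0 then of_real (fejer_coef N k) * fcoef f k else 0)"
  unfolding analytic_fejer_eq by (subst fcoef_sum_zchar) (auto simp: fejer_coef_def)

lemma fejer_analytic_part:
  assumes "analytic_part f u"
  shows "fejer N u = analytic_fejer N f"
proof
  fix z
  have "fejer N u z = (\<Sum>k\<in>{0..int N}. of_real (fejer_coef N k) * fcoef u k * zchar k z)"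
    unfolding fejer_def using assms
    by (intro sum.mono_neutral_right) (auto simp: analytic_part_def)
  also have "\<dots> = analytic_fejer N f z"
    unfolding analytic_fejer_eq using assms by (intro sum.cong) (auto simp: analytic_part_def)
  finally show "fejer N u z = analytic_fejer N f z" .
qed

text \<open>The Fejer means of u are the truncated operators applied to f, and they converge to u;
  so a bound uniform in N passes to the analytic part.\<close>

lemma analytic_part_bound:
  assumes b: "analytic_fejer_bound p C" and p: "p \<ge> 1" and f: "f \<in> Lp_fun p circle" and u: "u \<in> Lp_fun p circle" and fu: "analytic_part f u"
  shows "pnorm p circle u \<le> C * pnorm p circle f"
proof -
  have p0: "p > 0" using p by simp
  have "pnorm p circle u \<le> C * pnorm p circle f + pnorm p circle (\<lambda>z. u z - fejer N u z)" for N
  proof -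
    note d = pnorm_triangle_diff(1)[OF p u fejer_Lp[OF p0, of N u]]
    have "pnorm p circle u \<le> pnorm p circle (fejer N u) + pnorm p circle (\<lambda>z. u z - fejer N u z)"
      using pnorm_triangle(2)[OF p fejer_Lp[OF p0, of N u] d] by simp
    also have "pnorm p circle (fejer N u) \<le> C * pnorm p circle f"
      unfolding fejer_analytic_part[OF fu] using b f multiplier.bounded_by_def[OF multiplier_analytic_fejer] by blast
    finally show ?thesis by simp
  qed
  moreover have "(\<lambda>N. C * pnorm p circle f + pnorm p circle (\<lambda>z. u z - fejer N u z)) \<longlonglongrightarrow> C * pnorm p circle f + 0"
    by (intro tendsto_intros fejer_tendsto p u)
  ultimately have "pnorm p circle u \<le> C * pnorm p circle f + 0"
    by (intro LIMSEQ_le_const) auto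
  thus ?thesis by simp
qed

lemma riesz_bound_of_analytic_fejer_bound:
  assumes "analytic_fejer_bound p C" "p \<ge> 1"
  shows "riesz_bound p C"
  unfolding riesz_bound_def using assms by (auto intro!: analytic_part_bound trig_Lp)

text \<open>\<open>analytic_fejer N f\<close> is the analytic part of the trigonometric polynomial
  \<open>fejer N f\<close>, whose norm is at most that of f. So the estimate for polynomials is
  equivalent to one for finite multipliers, to which interpolation and duality apply.\<close>

lemma analytic_fejer_bound_of_riesz_bound:
  assumes "riesz_bound p C" "p \<ge> 1" "C \<ge> 0"
  shows "analytic_fejer_bound p C"
  unfolding multiplier.bounded_by_def[OF multiplier_analytic_fejer]
proof (intro allI ballI)
  fix N f assume f: "f \<in> Lp_fun p circle"
  have "analytic_part (fejer N f) (analytic_fejer N f)"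
    by (simp add: analytic_part_def fcoef_fejer fcoef_analytic_fejer)
  hence "pnorm p circle (analytic_fejer N f) \<le> C * pnorm p circle (fejer N f)"
    using assms(1) trig_fejer trig_analytic_fejer by (simp add: riesz_bound_def)
  also have "\<dots> \<le> C * pnorm p circle f"
    by (intro mult_left_mono pnorm_fejer_le assms f)
  finally show "pnorm p circle (analytic_fejer N f) \<le> C * pnorm p circle f" .
qed

lemma analytic_fejer_bound_2: "analytic_fejer_bound 2 1"
  using fejer_coef_bounds by (auto intro!: multiplier.bounded_by_L2[OF multiplier_analytic_fejer])

lemma riesz_bound_power2: "riesz_bound (2 ^ Suc n) (3 ^ n)"
proof (induction n)
  case 0
  show ?case using riesz_bound_of_analytic_fejer_bound[OF analytic_fejer_bound_2] by simp
next
  case (Suc n)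
  have "1 \<le> (2::real) ^ Suc n" "1 \<le> (3::real) ^ n" by (rule one_le_power; simp)+
  thus ?case using riesz_bound_double[OF _ _ Suc.IH] by simp
qed

text \<open>Interpolation and duality are carried out for each fixed N, where boundedness is already
  known; the constant that comes out does not involve N.\<close>

theorem analytic_fejer_bounded:
  assumes "p > 1"
  obtains C where "C \<ge> 0" "analytic_fejer_bound p C"
proof -
  have ge2: "\<exists>C\<ge>0. analytic_fejer_bound p C" if "p \<ge> 2" for p
  proof (cases "p = 2")
    case True
    thus ?thesis using analytic_fejer_bound_2 by (intro exI[of _ 1]) auto
  next
    case False
    hence p: "p > 2" using that by simp
    obtain n where n: "p < 2 ^ n" using real_arch_pow[of 2 p] by auto
    have "2 ^ n \<le> (2::real) ^ Suc n" by simp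
    define r :: real where "r = 2 ^ Suc n"
    have r: "r > p" using n \<open>2 ^ n \<le> 2 ^ Suc n\<close> unfolding r_def by linarith
    define t where "t = (1 / 2 - 1 / p) / (1 / 2 - 1 / r)"
    note t = interpolation_parameter[OF p r, folded t_def]
    have "r \<ge> 1" using r p by simp
    hence rb: "analytic_fejer_bound r (3 ^ n)"
      using riesz_bound_power2[of n] unfolding r_def by (intro analytic_fejer_bound_of_riesz_bound) auto
    have "analytic_fejer_bound p (1 powr (1 - t) * (3 ^ n) powr t)"
    proof
      fix N
      show "multiplier.bounded_by 0 {0..int N} (fejer_coef N) p (1 powr (1 - t) * (3 ^ n) powr t)"
        by (rule multiplier.bounded_by_interpolate[OF multiplier_analytic_fejer _ t])
           (use analytic_fejer_bound_2 rb r p in auto)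
    qed
    thus ?thesis by (intro exI[of _ "1 powr (1 - t) * (3 ^ n) powr t"]) auto
  qed
  have "\<exists>C\<ge>0. analytic_fejer_bound p C"
  proof (cases "p \<ge> 2")
    case False
    define q where "q = p / (p - 1)"
    have pq: "1 / q + 1 / p = 1" "q \<ge> 2" using False assms by (auto simp: q_def field_simps)
    obtain C where C: "C \<ge> 0" "analytic_fejer_bound q C" using ge2[OF pq(2)] by blast
    have "analytic_fejer_bound p C"
      using multiplier.bounded_by_dual[OF multiplier_analytic_fejer _ pq(1) C(1)] C(2) pq(2) by simp
    thus ?thesis using C by blast
  qed (rule ge2)
  thus ?thesis using that by blast
qed

text \<open>u is the limit of U N = \<open>analytic_fejer N f\<close>. The difference U m - U n is
  the analytic part of \<open>fejer m f - fejer n f\<close>, so the polynomial estimate makes U a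
  Cauchy sequence; Fourier coefficients are continuous in norm and pass to the limit.\<close>

theorem M_Riesz:
  assumes "p > 1"
  obtains C where "C \<ge> 0"
    "\<And>f. f \<in> Lp_fun p circle \<Longrightarrow>
       \<exists>u\<in>Lp_fun p circle. analytic_part f u \<and> pnorm p circle u \<le> C * pnorm p circle f"
proof -
  obtain C where C: "C \<ge> 0" "analytic_fejer_bound p C" by (rule analytic_fejer_bounded[OF assms])
  have p: "p \<ge> 1" "p > 0" using assms by auto
  have rb: "riesz_bound p C" by (rule riesz_bound_of_analytic_fejer_bound[OF C(2) p(1)])
  have "\<exists>u\<in>Lp_fun p circle. analytic_part f u \<and> pnorm p circle u \<le> C * pnorm p circle f"
    if f: "f \<in> Lp_fun p circle" for f
  proof -
    define U where "U N = analytic_fejer N f" for N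
    have tU: "trig (U N)" for N unfolding U_def by (rule trig_analytic_fejer)
    have UL: "U N \<in> Lp_fun p circle" for N by (rule trig_Lp[OF tU p(2)])
    have d: "pnorm p circle (\<lambda>z. U m z - U n z) \<le> C * (pnorm p circle (\<lambda>z. f z - fejer m f z) + pnorm p circle (\<lambda>z. f z - fejer n f z))" for m n
    proof -
      have td: "trig (\<lambda>z. g z - h z)" if "trig g" "trig h" for g h
        using trig_add[OF trig_cmult[OF that(2), of "-1"] that(1)] by simp
      have ti: "integrable circle g" if "trig g" for g by (rule trig_integrable[OF that])
      have "analytic_part (\<lambda>z. fejer m f z - fejer n f z) (\<lambda>z. U m z - U n z)"
        unfolding analytic_part_def U_def
        by (simp add: fcoef_diff ti trig_fejer trig_analytic_fejer fcoef_fejer fcoef_analytic_fejer)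
      hence "pnorm p circle (\<lambda>z. U m z - U n z) \<le> C * pnorm p circle (\<lambda>z. fejer m f z - fejer n f z)"
        using rb td[OF tU tU] td[OF trig_fejer trig_fejer] unfolding riesz_bound_def by blast
      also have "(\<lambda>z. fejer m f z - fejer n f z) = (\<lambda>z. (f z - fejer n f z) - (f z - fejer m f z))" by simp
      also have "C * pnorm p circle \<dots> \<le> C * (pnorm p circle (\<lambda>z. f z - fejer n f z) + pnorm p circle (\<lambda>z. f z - fejer m f z))"
        by (intro mult_left_mono pnorm_triangle_diff p f fejer_Lp C)
      finally show ?thesis by (simp add: add.commute)
    qed
    obtain u where u: "u \<in> Lp_fun p circle" "(\<lambda>n. pnorm p circle (\<lambda>x. U n x - u x)) \<longlonglongrightarrow> 0"
    proof (rule Lp_complete[OF p(1) UL])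
      \<comment> \<open>The difference of two members costs C times two errors of size e/(2 * (C +
        1)), which is less than e; C + 1 in place of C allows C = 0.\<close>
      fix e :: real assume "e > 0"
      have "\<forall>\<^sub>F N in sequentially. pnorm p circle (\<lambda>z. f z - fejer N f z) < e / (2 * (C + 1))"
        using C(1) \<open>e > 0\<close> by (intro order_tendstoD(2)[OF fejer_tendsto[OF p(1) f]]) auto
      then obtain K where K: "\<And>N. N \<ge> K \<Longrightarrow> pnorm p circle (\<lambda>z. f z - fejer N f z) < e / (2 * (C + 1))"
        by (auto simp: eventually_sequentially)
      have "pnorm p circle (\<lambda>z. U m z - U n z) < e" if "m \<ge> K" "n \<ge> K" for m n
      proof -
        have "pnorm p circle (\<lambda>z. U m z - U n z) \<le> C * (e / (2 * (C + 1)) + e / (2 * (C + 1)))"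
          using K[OF that(1)] K[OF that(2)] C(1) by (intro order_trans[OF d] mult_left_mono add_mono) auto
        also have "\<dots> < e"
        proof -
          define x where "x = e / (2 * (C + 1))"
          have "x > 0" "2 * (C + 1) * x = e" using C(1) \<open>e > 0\<close> by (auto simp: x_def)
          moreover have "C * (x + x) + 2 * x = 2 * (C + 1) * x" by (simp add: algebra_simps)
          ultimately show ?thesis unfolding x_def[symmetric] by linarith
        qed
        finally show ?thesis .
      qed
      thus "\<exists>K. \<forall>m\<ge>K. \<forall>n\<ge>K. pnorm p circle (\<lambda>x. U m x - U n x) < e" by blast
    qed (use that in blast)
    have "analytic_part f u"
      unfolding analytic_part_def
    proof
      fix k
      have "(\<lambda>n. fcoef (U n) k) \<longlonglongrightarrow> fcoef u k"
      proof (rule LIM_zero_cancel, rule Lim_null_comparison[OF _ u(2)], rule always_eventually, rule allI)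
        fix n
        have "fcoef (U n) k - fcoef u k = fcoef (\<lambda>z. U n z - u z) k"
          by (intro fcoef_diff[symmetric] Lp_circle_integrable[OF p(1)] UL u)
        thus "cmod (fcoef (U n) k - fcoef u k) \<le> pnorm p circle (\<lambda>x. U n x - u x)"
          using norm_fcoef_le[OF p(1) pnorm_triangle_diff(1)[OF p(1) UL u(1)]] by simp
      qed
      moreover have "(\<lambda>n. fcoef (U n) k) \<longlonglongrightarrow> (if k \<ge> 0 then of_real 1 * fcoef f k else 0)"
      proof (cases "k \<ge> 0")
        case True
        have "(\<lambda>n. of_real (fejer_coef n k) * fcoef f k) \<longlonglongrightarrow> of_real 1 * fcoef f k"
          by (intro tendsto_intros fejer_coef_lim)
        thus ?thesis using True by (simp add: U_def fcoef_analytic_fejer)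
      qed (simp add: U_def fcoef_analytic_fejer)
      ultimately show "fcoef u k = (if k \<ge> 0 then fcoef f k else 0)"
        using LIMSEQ_unique by fastforce
    qed
    thus ?thesis using u(1) analytic_part_bound[OF C(2) p(1) f u(1)] by blast
  qed
  thus ?thesis using that C(1) by blast
qed

section \<open>Passage to equivalence classes of functions\<close>

lemma L0_cases:
  obtains f where "f \<in> borel_measurable circle" "x = abs_L0 f"
proof -
  have "\<exists>f. f \<in> borel_measurable circle \<and> x = abs_L0 f"
    by (induction x rule: L0.abs_induct) (auto simp: ae_eq_def)
  thus ?thesis using that by blast
qed

lemma ae_eq_refl: "f \<in> borel_measurable circle \<Longrightarrow> ae_eq f f"
  by (simp add: ae_eq_def)

lemma abs_L0_eq_iff:
  assumes "f \<in> borel_measurable circle" "g \<in> borel_measurable circle"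
  shows "abs_L0 f = abs_L0 g \<longleftrightarrow> (AE z in circle. f z = g z)"
  using Quotient3_rel[OF Quotient3_L0, of f g] assms by (auto simp: ae_eq_def)

lemma
  assumes "f \<in> borel_measurable circle" "g \<in> borel_measurable circle"
  shows abs_L0_add: "abs_L0 f + abs_L0 g = abs_L0 (\<lambda>z. f z + g z)"
    and abs_L0_diff: "abs_L0 f - abs_L0 g = abs_L0 (\<lambda>z. f z - g z)"
    and abs_L0_mult: "abs_L0 f * abs_L0 g = abs_L0 (\<lambda>z. f z * g z)"
  using assms by (simp_all add: plus_L0.abs_eq minus_L0.abs_eq times_L0.abs_eq ae_eq_refl)

lemma abs_L0_cscale:
  "f \<in> borel_measurable circle \<Longrightarrow> cscale c (abs_L0 f) = abs_L0 (\<lambda>z. c * f z)"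
  by (simp add: cscale.abs_eq ae_eq_refl)

lemma abs_L0_zero: "abs_L0 (\<lambda>_. 0) = 0"
  by (simp add: zero_L0_def)

lemma abs_L0_sum:
  assumes "finite I" "\<And>i. i \<in> I \<Longrightarrow> f i \<in> borel_measurable circle"
  shows "(\<Sum>i\<in>I. abs_L0 (f i)) = abs_L0 (\<lambda>z. \<Sum>i\<in>I. f i z)"
  using assms by (induction I rule: finite_induct) (auto simp: abs_L0_zero abs_L0_add)

lemma Lp_norm_abs_L0:
  assumes "f \<in> borel_measurable circle" "p > 0"
  shows "Lp_norm (ennreal p) (abs_L0 f) = pnorm p circle f"
  using assms by (simp add: Lp_norm.abs_eq ae_eq_refl pnorm_def)

lemma abs_L0_in_Lp_iff:
  assumes "f \<in> borel_measurable circle" "p > 0"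
  shows "abs_L0 f \<in> Lp (ennreal p) \<longleftrightarrow> f \<in> Lp_fun p circle"
  using assms by (simp add: Lp_def in_Lp.abs_eq ae_eq_refl Lp_fun_def)

lemma Lp_cases:
  assumes "x \<in> Lp (ennreal p)" "p > 0"
  obtains f where "f \<in> Lp_fun p circle" "x = abs_L0 f"
  using L0_cases[of x] abs_L0_in_Lp_iff[OF _ assms(2)] assms(1) by metis

lemma Lp_fun_abs_L0:
  assumes "f \<in> Lp_fun p circle" "p > 0"
  shows "abs_L0 f \<in> Lp (ennreal p)" "Lp_norm (ennreal p) (abs_L0 f) = pnorm p circle f"
  using assms abs_L0_in_Lp_iff Lp_norm_abs_L0 Lp_fun_measurable by blast+

abbreviation nrm :: "real \<Rightarrow> L0 \<Rightarrow> real" where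
  "nrm p \<equiv> Lp_norm (ennreal p)"

lemma nrm_nonneg: "p > 0 \<Longrightarrow> 0 \<le> nrm p x"
  by (rule L0_cases[of x]) (simp add: Lp_norm_abs_L0)

lemma nrm_zero: "p > 0 \<Longrightarrow> nrm p 0 = 0"
  by (subst abs_L0_zero[symmetric]) (simp add: Lp_norm_abs_L0 del: abs_L0_zero)

lemma Lp_zero: "p > 0 \<Longrightarrow> 0 \<in> Lp (ennreal p)"
  using Lp_fun_abs_L0(1)[OF Lp_fun_zero[of p circle]] by (simp add: abs_L0_zero)

lemma
  assumes "p \<ge> 1" "x \<in> Lp (ennreal p)" "y \<in> Lp (ennreal p)"
  shows Lp_add: "x + y \<in> Lp (ennreal p)" and nrm_add: "nrm p (x + y) \<le> nrm p x + nrm p y"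
    and Lp_diff: "x - y \<in> Lp (ennreal p)" and nrm_diff: "nrm p (x - y) \<le> nrm p x + nrm p y"
    and fourier_add: "fourier (x + y) k = fourier x k + fourier y k"
    and fourier_diff: "fourier (x - y) k = fourier x k - fourier y k"
proof -
  have p0: "p > 0" using assms by simp
  obtain f where f: "f \<in> Lp_fun p circle" "x = abs_L0 f" using Lp_cases[OF assms(2) p0] .
  obtain g where g: "g \<in> Lp_fun p circle" "y = abs_L0 g" using Lp_cases[OF assms(3) p0] .
  note fm = Lp_fun_measurable[OF f(1)] and gm = Lp_fun_measurable[OF g(1)]
  note s = pnorm_triangle[OF assms(1) f(1) g(1)] pnorm_triangle_diff[OF assms(1) f(1) g(1)]
  note i = Lp_circle_integrable[OF assms(1) f(1)] Lp_circle_integrable[OF assms(1) g(1)]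
  show "x + y \<in> Lp (ennreal p)" "nrm p (x + y) \<le> nrm p x + nrm p y"
    "x - y \<in> Lp (ennreal p)" "nrm p (x - y) \<le> nrm p x + nrm p y"
    using Lp_fun_abs_L0[OF s(1) p0] Lp_fun_abs_L0[OF s(3) p0] s Lp_fun_abs_L0[OF f(1) p0] Lp_fun_abs_L0[OF g(1) p0]
    by (simp_all add: f(2) g(2) abs_L0_add[OF fm gm] abs_L0_diff[OF fm gm])
  show "fourier (x + y) k = fourier x k + fourier y k" "fourier (x - y) k = fourier x k - fourier y k"
    using fm gm by (simp_all add: f(2) g(2) abs_L0_add[OF fm gm] abs_L0_diff[OF fm gm] fourier_abs_L0 fcoef_add[OF i] fcoef_diff[OF i])
qed

lemma
  assumes "p > 0" "x \<in> Lp (ennreal p)"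
  shows Lp_cscale: "cscale c x \<in> Lp (ennreal p)" and nrm_cscale: "nrm p (cscale c x) = cmod c * nrm p x"
proof -
  obtain f where f: "f \<in> Lp_fun p circle" "x = abs_L0 f" using Lp_cases[OF assms(2,1)] .
  note fm = Lp_fun_measurable[OF f(1)]
  show "cscale c x \<in> Lp (ennreal p)" "nrm p (cscale c x) = cmod c * nrm p x"
    using Lp_fun_abs_L0[OF Lp_fun_cmult[OF f(1)] assms(1)] Lp_fun_abs_L0[OF f(1) assms(1)]
    by (simp_all add: f(2) abs_L0_cscale[OF fm] pnorm_cmult[OF assms(1)])
qed

lemma fourier_cscale: "fourier (cscale c x) k = c * fourier x k"
proof (rule L0_cases[of x])
  fix f assume f [measurable]: "f \<in> borel_measurable circle" and x: "x = abs_L0 f"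
  have "(\<lambda>z. c * f z) \<in> borel_measurable circle" by measurable
  thus ?thesis by (simp add: x abs_L0_cscale[OF f] fourier_abs_L0 f fcoef_cmult)
qed

lemma fourier_zero: "fourier 0 k = 0"
  using fourier_cscale[of 0 0 k] by (simp add: L0.scale_zero_left)

lemma norm_fourier_le:
  assumes "p \<ge> 1" "x \<in> Lp (ennreal p)"
  shows "cmod (fourier x k) \<le> nrm p x"
proof -
  have p0: "p > 0" using assms by simp
  obtain f where f: "f \<in> Lp_fun p circle" "x = abs_L0 f" using Lp_cases[OF assms(2) p0] .
  thus ?thesis using norm_fcoef_le[OF assms(1) f(1)] Lp_fun_abs_L0[OF f(1) p0] Lp_fun_measurable[OF f(1)]
    by (simp add: fourier_abs_L0)
qed

lemma Lp_subset_L1: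
  assumes "p \<ge> 1" "x \<in> Lp (ennreal p)"
  shows "x \<in> Lp 1"
proof -
  have p0: "p > 0" using assms by simp
  obtain f where f: "f \<in> Lp_fun p circle" "x = abs_L0 f" using Lp_cases[OF assms(2) p0] .
  have "f \<in> Lp_fun 1 circle"
    using Lp_circle_integrable[OF assms(1) f(1)] Lp_fun_measurable[OF f(1)] by (simp add: Lp_fun_def)
  from Lp_fun_abs_L0(1)[OF this] show ?thesis using f(2) by simp
qed

lemma fourier_unique:
  assumes "p \<ge> 1" "x \<in> Lp (ennreal p)" "y \<in> Lp (ennreal p)" "\<And>k. fourier x k = fourier y k"
  shows "x = y"
proof -
  have p0: "p > 0" using assms by simp
  have d: "x - y \<in> Lp (ennreal p)" by (rule Lp_diff[OF assms(1-3)])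
  obtain f where f: "f \<in> Lp_fun p circle" "x - y = abs_L0 f" using Lp_cases[OF d p0] .
  have "fcoef f k = 0" for k
    using fourier_diff[OF assms(1-3), of k] assms(4)[of k] Lp_fun_measurable[OF f(1)] by (simp add: f(2) fourier_abs_L0)
  hence "AE z in circle. f z = 0" by (rule fcoef_unique[OF f(1) assms(1)])
  hence "abs_L0 f = 0" using Lp_fun_measurable[OF f(1)] by (simp add: abs_L0_zero[symmetric] abs_L0_eq_iff)
  thus ?thesis using f(2) by simp
qed

text \<open>The norm dominates every Fourier coefficient, so all of them vanish.\<close>

lemma nrm_eq_0:
  assumes "p \<ge> 1" "x \<in> Lp (ennreal p)" "nrm p x = 0"
  shows "x = 0"
  using assms norm_fourier_le[OF assms(1,2)]
  by (intro fourier_unique[OF assms(1,2)]) (auto simp: Lp_zero fourier_zero)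

lemma Lp_sum:
  assumes "p \<ge> 1" "finite I" "\<And>i. i \<in> I \<Longrightarrow> x i \<in> Lp (ennreal p)"
  shows "(\<Sum>i\<in>I. x i) \<in> Lp (ennreal p) \<and> nrm p (\<Sum>i\<in>I. x i) \<le> (\<Sum>i\<in>I. nrm p (x i)) \<and>
    fourier (\<Sum>i\<in>I. x i) k = (\<Sum>i\<in>I. fourier (x i) k)"
  using assms(2,3)
proof (induction I rule: finite_induct)
  case empty
  thus ?case using assms(1) by (simp add: Lp_zero nrm_zero fourier_zero)
next
  case (insert i I)
  have "x i \<in> Lp (ennreal p)" "(\<Sum>i\<in>I. x i) \<in> Lp (ennreal p)" using insert by auto
  from Lp_add[OF assms(1) this] nrm_add[OF assms(1) this] fourier_add[OF assms(1) this] show ?case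
    using insert by (auto intro: order_trans)
qed

lemma Linf_cases:
  assumes "a \<in> Lp \<infinity>"
  obtains \<alpha> where "\<alpha> \<in> borel_measurable circle" "a = abs_L0 \<alpha>" "AE z in circle. cmod (\<alpha> z) \<le> Lp_norm \<infinity> a"
    "Lp_norm \<infinity> a \<ge> 0" "\<And>c. c \<ge> 0 \<Longrightarrow> AE z in circle. cmod (\<alpha> z) \<le> c \<Longrightarrow> Lp_norm \<infinity> a \<le> c"
proof -
  obtain \<alpha> where m [measurable]: "\<alpha> \<in> borel_measurable circle" and a: "a = abs_L0 \<alpha>" by (rule L0_cases)
  define S where "S = esssup circle (\<lambda>z. ereal (cmod (\<alpha> z)))"
  have fin: "S < \<infinity>" using assms by (simp add: a Lp_def in_Lp.abs_eq ae_eq_refl m S_def)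
  have N: "Lp_norm \<infinity> a = real_of_ereal S" by (simp add: a Lp_norm.abs_eq ae_eq_refl m S_def)
  have em: "emeasure circle (space circle) \<noteq> 0" by (simp add: circle.emeasure_space_1 del: space_circle)
  \<comment> \<open>\<open>real_of_ereal\<close> is faithful on finite values only:
    \<open>fin\<close> excludes \<infinity>, and nonnegativity, from the positive total mass,
    excludes the other end.\<close>
  have S0: "S \<ge> 0"
  proof -
    have "esssup circle (\<lambda>z. 0 :: ereal) \<le> S" unfolding S_def by (rule esssup_mono) auto
    thus ?thesis using esssup_const[OF em, of "0 :: ereal"] by simp
  qed
  have Sr: "S = ereal (Lp_norm \<infinity> a)" unfolding N using fin S0 by (cases S) auto
  show ?thesis
  proof (rule that[OF m a])
    have "AE z in circle. ereal (cmod (\<alpha> z)) \<le> S" unfolding S_def by (rule esssup_AE)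
    thus "AE z in circle. cmod (\<alpha> z) \<le> Lp_norm \<infinity> a" unfolding Sr by simp
    show "Lp_norm \<infinity> a \<ge> 0" using S0 Sr by simp
    fix c :: real assume "c \<ge> 0" "AE z in circle. cmod (\<alpha> z) \<le> c"
    hence "S \<le> ereal c" unfolding S_def by (intro esssup_I) auto
    thus "Lp_norm \<infinity> a \<le> c" unfolding Sr by simp
  qed
qed

lemma bounded_abs_L0_Linf:
  assumes [measurable]: "f \<in> borel_measurable circle" and "AE z in circle. cmod (f z) \<le> c"
  shows "abs_L0 f \<in> Lp \<infinity>"
proof -
  have "esssup circle (\<lambda>z. ereal (cmod (f z))) \<le> ereal c" using assms by (intro esssup_I) auto
  thus ?thesis by (auto simp: Lp_def in_Lp.abs_eq ae_eq_refl intro: le_less_trans)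
qed

lemma Linf_mult:
  assumes "p > 0" "a \<in> Lp \<infinity>" "x \<in> Lp (ennreal p)"
  shows "a * x \<in> Lp (ennreal p)" "nrm p (a * x) \<le> Lp_norm \<infinity> a * nrm p x"
proof -
  obtain \<alpha> where \<alpha>: "\<alpha> \<in> borel_measurable circle" "a = abs_L0 \<alpha>" "AE z in circle. cmod (\<alpha> z) \<le> Lp_norm \<infinity> a" "Lp_norm \<infinity> a \<ge> 0"
    by (rule Linf_cases[OF assms(2)])
  obtain f where f: "f \<in> Lp_fun p circle" "x = abs_L0 f" using Lp_cases[OF assms(3,1)] .
  note fm = Lp_fun_measurable[OF f(1)]
  note [measurable] = \<alpha>(1) fm
  have m: "(\<lambda>z. \<alpha> z * f z) \<in> borel_measurable circle" by measurable
  have "AE z in circle. cmod (\<alpha> z * f z) \<le> Lp_norm \<infinity> a * cmod (f z)"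
    using \<alpha>(3) by eventually_elim (auto simp: norm_mult intro: mult_right_mono)
  note * = Lp_fun_mono[OF f(1) m this assms(1) \<alpha>(4)]
  show "a * x \<in> Lp (ennreal p)" "nrm p (a * x) \<le> Lp_norm \<infinity> a * nrm p x"
    using Lp_fun_abs_L0[OF *(1) assms(1)] *(2) Lp_fun_abs_L0[OF f(1) assms(1)]
    unfolding \<alpha>(2) f(2) abs_L0_mult[OF \<alpha>(1) fm] by simp_all
qed

lemma Linf_add:
  assumes "a \<in> Lp \<infinity>" "b \<in> Lp \<infinity>"
  shows "a + b \<in> Lp \<infinity>"
proof -
  obtain \<alpha> where \<alpha>: "\<alpha> \<in> borel_measurable circle" "a = abs_L0 \<alpha>" "AE z in circle. cmod (\<alpha> z) \<le> Lp_norm \<infinity> a"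
    by (rule Linf_cases[OF assms(1)])
  obtain \<beta> where \<beta>: "\<beta> \<in> borel_measurable circle" "b = abs_L0 \<beta>" "AE z in circle. cmod (\<beta> z) \<le> Lp_norm \<infinity> b"
    by (rule Linf_cases[OF assms(2)])
  note [measurable] = \<alpha>(1) \<beta>(1)
  have "AE z in circle. cmod (\<alpha> z + \<beta> z) \<le> Lp_norm \<infinity> a + Lp_norm \<infinity> b"
    using \<alpha>(3) \<beta>(3) by eventually_elim (rule norm_triangle_le, simp)
  thus ?thesis unfolding \<alpha>(2) \<beta>(2) abs_L0_add[OF \<alpha>(1) \<beta>(1)] by (intro bounded_abs_L0_Linf) auto
qed

definition zchar_L0 :: "int \<Rightarrow> L0" where
  "zchar_L0 k = abs_L0 (zchar k)"

lemma zchar_L0_Lp: "p > 0 \<Longrightarrow> zchar_L0 k \<in> Lp (ennreal p)" 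
  unfolding zchar_L0_def by (rule Lp_fun_abs_L0(1)[OF zchar_Lp])

lemma nrm_zchar_L0_le: "p > 0 \<Longrightarrow> nrm p (zchar_L0 k) \<le> 1"
  unfolding zchar_L0_def by (simp add: Lp_fun_abs_L0(2)[OF zchar_Lp] pnorm_zchar_le)

lemma fourier_zchar_L0: "fourier (zchar_L0 j) k = (if k = j then 1 else 0)"
  unfolding zchar_L0_def by (simp add: fourier_abs_L0 fcoef_zchar)

text \<open>Built from \<open>fourier\<close> on classes, so that linearity and finite-dimensional
  range are visible; \<open>fejer_abs_L0\<close> transfers the norm estimates proved for
  functions.\<close>

definition fejer_L0 :: "nat \<Rightarrow> L0 \<Rightarrow> L0" where
  "fejer_L0 N x = (\<Sum>k\<in>{- int N..int N}. cscale (of_real (fejer_coef N k) * fourier x k) (zchar_L0 k))"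

lemma fejer_abs_L0:
  assumes "f \<in> borel_measurable circle"
  shows "fejer_L0 N (abs_L0 f) = abs_L0 (fejer N f)"
  unfolding fejer_L0_def fejer_def zchar_L0_def
  by (subst abs_L0_sum[symmetric]) (auto simp: abs_L0_cscale[OF zchar_measurable] fourier_abs_L0[OF assms])

lemma nrm_diff_fejer_L0_le:
  assumes "p > 1" "x \<in> Lp (ennreal p)"
  shows "nrm p (x - fejer_L0 N x) \<le> 2 powr \<bar>1 - 2 / p\<bar> * nrm p x"
proof -
  have p0: "p > 0" "p \<ge> 1" using assms by auto
  obtain f where f: "f \<in> Lp_fun p circle" "x = abs_L0 f" using Lp_cases[OF assms(2) p0(1)] .
  note fm = Lp_fun_measurable[OF f(1)]
  have "x - fejer_L0 N x = abs_L0 (\<lambda>z. f z - fejer N f z)"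
    unfolding f(2) fejer_abs_L0[OF fm] by (rule abs_L0_diff[OF fm trig_measurable[OF trig_fejer]])
  hence "nrm p (x - fejer_L0 N x) = pnorm p circle (\<lambda>z. f z - fejer N f z)"
    using Lp_fun_abs_L0(2)[OF pnorm_triangle_diff(1)[OF p0(2) f(1) fejer_Lp[OF p0(1)]] p0(1)] by simp
  thus ?thesis using pnorm_diff_fejer_le[OF assms(1) f(1)] Lp_fun_abs_L0(2)[OF f(1) p0(1)] f(2) by simp
qed

lemma
  assumes "p \<ge> 1"
  shows fejer_L0_Lp: "fejer_L0 N x \<in> Lp (ennreal p)" 
    and fourier_fejer_L0: "fourier (fejer_L0 N x) k = of_real (fejer_coef N k) * fourier x k"
proof -
  have p0: "p > 0" using assms by auto
  have c: "cscale (of_real (fejer_coef N k) * fourier x k) (zchar_L0 k) \<in> Lp (ennreal p)" for k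
    by (intro Lp_cscale zchar_L0_Lp p0)
  note s = Lp_sum[OF assms, of "{- int N..int N}" "\<lambda>k. cscale (of_real (fejer_coef N k) * fourier x k) (zchar_L0 k)", OF _ c]
  show "fejer_L0 N x \<in> Lp (ennreal p)" unfolding fejer_L0_def using s by simp
  have "fourier (fejer_L0 N x) k = (\<Sum>j\<in>{- int N..int N}. if j = k then of_real (fejer_coef N k) * fourier x k else 0)"
  proof -
    have "fourier (fejer_L0 N x) k = (\<Sum>j\<in>{- int N..int N}. of_real (fejer_coef N j) * fourier x j * (if k = j then 1 else 0))"
      unfolding fejer_L0_def using s[of k] by (simp add: fourier_cscale fourier_zchar_L0)
    also have "\<dots> = (\<Sum>j\<in>{- int N..int N}. if j = k then of_real (fejer_coef N k) * fourier x k else 0)"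
      by (intro sum.cong) auto
    finally show ?thesis .
  qed
  thus "fourier (fejer_L0 N x) k = of_real (fejer_coef N k) * fourier x k"
    by (auto simp: fejer_coef_def)
qed

section \<open>Hardy spaces and the Riesz projection\<close>

lemma HpD:
  assumes "x \<in> Hp p"
  shows "x \<in> Lp p" "k < 0 \<Longrightarrow> fourier x k = 0"
  using assms by (auto simp: Hp_def)

lemma HpI: "x \<in> Lp p \<Longrightarrow> (\<And>k. k < 0 \<Longrightarrow> fourier x k = 0) \<Longrightarrow> x \<in> Hp p"
  by (simp add: Hp_def)

lemma
  assumes "p \<ge> 1" "x \<in> Hp (ennreal p)" "y \<in> Hp (ennreal p)"
  shows Hp_add: "x + y \<in> Hp (ennreal p)" and Hp_diff: "x - y \<in> Hp (ennreal p)"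
  using assms by (auto intro!: HpI Lp_add Lp_diff simp: HpD fourier_add fourier_diff)

lemma Hp_cscale: "p > 0 \<Longrightarrow> x \<in> Hp (ennreal p) \<Longrightarrow> cscale c x \<in> Hp (ennreal p)"
  by (auto intro!: HpI Lp_cscale simp: HpD fourier_cscale)

lemma Hp_zero: "p > 0 \<Longrightarrow> 0 \<in> Hp (ennreal p)"
  by (auto intro!: HpI Lp_zero simp: fourier_zero)

lemma Hp_sum:
  assumes "p \<ge> 1" "finite I" "\<And>i. i \<in> I \<Longrightarrow> x i \<in> Hp (ennreal p)"
  shows "(\<Sum>i\<in>I. x i) \<in> Hp (ennreal p)"
  using assms(2,3)
  by (induction I rule: finite_induct) (use assms(1) in \<open>auto intro: Hp_zero Hp_add\<close>)

lemma zchar_L0_Hp: "p > 0 \<Longrightarrow> k \<ge> 0 \<Longrightarrow> zchar_L0 k \<in> Hp (ennreal p)"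
  by (auto intro!: HpI zchar_L0_Lp simp: fourier_zchar_L0)

lemma Linf_mult_fourier_eq_0:
  assumes "p \<ge> 1" "a \<in> Lp \<infinity>" "x \<in> Lp (ennreal p)"
    and "\<And>k. k < m \<Longrightarrow> fourier a k = 0" "\<And>k. k < n \<Longrightarrow> fourier x k = 0" "k < m + n"
  shows "fourier (a * x) k = 0"
proof -
  have p0: "p > 0" using assms by auto
  obtain \<alpha> where \<alpha>: "\<alpha> \<in> borel_measurable circle" "a = abs_L0 \<alpha>" "AE z in circle. cmod (\<alpha> z) \<le> Lp_norm \<infinity> a" "Lp_norm \<infinity> a \<ge> 0"
    by (rule Linf_cases[OF assms(2)])
  obtain f where f: "f \<in> Lp_fun p circle" "x = abs_L0 f" using Lp_cases[OF assms(3) p0] .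
  note fm = Lp_fun_measurable[OF f(1)]
  note [measurable] = \<alpha>(1) fm
  have m: "(\<lambda>z. \<alpha> z * f z) \<in> borel_measurable circle" by measurable
  have "fcoef (\<lambda>z. \<alpha> z * f z) k = 0"
    by (rule fcoef_bounded_mult_eq_0[OF assms(1) \<alpha>(1,3,4) f(1), of m n])
       (use assms(4-6) in \<open>auto simp: \<alpha>(2) f(2) fourier_abs_L0[OF \<alpha>(1)] fourier_abs_L0[OF fm]\<close>)
  thus ?thesis unfolding \<alpha>(2) f(2) abs_L0_mult[OF \<alpha>(1) fm] fourier_abs_L0[OF m] .
qed

text \<open>The way to evaluate the definite description: exhibit a candidate in
  \<open>L\<^sup>p\<close> with the right coefficients. Linearity of the Toeplitz operator and its
  action on \<open>Hp_shift\<close> are obtained like this.\<close>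

lemma riesz_projection_unique:
  assumes "p \<ge> 1" "u \<in> Lp (ennreal p)" "\<And>k. fourier u k = (if k \<ge> 0 then fourier x k else 0)"
  shows "riesz_projection x = u"
  unfolding riesz_projection_def
proof (rule the_equality)
  show "u \<in> Lp 1 \<and> (\<forall>k. fourier u k = (if k \<ge> 0 then fourier x k else 0))"
    using Lp_subset_L1[OF assms(1,2)] assms(3) by blast
  fix g assume "g \<in> Lp 1 \<and> (\<forall>k. fourier g k = (if k \<ge> 0 then fourier x k else 0))"
  thus "g = u"
    using fourier_unique[of 1 g u] Lp_subset_L1[OF assms(1,2)] assms(3) by simp
qed

lemma riesz_projection_Lp:
  assumes "p > 1"
  obtains C where "C \<ge> 0"
    "\<And>x. x \<in> Lp (ennreal p) \<Longrightarrow> riesz_projection x \<in> Hp (ennreal p)"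
    "\<And>x k. x \<in> Lp (ennreal p) \<Longrightarrow> fourier (riesz_projection x) k = (if k \<ge> 0 then fourier x k else 0)"
    "\<And>x. x \<in> Lp (ennreal p) \<Longrightarrow> nrm p (riesz_projection x) \<le> C * nrm p x"
proof -
  have p0: "p > 0" "p \<ge> 1" using assms by auto
  obtain C where C: "C \<ge> 0" "\<And>f. f \<in> Lp_fun p circle \<Longrightarrow> \<exists>u\<in>Lp_fun p circle. analytic_part f u \<and> pnorm p circle u \<le> C * pnorm p circle f"
    by (rule M_Riesz[OF assms]) blast
  have main: "riesz_projection x \<in> Lp (ennreal p) \<and> (\<forall>k. fourier (riesz_projection x) k = (if k \<ge> 0 then fourier x k else 0)) \<and> nrm p (riesz_projection x) \<le> C * nrm p x"
    if x: "x \<in> Lp (ennreal p)" for x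
  proof -
    obtain f where f: "f \<in> Lp_fun p circle" "x = abs_L0 f" using Lp_cases[OF x p0(1)] .
    obtain u where u: "u \<in> Lp_fun p circle" "analytic_part f u" "pnorm p circle u \<le> C * pnorm p circle f"
      using C(2)[OF f(1)] by blast
    have co: "fourier (abs_L0 u) k = (if k \<ge> 0 then fourier x k else 0)" for k
      using u(2) Lp_fun_measurable[OF f(1)] Lp_fun_measurable[OF u(1)] by (simp add: f(2) fourier_abs_L0 analytic_part_def)
    have "riesz_projection x = abs_L0 u"
      by (rule riesz_projection_unique[OF p0(2) Lp_fun_abs_L0(1)[OF u(1) p0(1)] co])
    thus ?thesis using co Lp_fun_abs_L0[OF u(1) p0(1)] Lp_fun_abs_L0[OF f(1) p0(1)] u(3) f(2) by simp
  qed
  show ?thesis by (rule that[OF C(1)]) (use main in \<open>auto intro!: HpI\<close>)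
qed

section \<open>Upper bounds\<close>

lemma Linf_norm_le:
  assumes m: "h \<in> borel_measurable circle" and h: "AE z in circle. cmod (h z) \<le> c" and "c \<ge> 0"
  shows "Lp_norm \<infinity> (abs_L0 h) \<le> c"
proof -
  obtain \<alpha> where \<alpha>: "\<alpha> \<in> borel_measurable circle" "abs_L0 h = abs_L0 \<alpha>"
    "\<And>c. c \<ge> 0 \<Longrightarrow> AE z in circle. cmod (\<alpha> z) \<le> c \<Longrightarrow> Lp_norm \<infinity> (abs_L0 h) \<le> c"
    by (rule Linf_cases[OF bounded_abs_L0_Linf[OF m h]]) blast
  have "AE z in circle. h z = \<alpha> z" using \<alpha>(2) abs_L0_eq_iff[OF m \<alpha>(1)] by simp
  hence "AE z in circle. cmod (\<alpha> z) \<le> c" using h by eventually_elim simp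
  thus ?thesis using \<alpha>(3) assms(3) by blast
qed

lemma Linf_Lp:
  assumes "a \<in> Lp \<infinity>" "p > 0"
  shows "a \<in> Lp (ennreal p)"
proof -
  obtain \<alpha> where \<alpha>: "\<alpha> \<in> borel_measurable circle" "a = abs_L0 \<alpha>" "AE z in circle. cmod (\<alpha> z) \<le> Lp_norm \<infinity> a" "Lp_norm \<infinity> a \<ge> 0"
    by (rule Linf_cases[OF assms(1)])
  show ?thesis unfolding \<alpha>(2)
    by (rule Lp_fun_abs_L0(1)[OF bounded_Lp_fun(1)[OF prob_space_circle \<alpha>(1,3) assms(2) \<alpha>(4)] assms(2)])
qed

lemma trig_fcoef_bounded_below:
  assumes "trig t"
  obtains N where "\<And>k. k < - int N \<Longrightarrow> fcoef t k = 0"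
proof -
  have "\<exists>N. \<forall>k < - int N. fcoef t k = 0"
    using assms
  proof induction
    case trig_zero
    show ?case by (simp add: fcoef_def)
  next
    case (trig_add_zchar f c k)
    then obtain N where N: "\<forall>k < - int N. fcoef f k = 0" by blast
    have "fcoef (\<lambda>z. f z + c * zchar k z) j = fcoef f j + c * (if j = k then 1 else 0)" for j
      by (subst fcoef_add) (auto intro: trig_integrable trig_add_zchar.hyps trig_zchar simp: fcoef_cmult fcoef_zchar)
    thus ?case using N by (intro exI[of _ "max N (nat \<bar>k\<bar>)"]) auto
  qed
  thus ?thesis using that by blast
qed

text \<open>b = t + g with a trigonometric polynomial t uniformly close to the continuous part. N
  bounds the negative frequencies of t, and g contributes none.\<close>

lemma C_plus_Hinf_approx:
  assumes a: "a \<in> C_plus_Hinf" and e: "e > 0"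
  obtains b N where "b \<in> Lp \<infinity>" "\<And>k. k < - int N \<Longrightarrow> fourier b k = 0" "a - b \<in> Lp \<infinity>" "Lp_norm \<infinity> (a - b) \<le> e"
proof -
  obtain c g where c: "continuous_on (sphere 0 1) c" and g: "g \<in> Hp \<infinity>" and a_eq: "a = abs_L0 c + g"
    using a by (auto simp: C_plus_Hinf_def)
  obtain t where t: "trig t" "\<And>z. cmod z = 1 \<Longrightarrow> cmod (c z - t z) \<le> e" by (rule trig_dense_continuous[OF c e]) blast
  obtain N where N: "\<And>k. k < - int N \<Longrightarrow> fcoef t k = 0" by (rule trig_fcoef_bounded_below[OF t(1)]) blast
  note cm = measurable_circle_continuous[OF c] and tm = trig_measurable[OF t(1)]
  have tb: "abs_L0 t \<in> Lp \<infinity>"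
  proof -
    obtain B where "\<And>z. cmod z = 1 \<Longrightarrow> cmod (t z) \<le> B" using bounded_continuous_circle[OF trig_continuous[OF t(1)]] by blast
    thus ?thesis by (intro bounded_abs_L0_Linf[OF tm, of B] AE_I2) auto
  qed
  have gL: "g \<in> Lp \<infinity>" using g by (simp add: Hp_def)
  let ?b = "abs_L0 t + g"
  have ab: "a - ?b = abs_L0 (\<lambda>z. c z - t z)" by (simp add: a_eq abs_L0_diff[OF cm tm, symmetric])
  have dm: "(\<lambda>z. c z - t z) \<in> borel_measurable circle" using cm tm by measurable
  have dA: "AE z in circle. cmod (c z - t z) \<le> e" by (rule AE_I2) (use t(2) in simp)
  show ?thesis
  proof (rule that[of ?b N])
    show "?b \<in> Lp \<infinity>" by (rule Linf_add[OF tb gL])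
    show "a - ?b \<in> Lp \<infinity>" unfolding ab by (rule bounded_abs_L0_Linf[OF dm dA])
    show "Lp_norm \<infinity> (a - ?b) \<le> e" unfolding ab by (rule Linf_norm_le[OF dm dA]) (use e in simp)
    fix k :: int assume k: "k < - int N"
    have "fourier ?b k = fourier (abs_L0 t) k + fourier g k"
      by (rule fourier_add[of 1]) (use Linf_Lp[OF tb, of 1] Linf_Lp[OF gL, of 1] in auto)
    thus "fourier ?b k = 0" using N[OF k] g k by (simp add: fourier_abs_L0[OF tm] Hp_def)
  qed
qed

lemma C_plus_Hinf_Linf:
  assumes "a \<in> C_plus_Hinf"
  shows "a \<in> Lp \<infinity>"
proof -
  obtain b N where "b \<in> Lp \<infinity>" "a - b \<in> Lp \<infinity>" using C_plus_Hinf_approx[OF assms, of 1] zero_less_one by metis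
  from Linf_add[OF this(2,1)] show ?thesis by simp
qed

lemma mult_cscale: "a * cscale c x = cscale c (a * x)"
proof (rule L0_cases[of a], rule L0_cases[of x])
  fix f g assume m: "f \<in> borel_measurable circle" "g \<in> borel_measurable circle" and e: "a = abs_L0 f" "x = abs_L0 g"
  note [measurable] = m
  have "(\<lambda>z. c * g z) \<in> borel_measurable circle" "(\<lambda>z. f z * g z) \<in> borel_measurable circle" by measurable
  thus ?thesis unfolding e abs_L0_cscale[OF m(2)] abs_L0_mult[OF m]
    by (simp add: abs_L0_mult[OF m(1)] abs_L0_cscale mult.left_commute)
qed

lemma toeplitz_facts:
  assumes "p > 1" "a \<in> Lp \<infinity>"
  obtains B where "B \<ge> 0"
    "linear_map (Hp (ennreal p)) (Hp (ennreal p)) (toeplitz a)"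
    "\<And>f. f \<in> Hp (ennreal p) \<Longrightarrow> nrm p (toeplitz a f) \<le> B * nrm p f"
proof -
  have p0: "p > 0" "p \<ge> 1" using assms by auto
  obtain C where C: "C \<ge> 0"
    "\<And>x. x \<in> Lp (ennreal p) \<Longrightarrow> riesz_projection x \<in> Hp (ennreal p)"
    "\<And>x k. x \<in> Lp (ennreal p) \<Longrightarrow> fourier (riesz_projection x) k = (if k \<ge> 0 then fourier x k else 0)"
    "\<And>x. x \<in> Lp (ennreal p) \<Longrightarrow> nrm p (riesz_projection x) \<le> C * nrm p x"
    by (rule riesz_projection_Lp[OF assms(1)]) blast
  have af: "a * f \<in> Lp (ennreal p)" "nrm p (a * f) \<le> Lp_norm \<infinity> a * nrm p f" if "f \<in> Hp (ennreal p)" for f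
    using Linf_mult[OF p0(1) assms(2) HpD(1)[OF that]] .
  have T: "toeplitz a f \<in> Hp (ennreal p)" if "f \<in> Hp (ennreal p)" for f
    unfolding toeplitz_def by (rule C(2)[OF af(1)[OF that]])
  have "linear_map (Hp (ennreal p)) (Hp (ennreal p)) (toeplitz a)"
    unfolding linear_map_def
  proof (intro conjI ballI allI funcsetI)
    fix f g assume fg: "f \<in> Hp (ennreal p)" "g \<in> Hp (ennreal p)"
    show "toeplitz a (f + g) = toeplitz a f + toeplitz a g"
      unfolding toeplitz_def distrib_left
      by (rule riesz_projection_unique[OF p0(2)])
         (use af[OF fg(1)] af[OF fg(2)] C(2,3) p0 in \<open>auto simp: fourier_add HpD intro!: Lp_add\<close>)
  next
    fix c f assume f: "f \<in> Hp (ennreal p)"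
    show "toeplitz a (cscale c f) = cscale c (toeplitz a f)"
      unfolding toeplitz_def mult_cscale
      by (rule riesz_projection_unique[OF p0(2)])
         (use af[OF f] C(2,3) p0 in \<open>auto simp: fourier_cscale HpD intro!: Lp_cscale\<close>)
  qed (use T in auto)
  moreover have "nrm p (toeplitz a f) \<le> (C * Lp_norm \<infinity> a) * nrm p f" if "f \<in> Hp (ennreal p)" for f
    unfolding toeplitz_def mult.assoc
    by (rule order_trans[OF C(4)[OF af(1)[OF that]] mult_left_mono[OF af(2)[OF that] C(1)]])
  moreover have "C * Lp_norm \<infinity> a \<ge> 0"
  proof -
    have "Lp_norm \<infinity> a \<ge> 0" by (rule Linf_cases[OF assms(2)])
    thus ?thesis using C(1) by simp
  qed
  ultimately show ?thesis using that by blast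
qed

text \<open>This is \<open>z\<^sup>N H\<^sup>p\<close>, described by coefficients so that closedness
  and finite codimension come from properties of \<open>fourier\<close>.\<close>

definition Hp_shift :: "real \<Rightarrow> nat \<Rightarrow> L0 set" where
  "Hp_shift p N = {f \<in> Hp (ennreal p). \<forall>k < int N. fourier f k = 0}"

text \<open>b * f is already analytic, so the projection P leaves it alone and T(a) f - a f = P d -
  d with d = (a - b) * f. The norm of P - I is at most C + 1, hence the precision e/(C + 1) for
  b.\<close>

lemma toeplitz_shift:
  assumes "p > 1" "a \<in> C_plus_Hinf" "e > 0"
  obtains N where "\<And>f. f \<in> Hp_shift p N \<Longrightarrow> nrm p (toeplitz a f - a * f) \<le> e * nrm p f"
proof -
  have p0: "p > 0" "p \<ge> 1" using assms by auto
  obtain C where C: "C \<ge> 0"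
    "\<And>x. x \<in> Lp (ennreal p) \<Longrightarrow> riesz_projection x \<in> Hp (ennreal p)"
    "\<And>x k. x \<in> Lp (ennreal p) \<Longrightarrow> fourier (riesz_projection x) k = (if k \<ge> 0 then fourier x k else 0)"
    "\<And>x. x \<in> Lp (ennreal p) \<Longrightarrow> nrm p (riesz_projection x) \<le> C * nrm p x"
    by (rule riesz_projection_Lp[OF assms(1)]) blast
  have e': "e / (C + 1) > 0" using C(1) assms(3) by simp
  obtain b N where b: "b \<in> Lp \<infinity>" "\<And>k. k < - int N \<Longrightarrow> fourier b k = 0" "a - b \<in> Lp \<infinity>" "Lp_norm \<infinity> (a - b) \<le> e / (C + 1)"
    using C_plus_Hinf_approx[OF assms(2) e'] by blast
  have "nrm p (toeplitz a f - a * f) \<le> e * nrm p f" if f: "f \<in> Hp_shift p N" for f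
  proof -
    have fH: "f \<in> Hp (ennreal p)" "f \<in> Lp (ennreal p)" and f0: "\<And>k. k < int N \<Longrightarrow> fourier f k = 0"
      using f by (auto simp: Hp_shift_def Hp_def)
    define d where "d = (a - b) * f"
    have bf: "b * f \<in> Lp (ennreal p)" by (rule Linf_mult(1)[OF p0(1) b(1) fH(2)])
    have dL: "d \<in> Lp (ennreal p)" unfolding d_def by (rule Linf_mult(1)[OF p0(1) b(3) fH(2)])
    have af: "a * f = b * f + d" by (simp add: d_def algebra_simps)
    have bf0: "fourier (b * f) k = 0" if "k < 0" for k
      by (rule Linf_mult_fourier_eq_0[OF p0(2) b(1) fH(2) b(2) f0]) (use that in auto)
    have "toeplitz a f = b * f + riesz_projection d"
      unfolding toeplitz_def af
      by (rule riesz_projection_unique[OF p0(2)])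
         (use bf dL C(2,3) p0 bf0 in \<open>auto simp: fourier_add HpD intro!: Lp_add\<close>)
    hence "toeplitz a f - a * f = riesz_projection d - d" by (simp add: af)
    also have "nrm p \<dots> \<le> C * nrm p d + nrm p d"
      using nrm_diff[OF p0(2) HpD(1)[OF C(2)[OF dL]] dL] C(4)[OF dL] by simp
    also have "\<dots> = (C + 1) * nrm p d" by (simp add: algebra_simps)
    also have "\<dots> \<le> (C + 1) * (e / (C + 1) * nrm p f)"
    proof -
      have "nrm p d \<le> Lp_norm \<infinity> (a - b) * nrm p f" unfolding d_def by (rule Linf_mult(2)[OF p0(1) b(3) fH(2)])
      also have "\<dots> \<le> e / (C + 1) * nrm p f" by (intro mult_right_mono b(4) nrm_nonneg p0)
      finally show ?thesis using C(1) by (intro mult_left_mono) auto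
    qed
    also have "\<dots> = e * nrm p f" using C(1) by simp
    finally show ?thesis .
  qed
  thus ?thesis using that by blast
qed

section \<open>The subspaces \<open>z\<^sup>N H\<^sup>p\<close> and the upper bound for the
  m-norm\<close>

lemma op_norm_le:
  assumes "\<And>f. f \<in> X \<Longrightarrow> NX f \<le> 1 \<Longrightarrow> NY (A f) \<le> c"
  shows "op_norm X NX NY A \<le> ennreal c"
  unfolding op_norm_def using assms by (auto intro!: SUP_least ennreal_leI)

lemma Metric_space_Hp:
  assumes "p \<ge> 1"
  shows "Metric_space (Hp (ennreal p)) (\<lambda>f g. nrm p (f - g))"
proof
  have p0: "p > 0" using assms by simp
  fix x y z
  show "0 \<le> nrm p (x - y)" by (rule nrm_nonneg[OF p0])
  show "nrm p (x - y) = nrm p (y - x)"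
  proof (rule L0_cases[of x], rule L0_cases[of y])
    fix f g assume m: "f \<in> borel_measurable circle" "g \<in> borel_measurable circle" and e: "x = abs_L0 f" "y = abs_L0 g"
    note [measurable] = m
    have "(\<lambda>z. f z - g z) \<in> borel_measurable circle" "(\<lambda>z. g z - f z) \<in> borel_measurable circle" by measurable
    thus ?thesis unfolding e abs_L0_diff[OF m] abs_L0_diff[OF m(2,1)]
      using pnorm_uminus[of p circle "\<lambda>z. f z - g z"] p0 by (simp add: Lp_norm_abs_L0)
  qed
  assume x: "x \<in> Hp (ennreal p)" and y: "y \<in> Hp (ennreal p)"
  show "nrm p (x - y) = 0 \<longleftrightarrow> x = y"
    using nrm_eq_0[OF assms HpD(1)[OF Hp_diff[OF assms x y]]] by (auto simp: nrm_zero p0)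
  assume z: "z \<in> Hp (ennreal p)"
  have "nrm p ((x - y) + (y - z)) \<le> nrm p (x - y) + nrm p (y - z)"
    by (intro nrm_add assms HpD(1) Hp_diff x y z)
  thus "nrm p (x - z) \<le> nrm p (x - y) + nrm p (y - z)" by simp
qed

lemma subspace_Hp_shift:
  assumes "p \<ge> 1"
  shows "L0.subspace (Hp_shift p N)"
proof -
  have "p > 0" using assms by simp
  thus ?thesis using assms
    by (auto simp: L0.subspace_def Hp_shift_def fourier_zero fourier_cscale HpD fourier_add
        intro: Hp_zero Hp_add Hp_cscale)
qed

text \<open>Coefficients are 1-Lipschitz, so the ball about x of radius |fourier x k| contains no
  element whose k-th coefficient vanishes.\<close>

lemma closedin_Hp_shift:
  assumes "p \<ge> 1"
  shows "closedin (norm_topology (Hp (ennreal p)) (nrm p)) (Hp_shift p N)"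
proof -
  interpret Metric_space "Hp (ennreal p)" "\<lambda>f g. nrm p (f - g)" by (rule Metric_space_Hp[OF assms])
  show ?thesis unfolding closedin_metric
  proof (intro conjI allI impI)
    show "Hp_shift p N \<subseteq> Hp (ennreal p)" by (auto simp: Hp_shift_def)
    fix x assume x: "x \<in> Hp (ennreal p) - Hp_shift p N"
    then obtain k where k: "k < int N" "fourier x k \<noteq> 0" by (auto simp: Hp_shift_def)
    have "y \<notin> Hp_shift p N" if y: "y \<in> mball x (cmod (fourier x k))" for y
    proof
      assume "y \<in> Hp_shift p N"
      hence "fourier y k = 0" using k by (auto simp: Hp_shift_def)
      moreover have yH: "y \<in> Hp (ennreal p)" "nrm p (x - y) < cmod (fourier x k)" using y by auto
      ultimately have "cmod (fourier x k) \<le> nrm p (x - y)"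
        using norm_fourier_le[OF assms HpD(1)[OF Hp_diff[OF assms _ yH(1)]], of x k] x
          fourier_diff[OF assms HpD(1) HpD(1)[OF yH(1)], of x k] by auto
      thus False using yH(2) by simp
    qed
    thus "\<exists>r>0. disjnt (Hp_shift p N) (mball x r)"
      using k(2) by (intro exI[of _ "cmod (fourier x k)"]) (auto simp: disjnt_def)
  qed
qed

text \<open>For f in \<open>H\<^sup>p\<close> this is a partial sum of its Fourier series, and
  subtracting it lands in \<open>Hp_shift p N\<close>. The norm bound by the sum of moduli is useful
  when the coefficients themselves are small.\<close>

definition low_part :: "nat \<Rightarrow> L0 \<Rightarrow> L0" where
  "low_part N f = (\<Sum>k\<in>{0..<int N}. cscale (fourier f k) (zchar_L0 k))"

lemma
  assumes "p \<ge> 1"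
  shows low_part_Hp: "low_part N f \<in> Hp (ennreal p)"
    and fourier_low_part: "fourier (low_part N f) k = (if k \<in> {0..<int N} then fourier f k else 0)"
    and nrm_low_part: "nrm p (low_part N f) \<le> (\<Sum>k\<in>{0..<int N}. cmod (fourier f k))"
proof -
  have p0: "p > 0" using assms by simp
  have c: "cscale (fourier f k) (zchar_L0 k) \<in> Lp (ennreal p)" for k by (intro Lp_cscale zchar_L0_Lp p0)
  note s = Lp_sum[OF assms, of "{0..<int N}" "\<lambda>k. cscale (fourier f k) (zchar_L0 k)", OF _ c]
  show "low_part N f \<in> Hp (ennreal p)" unfolding low_part_def
    by (intro Hp_sum assms Hp_cscale p0 zchar_L0_Hp) auto
  have "fourier (low_part N f) k = (\<Sum>j\<in>{0..<int N}. fourier f j * (if k = j then 1 else 0))"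
    unfolding low_part_def using s[of k] by (simp add: fourier_cscale fourier_zchar_L0)
  also have "\<dots> = (\<Sum>j\<in>{0..<int N}. if j = k then fourier f k else 0)" by (intro sum.cong) auto
  finally show "fourier (low_part N f) k = (if k \<in> {0..<int N} then fourier f k else 0)" by simp
  have "nrm p (low_part N f) \<le> (\<Sum>k\<in>{0..<int N}. nrm p (cscale (fourier f k) (zchar_L0 k)))"
    unfolding low_part_def using s by simp
  also have "\<dots> \<le> (\<Sum>k\<in>{0..<int N}. cmod (fourier f k))"
    using nrm_zchar_L0_le[OF p0] by (intro sum_mono) (simp add: nrm_cscale[OF p0 zchar_L0_Lp[OF p0]] mult_left_le)
  finally show "nrm p (low_part N f) \<le> (\<Sum>k\<in>{0..<int N}. cmod (fourier f k))" .
qed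

lemma diff_low_part:
  assumes "p \<ge> 1" "f \<in> Hp (ennreal p)"
  shows "f - low_part N f \<in> Hp_shift p N"
  using assms low_part_Hp[OF assms(1), of N f]
  by (auto simp: Hp_shift_def fourier_low_part fourier_diff HpD Hp_diff)

lemma finite_codim_Hp_shift:
  assumes "p \<ge> 1"
  shows "finite_codim (Hp (ennreal p)) (Hp_shift p N)"
  unfolding finite_codim_def
proof (intro exI conjI ballI)
  show "finite (zchar_L0 ` {0..<int N})" by simp
  show "zchar_L0 ` {0..<int N} \<subseteq> Hp (ennreal p)" using assms by (auto intro!: zchar_L0_Hp)
  fix f assume f: "f \<in> Hp (ennreal p)"
  have "low_part N f \<in> L0.span (zchar_L0 ` {0..<int N})"
    unfolding low_part_def by (intro L0.span_sum L0.span_scale L0.span_base imageI)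
  thus "\<exists>b\<in>L0.span (zchar_L0 ` {0..<int N}). f - b \<in> Hp_shift p N"
    using diff_low_part[OF assms f] by blast
qed

lemma nrm_toeplitz_shift_le:
  assumes "p > 1" "a \<in> Lp \<infinity>" "f \<in> Hp (ennreal p)" "nrm p (toeplitz a f - a * f) \<le> e * nrm p f"
  shows "nrm p (toeplitz a f) \<le> (Lp_norm \<infinity> a + e) * nrm p f"
    and "nrm p (a * f) - e * nrm p f \<le> nrm p (toeplitz a f)"
proof -
  have p0: "p > 0" "p \<ge> 1" using assms by auto
  have T: "toeplitz a f \<in> Lp (ennreal p)"
    by (rule toeplitz_facts[OF assms(1,2)]) (use assms(3) HpD(1) in \<open>auto simp: linear_map_def\<close>)
  have af: "a * f \<in> Lp (ennreal p)" "nrm p (a * f) \<le> Lp_norm \<infinity> a * nrm p f"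
    using Linf_mult[OF p0(1) assms(2) HpD(1)[OF assms(3)]] .
  have "nrm p ((toeplitz a f - a * f) + a * f) \<le> nrm p (toeplitz a f - a * f) + nrm p (a * f)"
    by (intro nrm_add p0 Lp_diff T af)
  thus "nrm p (toeplitz a f) \<le> (Lp_norm \<infinity> a + e) * nrm p f" using assms(4) af(2) by (simp add: algebra_simps)
  have "nrm p (toeplitz a f - (toeplitz a f - a * f)) \<le> nrm p (toeplitz a f) + nrm p (toeplitz a f - a * f)"
    by (intro nrm_diff p0 Lp_diff T af)
  thus "nrm p (a * f) - e * nrm p f \<le> nrm p (toeplitz a f)" using assms(4) by simp
qed

lemma m_norm_toeplitz_le:
  assumes "p > 1" "a \<in> C_plus_Hinf"
  shows "m_norm (Hp (ennreal p)) (nrm p) (nrm p) (toeplitz a) \<le> ennreal (Lp_norm \<infinity> a)"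
proof (rule ennreal_le_epsilon)
  fix e :: real assume e: "e > 0"
  have p0: "p > 0" "p \<ge> 1" using assms by auto
  note aL = C_plus_Hinf_Linf[OF assms(2)]
  have A0: "Lp_norm \<infinity> a \<ge> 0" by (rule Linf_cases[OF aL])
  obtain N where N: "\<And>f. f \<in> Hp_shift p N \<Longrightarrow> nrm p (toeplitz a f - a * f) \<le> e * nrm p f"
    by (rule toeplitz_shift[OF assms e]) blast
  have "m_norm (Hp (ennreal p)) (nrm p) (nrm p) (toeplitz a) \<le> op_norm (Hp_shift p N) (nrm p) (nrm p) (toeplitz a)"
    unfolding m_norm_def
    by (rule INF_lower) (use subspace_Hp_shift closedin_Hp_shift finite_codim_Hp_shift p0 in \<open>auto simp: Hp_shift_def\<close>)
  also have "\<dots> \<le> ennreal (Lp_norm \<infinity> a + e)"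
  proof (rule op_norm_le)
    fix f assume f: "f \<in> Hp_shift p N" "nrm p f \<le> 1"
    have "nrm p (toeplitz a f) \<le> (Lp_norm \<infinity> a + e) * nrm p f"
      by (rule nrm_toeplitz_shift_le(1)[OF assms(1) aL _ N[OF f(1)]]) (use f in \<open>simp add: Hp_shift_def\<close>)
    also have "\<dots> \<le> (Lp_norm \<infinity> a + e) * 1" using f(2) A0 e by (intro mult_left_mono) auto
    finally show "nrm p (toeplitz a f) \<le> Lp_norm \<infinity> a + e" by simp
  qed
  also have "\<dots> = ennreal (Lp_norm \<infinity> a) + ennreal e" using A0 e by simp
  finally show "m_norm (Hp (ennreal p)) (nrm p) (nrm p) (toeplitz a) \<le> ennreal (Lp_norm \<infinity> a) + ennreal e" .
qed

text \<open>The continuous image of a finite product of closed unit discs, which is compact by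
  Tychonoff.\<close>

lemma compact_finite_sums:
  assumes "p \<ge> 1" "finite I" and u: "\<And>k. k \<in> I \<Longrightarrow> u k \<in> Hp (ennreal p)"
  shows "compactin (norm_topology (Hp (ennreal p)) (nrm p)) {(\<Sum>k\<in>I. cscale (c k) (u k)) | c. \<forall>k\<in>I. cmod (c k) \<le> 1}"
proof -
  have p0: "p > 0" using assms by simp
  interpret Metric_space "Hp (ennreal p)" "\<lambda>f g. nrm p (f - g)" by (rule Metric_space_Hp[OF assms(1)])
  let ?X = "product_topology (\<lambda>_. top_of_set (cball 0 1 :: complex set)) I"
  let ?F = "\<lambda>c. \<Sum>k\<in>I. cscale (c k) (u k)"
  have FH: "?F c \<in> Hp (ennreal p)" for c by (intro Hp_sum Hp_cscale assms p0 u)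
  have top: "topspace ?X = (\<Pi>\<^sub>E k\<in>I. cball 0 1)" by simp
  have "compact_space ?X"
    unfolding compact_space_product_topology by (auto simp: compact_space_subtopology)
  hence "compactin ?X (topspace ?X)" by (simp add: compact_space_def)
  moreover have "continuous_map ?X mtopology ?F"
    unfolding continuous_map_to_metric
  proof (intro ballI allI impI)
    fix c and e :: real assume c: "c \<in> topspace ?X" and e: "e > 0"
    \<comment> \<open>The added 1 makes S positive and the final estimate strict: e/S * (S - 1) <
      e.\<close>
    define S where "S = (\<Sum>k\<in>I. nrm p (u k)) + 1"
    have S: "S > 0" unfolding S_def by (intro add_nonneg_pos sum_nonneg nrm_nonneg p0) simp
    define U where "U = (\<Pi>\<^sub>E k\<in>I. cball 0 1 \<inter> ball (c k) (e / S))"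
    have "openin ?X U"
      unfolding U_def using assms(2) by (subst openin_PiE) (auto simp: openin_open_Int)
    moreover have "c \<in> U" using c e S by (auto simp: U_def PiE_iff)
    moreover have "?F y \<in> mball (?F c) e" if y: "y \<in> U" for y
    proof -
      have "?F c - ?F y = (\<Sum>k\<in>I. cscale (c k - y k) (u k))"
        by (simp add: sum_subtractf L0.scale_left_diff_distrib)
      hence "nrm p (?F c - ?F y) \<le> (\<Sum>k\<in>I. nrm p (cscale (c k - y k) (u k)))"
        using Lp_sum[OF assms(1,2), of "\<lambda>k. cscale (c k - y k) (u k)"] u by (auto simp: Lp_cscale HpD p0)
      also have "\<dots> \<le> (\<Sum>k\<in>I. e / S * nrm p (u k))"
      proof (rule sum_mono)
        fix k assume k: "k \<in> I"
        have "y k \<in> ball (c k) (e / S)" using y k by (auto simp: U_def)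
        hence "cmod (c k - y k) \<le> e / S" by (simp add: dist_norm)
        thus "nrm p (cscale (c k - y k) (u k)) \<le> e / S * nrm p (u k)"
          unfolding nrm_cscale[OF p0 HpD(1)[OF u[OF k]]] by (intro mult_right_mono nrm_nonneg p0)
      qed
      also have "\<dots> = e / S * (S - 1)" by (simp add: S_def sum_distrib_left)
      also have "\<dots> < e / S * S" using e S by (intro mult_strict_left_mono) auto
      also have "\<dots> = e" using S by simp
      finally show ?thesis using FH by simp
    qed
    ultimately show "\<exists>U. openin ?X U \<and> c \<in> U \<and> (\<forall>y\<in>U. ?F y \<in> mball (?F c) e)" by blast
  qed
  ultimately have "compactin mtopology (?F ` topspace ?X)" by (rule image_compactin)
  also have "?F ` topspace ?X = {?F c | c. \<forall>k\<in>I. cmod (c k) \<le> 1}"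
  proof safe
    fix c assume "c \<in> topspace ?X"
    thus "\<exists>c'. ?F c = ?F c' \<and> (\<forall>k\<in>I. cmod (c' k) \<le> 1)" by (intro exI[of _ c]) (auto simp: PiE_iff)
  next
    fix c assume c: "\<forall>k\<in>I. cmod (c k) \<le> 1"
    show "?F c \<in> ?F ` topspace ?X"
      \<comment> \<open>Points of the product are extensional functions, so c is restricted to I
        without changing the sum.\<close>
      by (rule image_eqI[of _ _ "restrict c I"]) (use c in auto)
  qed
  finally show ?thesis .
qed

text \<open>On the unit ball the coefficients of the Fejer mean have modulus at most 1, so the image
  lies in a compact set of finite sums. That set is closed, as the topology is Hausdorff, and hence
  contains the closure of the image.\<close>

lemma compact_operator_toeplitz_fejer:
  assumes "p > 1" "a \<in> Lp \<infinity>"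
  shows "compact_operator (Hp (ennreal p)) (nrm p) (Hp (ennreal p)) (nrm p) (\<lambda>f. toeplitz a (fejer_L0 n f))"
  unfolding compact_operator_def
proof
  have p0: "p > 0" "p \<ge> 1" using assms by auto
  obtain lin: "linear_map (Hp (ennreal p)) (Hp (ennreal p)) (toeplitz a)" by (rule toeplitz_facts[OF assms])
  have T: "toeplitz a f \<in> Hp (ennreal p)" if "f \<in> Hp (ennreal p)" for f using lin that by (auto simp: linear_map_def)
  have Tadd: "toeplitz a (f + g) = toeplitz a f + toeplitz a g" if "f \<in> Hp (ennreal p)" "g \<in> Hp (ennreal p)" for f g
    using lin that by (simp add: linear_map_def)
  have Tsc: "toeplitz a (cscale c f) = cscale c (toeplitz a f)" if "f \<in> Hp (ennreal p)" for c f
    using lin that by (simp add: linear_map_def)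
  have T0: "toeplitz a 0 = 0" using Tsc[OF Hp_zero[OF p0(1)], of 0] by (simp add: L0.scale_zero_left)
  have fH: "fejer_L0 n f \<in> Hp (ennreal p)" if "f \<in> Hp (ennreal p)" for f
    using that by (intro HpI fejer_L0_Lp p0) (simp add: fourier_fejer_L0[OF p0(2)] HpD)
  have fadd: "fejer_L0 n (f + g) = fejer_L0 n f + fejer_L0 n g" if "f \<in> Hp (ennreal p)" "g \<in> Hp (ennreal p)" for f g
    by (simp add: fejer_L0_def fourier_add[OF p0(2) HpD(1)[OF that(1)] HpD(1)[OF that(2)]] distrib_left L0.scale_left_distrib sum.distrib)
  have fsc: "fejer_L0 n (cscale c f) = cscale c (fejer_L0 n f)" for c f
    by (simp add: fejer_L0_def fourier_cscale L0.scale_sum_right mult.left_commute)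
  show "linear_map (Hp (ennreal p)) (Hp (ennreal p)) (\<lambda>f. toeplitz a (fejer_L0 n f))"
    unfolding linear_map_def by (auto simp: T fH fadd fsc Tadd Tsc)
  let ?top = "norm_topology (Hp (ennreal p)) (nrm p)"
  interpret Metric_space "Hp (ennreal p)" "\<lambda>f g. nrm p (f - g)" by (rule Metric_space_Hp[OF p0(2)])
  let ?I = "{0..int n}"
  let ?S = "{(\<Sum>k\<in>?I. cscale (c k) (toeplitz a (zchar_L0 k))) | c. \<forall>k\<in>?I. cmod (c k) \<le> 1}"
  have comp: "compactin ?top ?S"
    by (rule compact_finite_sums[OF p0(2)]) (auto intro!: T zchar_L0_Hp p0)
  have sum: "toeplitz a (\<Sum>k\<in>J. cscale (c k) (zchar_L0 k)) = (\<Sum>k\<in>J. cscale (c k) (toeplitz a (zchar_L0 k)))"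
    if "finite J" "\<And>k. k \<in> J \<Longrightarrow> k \<ge> 0" for J c
    using that
  proof (induction J rule: finite_induct)
    case (insert k J)
    have "(\<Sum>k\<in>J. cscale (c k) (zchar_L0 k)) \<in> Hp (ennreal p)" using insert by (intro Hp_sum Hp_cscale zchar_L0_Hp p0) auto
    thus ?case using insert by (simp add: Tadd Tsc Hp_cscale zchar_L0_Hp p0)
  qed (simp add: T0)
  have "(\<lambda>f. toeplitz a (fejer_L0 n f)) ` {f \<in> Hp (ennreal p). nrm p f \<le> 1} \<subseteq> ?S"
  proof safe
    fix f assume f: "f \<in> Hp (ennreal p)" "nrm p f \<le> 1"
    let ?c = "\<lambda>k. of_real (fejer_coef n k) * fourier f k"
    have "fejer_L0 n f = (\<Sum>k\<in>?I. cscale (?c k) (zchar_L0 k))"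
      unfolding fejer_L0_def by (intro sum.mono_neutral_right) (use f in \<open>auto simp: HpD L0.scale_zero_left\<close>)
    hence "toeplitz a (fejer_L0 n f) = toeplitz a (\<Sum>k\<in>?I. cscale (?c k) (zchar_L0 k))" by (rule arg_cong)
    also have "\<dots> = (\<Sum>k\<in>?I. cscale (?c k) (toeplitz a (zchar_L0 k)))" by (rule sum) auto
    finally have "toeplitz a (fejer_L0 n f) = (\<Sum>k\<in>?I. cscale (?c k) (toeplitz a (zchar_L0 k)))" .
    moreover have "cmod (?c k) \<le> 1" for k
    proof -
      have "cmod (?c k) \<le> 1 * 1"
        unfolding norm_mult using fejer_coef_bounds[of n k] norm_fourier_le[OF p0(2) HpD(1)[OF f(1)], of k] f(2)
        by (intro mult_mono) auto
      thus ?thesis by simp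
    qed
    ultimately show "\<exists>c. toeplitz a (fejer_L0 n f) = (\<Sum>k\<in>?I. cscale (c k) (toeplitz a (zchar_L0 k))) \<and> (\<forall>k\<in>?I. cmod (c k) \<le> 1)"
      by (intro exI[of _ ?c] conjI ballI)
  qed
  hence "?top closure_of ((\<lambda>f. toeplitz a (fejer_L0 n f)) ` {f \<in> Hp (ennreal p). nrm p f \<le> 1}) \<subseteq> ?S"
    using compactin_imp_closedin[OF Hausdorff_space_mtopology comp] by (rule closure_of_minimal)
  thus "compactin ?top (?top closure_of ((\<lambda>f. toeplitz a (fejer_L0 n f)) ` {f \<in> Hp (ennreal p). nrm p f \<le> 1}))"
    by (rule closed_compactin[OF comp _ closedin_closure_of])
qed

lemma essential_norm_toeplitz_le:
  assumes "p > 1" "a \<in> C_plus_Hinf"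
  shows "essential_norm (Hp (ennreal p)) (nrm p) (Hp (ennreal p)) (nrm p) (toeplitz a)
    \<le> ennreal (2 powr \<bar>1 - 2 / p\<bar> * Lp_norm \<infinity> a)"
proof (rule ennreal_le_epsilon)
  fix \<epsilon> :: real assume \<epsilon>: "\<epsilon> > 0"
  have p0: "p > 0" "p \<ge> 1" using assms by auto
  note aL = C_plus_Hinf_Linf[OF assms(2)]
  define A D where "A = Lp_norm \<infinity> a" and "D = 2 powr \<bar>1 - 2 / p\<bar>"
  have A0: "A \<ge> 0" unfolding A_def by (rule Linf_cases[OF aL])
  have D0: "D > 0" by (simp add: D_def)
  \<comment> \<open>With e * D = \<epsilon>/2 the limit (A + e) * D of the estimate below is D * A +
    \<epsilon>/2, strictly below the target.\<close>
  define e where "e = \<epsilon> / (2 * D)"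
  have e: "e > 0" "e * D = \<epsilon> / 2" using \<epsilon> D0 by (auto simp: e_def)
  obtain N where N: "\<And>f. f \<in> Hp_shift p N \<Longrightarrow> nrm p (toeplitz a f - a * f) \<le> e * nrm p f"
    by (rule toeplitz_shift[OF assms e(1)]) blast
  obtain B where B: "B \<ge> 0" and lin: "linear_map (Hp (ennreal p)) (Hp (ennreal p)) (toeplitz a)"
    and TB: "\<And>f. f \<in> Hp (ennreal p) \<Longrightarrow> nrm p (toeplitz a f) \<le> B * nrm p f"
    by (rule toeplitz_facts[OF assms(1) aL]) blast
  have T: "toeplitz a f \<in> Hp (ennreal p)" if "f \<in> Hp (ennreal p)" for f using lin that by (auto simp: linear_map_def)
  have Tadd: "toeplitz a (f + g) = toeplitz a f + toeplitz a g" if "f \<in> Hp (ennreal p)" "g \<in> Hp (ennreal p)" for f g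
    using lin that by (simp add: linear_map_def)
  \<comment> \<open>On the unit ball \<eta> n bounds the first N modes of
    \<open>f - fejer_L0 n f\<close>; for fixed N it tends to 0.\<close>
  define \<eta> where "\<eta> n = (\<Sum>k\<in>{0..<int N}. 1 - fejer_coef n k)" for n
  have \<eta>0: "\<eta> n \<ge> 0" for n unfolding \<eta>_def using fejer_coef_bounds(2) by (intro sum_nonneg) auto
  have "(\<lambda>n. B * \<eta> n + (A + e) * (D + \<eta> n)) \<longlonglongrightarrow> B * (\<Sum>k\<in>{0..<int N}. 1 - 1) + (A + e) * (D + (\<Sum>k\<in>{0..<int N}. 1 - 1))"
    unfolding \<eta>_def by (intro tendsto_intros fejer_coef_lim)
  moreover have "B * (\<Sum>k\<in>{0..<int N}. 1 - 1) + (A + e) * (D + (\<Sum>k\<in>{0..<int N}. 1 - 1)) < D * A + \<epsilon>"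
    using \<epsilon> e(2) by (simp add: algebra_simps)
  ultimately have "\<forall>\<^sub>F n in sequentially. B * \<eta> n + (A + e) * (D + \<eta> n) < D * A + \<epsilon>"
    by (rule order_tendstoD(2))
  then obtain n where n: "B * \<eta> n + (A + e) * (D + \<eta> n) < D * A + \<epsilon>"
    by (meson eventually_happens trivial_limit_sequentially)
  have "essential_norm (Hp (ennreal p)) (nrm p) (Hp (ennreal p)) (nrm p) (toeplitz a)
     \<le> op_norm (Hp (ennreal p)) (nrm p) (nrm p) (\<lambda>f. toeplitz a f - toeplitz a (fejer_L0 n f))"
    unfolding essential_norm_def
    by (rule INF_lower) (use compact_operator_toeplitz_fejer[OF assms(1) aL] in simp)
  also have "\<dots> \<le> ennreal (D * A + \<epsilon>)"
  proof (rule op_norm_le)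
    fix f assume f: "f \<in> Hp (ennreal p)" "nrm p f \<le> 1"
    note fL = HpD(1)[OF f(1)]
    have fjH: "fejer_L0 n f \<in> Hp (ennreal p)"
      using f(1) by (intro HpI fejer_L0_Lp p0) (simp add: fourier_fejer_L0[OF p0(2)] HpD)
    define y where "y = f - fejer_L0 n f"
    have yH: "y \<in> Hp (ennreal p)" unfolding y_def by (rule Hp_diff[OF p0(2) f(1) fjH])
    have yn: "nrm p y \<le> D"
    proof -
      have "nrm p y \<le> D * nrm p f" unfolding y_def D_def by (rule nrm_diff_fejer_L0_le[OF assms(1) fL])
      also have "\<dots> \<le> D * 1" using f(2) D0 by (intro mult_left_mono) auto
      finally show ?thesis by simp
    qed
    \<comment> \<open>y itself need not lie in \<open>Hp_shift p N\<close>. Its low modes are split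
      off: their norm is at most \<eta> n, so the crude bound B suffices for them, while T(a) almost
      acts as multiplication on the rest.\<close>
    let ?s = "low_part N y" and ?r = "y - low_part N y"
    note sH = low_part_Hp[OF p0(2), of N y]
    have rS: "?r \<in> Hp_shift p N" by (rule diff_low_part[OF p0(2) yH])
    have rH: "?r \<in> Hp (ennreal p)" using rS by (simp add: Hp_shift_def)
    have sn: "nrm p ?s \<le> \<eta> n"
    proof -
      have "nrm p ?s \<le> (\<Sum>k\<in>{0..<int N}. cmod (fourier y k))" by (rule nrm_low_part[OF p0(2)])
      also have "\<dots> \<le> \<eta> n" unfolding \<eta>_def
      proof (rule sum_mono)
        fix k
        have "fourier y k = of_real (1 - fejer_coef n k) * fourier f k"
          unfolding y_def by (simp add: fourier_diff[OF p0(2) fL HpD(1)[OF fjH]] fourier_fejer_L0[OF p0(2)] algebra_simps)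
        hence "cmod (fourier y k) = (1 - fejer_coef n k) * cmod (fourier f k)"
          using fejer_coef_bounds(2)[of n k] by (simp only: norm_mult norm_of_real)
        also have "\<dots> \<le> (1 - fejer_coef n k) * 1"
          using fejer_coef_bounds(2)[of n k] norm_fourier_le[OF p0(2) fL, of k] f(2) by (intro mult_left_mono) auto
        finally show "cmod (fourier y k) \<le> 1 - fejer_coef n k" by simp
      qed
      finally show ?thesis .
    qed
    have rn: "nrm p ?r \<le> D + \<eta> n"
      using nrm_diff[OF p0(2) HpD(1)[OF yH] HpD(1)[OF sH]] yn sn by simp
    have "toeplitz a f = toeplitz a (y + fejer_L0 n f)" by (simp add: y_def)
    also have "\<dots> = toeplitz a (?s + ?r) + toeplitz a (fejer_L0 n f)" by (simp add: Tadd yH fjH)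
    also have "\<dots> = toeplitz a ?s + toeplitz a ?r + toeplitz a (fejer_L0 n f)" by (simp only: Tadd[OF sH rH])
    finally have "toeplitz a f - toeplitz a (fejer_L0 n f) = toeplitz a ?s + toeplitz a ?r" by simp
    also have "nrm p \<dots> \<le> nrm p (toeplitz a ?s) + nrm p (toeplitz a ?r)"
      by (intro nrm_add p0 HpD(1) T sH rH)
    also have "\<dots> \<le> B * nrm p ?s + (A + e) * nrm p ?r"
      unfolding A_def by (intro add_mono TB sH nrm_toeplitz_shift_le(1)[OF assms(1) aL rH N[OF rS]])
    also have "\<dots> \<le> B * \<eta> n + (A + e) * (D + \<eta> n)"
      using B A0 e by (intro add_mono mult_left_mono sn rn) auto
    finally show "nrm p (toeplitz a f - toeplitz a (fejer_L0 n f)) \<le> D * A + \<epsilon>" using n by simp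
  qed
  also have "\<dots> = ennreal (D * A) + ennreal \<epsilon>" using A0 D0 \<epsilon> by simp
  finally show "essential_norm (Hp (ennreal p)) (nrm p) (Hp (ennreal p)) (nrm p) (toeplitz a)
    \<le> ennreal (2 powr \<bar>1 - 2 / p\<bar> * Lp_norm \<infinity> a) + ennreal \<epsilon>" by (simp add: A_def D_def)
qed

section \<open>Lower bound\<close>

text \<open>The preimage under \<open>cis\<close> in [-pi, pi] has at most two points; -pi is listed
  because w = -1 is reached at both ends.\<close>

lemma measure_circle_singleton: "measure circle {w} = 0" if "cmod w = 1"
proof -
  have cm: "cis \<in> uniform_measure lborel {-pi..pi} \<rightarrow>\<^sub>M restrict_space borel (sphere 0 1)"
    using cis_measurable_sphere by simp
  have W: "{w} \<in> sets (restrict_space borel (sphere 0 1))"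
    unfolding sets_restrict_space using that by (auto intro!: image_eqI[of _ _ "{w}"])
  have V: "cis -` {w} \<in> sets borel"
    using measurable_sets[OF cis_measurable_sphere W] by simp
  have "{-pi..pi} \<inter> cis -` {w} \<subseteq> {- pi, Arg w}"
  proof
    fix t assume t: "t \<in> {-pi..pi} \<inter> cis -` {w}"
    show "t \<in> {- pi, Arg w}"
    proof (cases "t = - pi")
      case False
      hence "Arg w = t" using t that by (intro cis_Arg_unique) (auto simp: sgn_eq)
      thus ?thesis by simp
    qed simp
  qed
  hence "emeasure lborel ({-pi..pi} \<inter> cis -` {w}) = 0"
    by (meson countable_finite emeasure_lborel_countable finite.emptyI finite.insertI finite_subset)
  hence "emeasure circle {w} = 0"
    unfolding circle_def using V
    by (subst emeasure_distr[OF cm W]) (simp add: emeasure_uniform_measure)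
  thus ?thesis by (simp add: measure_def)
qed

text \<open>No atoms: every point has a ball of measure less than that of E. Finitely many such
  balls cover the circle, so one of them meets E in positive measure, and it cannot exhaust
  E.\<close>

lemma circle_split:
  assumes E: "E \<in> sets circle" "measure circle E > 0"
  obtains b where "b \<in> sets circle" "b \<subseteq> E" "measure circle b > 0" "measure circle (E - b) > 0"
proof -
  have bs: "ball w r \<inter> sphere 0 1 \<in> sets circle" for w r
    unfolding sets_circle sets_restrict_space by (auto simp: Int_commute)
  have "\<exists>r>0. measure circle (ball w r \<inter> sphere 0 1) < measure circle E" if w: "cmod w = 1" for w
  proof -
    let ?B = "\<lambda>n. ball w (1 / real (Suc n)) \<inter> sphere 0 1"
    have "(\<lambda>n. measure circle (?B n)) \<longlonglongrightarrow> measure circle (\<Inter>n. ?B n)"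
    proof (rule circle.finite_Lim_measure_decseq)
      show "range ?B \<subseteq> sets circle" using bs by auto
      show "decseq ?B"
      proof (intro decseq_SucI Int_mono subset_ball order_refl)
        fix n
        show "1 / real (Suc (Suc n)) \<le> 1 / real (Suc n)" by (intro divide_left_mono) auto
      qed
    qed
    also have "(\<Inter>n. ?B n) = {w}"
    proof safe
      fix z assume z: "z \<in> (\<Inter>n. ?B n)"
      show "z = w"
      proof (rule ccontr)
        assume "z \<noteq> w"
        then obtain n where "inverse (real (Suc n)) < dist w z" using reals_Archimedean[of "dist w z"] by auto
        moreover have "dist w z < 1 / real (Suc n)" using z by auto
        ultimately show False by (simp add: inverse_eq_divide)
      qed
    qed (use w in auto)
    finally have "(\<lambda>n. measure circle (?B n)) \<longlonglongrightarrow> 0" using measure_circle_singleton[OF w] by simp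
    hence "\<forall>\<^sub>F n in sequentially. measure circle (?B n) < measure circle E"
      by (rule order_tendstoD(2)) (rule E(2))
    then obtain n where "measure circle (?B n) < measure circle E"
      by (meson eventually_happens trivial_limit_sequentially)
    thus ?thesis by (intro exI[of _ "1 / real (Suc n)"]) auto
  qed
  then obtain r where r: "\<And>w. cmod w = 1 \<Longrightarrow> r w > 0" "\<And>w. cmod w = 1 \<Longrightarrow> measure circle (ball w (r w) \<inter> sphere 0 1) < measure circle E"
    by metis
  have "compact (sphere 0 1 :: complex set)" by simp
  then obtain C where C: "C \<subseteq> sphere 0 1" "finite C" "sphere 0 1 \<subseteq> (\<Union>w\<in>C. ball w (r w))"
    by (rule compactE_image[of _ "sphere 0 1" "\<lambda>w. ball w (r w)"]) (use r(1) in auto)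
  have Es: "E \<subseteq> sphere 0 1" using sets.sets_into_space[OF E(1)] by simp
  let ?b = "\<lambda>w. E \<inter> (ball w (r w) \<inter> sphere 0 1)"
  have bm: "?b w \<in> sets circle" for w by (intro sets.Int E bs)
  have "\<exists>w\<in>C. measure circle (?b w) > 0"
  proof (rule ccontr)
    assume "\<not> ?thesis"
    hence z: "measure circle (?b w) = 0" if "w \<in> C" for w using that by (auto simp: not_less intro: antisym)
    have "E \<subseteq> (\<Union>w\<in>C. ?b w)" using C(3) Es by blast
    hence "measure circle E \<le> measure circle (\<Union>w\<in>C. ?b w)"
      by (rule circle.finite_measure_mono[OF _ sets.finite_UN[OF C(2) bm]])
    also have "\<dots> \<le> (\<Sum>w\<in>C. measure circle (?b w))"
      by (intro circle.finite_measure_subadditive_finite C(2)) (use bm in auto)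
    also have "\<dots> = 0" using z by simp
    finally show False using E(2) by simp
  qed
  then obtain w where w: "w \<in> C" "measure circle (?b w) > 0" by blast
  have "measure circle (?b w) \<le> measure circle (ball w (r w) \<inter> sphere 0 1)"
    by (intro circle.finite_measure_mono bs) auto
  also have "\<dots> < measure circle E" using r(2) w(1) C(1) by auto
  finally have "measure circle (E - ?b w) > 0"
    using circle.finite_measure_Diff[OF E(1) bm[of w]] by auto
  thus ?thesis using that[OF bm[of w]] w(2) by blast
qed

text \<open>Split E in two, keep one half as the last piece and subdivide the other. The d + 1
  pieces will face a quotient spanned by d vectors.\<close>

lemma circle_disjoint_pieces:
  assumes "E \<in> sets circle" "measure circle E > 0"
  shows "\<exists>P :: nat \<Rightarrow> complex set. (\<forall>j\<le>d. P j \<in> sets circle \<and> P j \<subseteq> E \<and> measure circle (P j) > 0) \<and>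
     (\<forall>i\<le>d. \<forall>j\<le>d. i \<noteq> j \<longrightarrow> P i \<inter> P j = {})"
  using assms
proof (induction d arbitrary: E)
  case 0
  thus ?case by (intro exI[of _ "\<lambda>_. E"]) auto
next
  case (Suc d)
  obtain b where b: "b \<in> sets circle" "b \<subseteq> E" "measure circle b > 0" "measure circle (E - b) > 0"
    by (rule circle_split[OF Suc.prems])
  from Suc.IH[OF b(1,3)] obtain P
    where P1: "\<forall>j\<le>d. P j \<in> sets circle \<and> P j \<subseteq> b \<and> measure circle (P j) > 0"
      and P2: "\<forall>i\<le>d. \<forall>j\<le>d. i \<noteq> j \<longrightarrow> P i \<inter> P j = {}"
    by (elim exE conjE)
  note P = P1[rule_format] P2[rule_format]
  define Q where "Q j = (if j = Suc d then E - b else P j)" for j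
  have "Q j \<in> sets circle \<and> Q j \<subseteq> E \<and> measure circle (Q j) > 0" if "j \<le> Suc d" for j
  proof (cases "j = Suc d")
    case True
    hence "Q j = E - b" by (simp add: Q_def)
    thus ?thesis using b(4) sets.Diff[OF Suc.prems(1) b(1)] by auto
  next
    case False
    hence "j \<le> d" using that by linarith
    from P(1)[OF this] show ?thesis using b(2) False by (auto simp: Q_def)
  qed
  moreover have "Q i \<inter> Q j = {}" if ij: "i \<le> Suc d" "j \<le> Suc d" "i \<noteq> j" for i j
  proof -
    consider "i = Suc d" "j \<le> d" | "j = Suc d" "i \<le> d" | "i \<le> d" "j \<le> d" using ij by linarith
    thus ?thesis
    proof cases
      case 1
      thus ?thesis using P(1)[OF 1(2)] by (auto simp: Q_def)
    next
      case 2
      thus ?thesis using P(1)[OF 2(2)] by (auto simp: Q_def)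
    next
      case 3
      thus ?thesis using P(2)[OF 3 ij(3)] by (simp add: Q_def)
    qed
  qed
  ultimately show ?case by (intro exI[of _ Q] conjI allI impI) blast+
qed

lemma pnorm_cong_norm:
  assumes "\<And>z. cmod z = 1 \<Longrightarrow> cmod (f z) = cmod (g z)"
  shows "pnorm p circle f = pnorm p circle g"
proof -
  have "(LINT z|circle. cmod (f z) powr p) = (LINT z|circle. cmod (g z) powr p)"
    by (intro Bochner_Integration.integral_cong) (auto simp: assms)
  thus ?thesis by (simp add: pnorm_def)
qed

text \<open>A (d+1)-dimensional space of trigonometric polynomials concentrated on the set where
  \<open>\<bar>\<alpha>\<bar>\<close> almost attains its essential supremum: its basis approximates the indicators of disjoint
  pieces of that set, relative to their norms.\<close>

lemma concentrated_trig_polynomials: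
  assumes p: "p \<ge> 1" and \<alpha>: "\<alpha> \<in> borel_measurable circle" "AE z in circle. cmod (\<alpha> z) \<le> A"
    and e: "e > 0" "2 * e < A" and sup: "\<not> (AE z in circle. cmod (\<alpha> z) \<le> A - e)"
  obtains G :: "nat \<Rightarrow> complex \<Rightarrow> complex" where "\<And>j. j \<le> d \<Longrightarrow> trig (G j)"
    "\<And>c. \<exists>j\<le>d. c j \<noteq> 0 \<Longrightarrow> 0 < pnorm p circle (\<lambda>z. \<Sum>j\<le>d. c j * G j z) \<and>
      (A - 3 * e) * pnorm p circle (\<lambda>z. \<Sum>j\<le>d. c j * G j z) \<le> pnorm p circle (\<lambda>z. \<alpha> z * (\<Sum>j\<le>d. c j * G j z))"
proof -
  have p0: "p > 0" using p by simp
  have A0: "A > 0" using e by simp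
  note [measurable] = \<alpha>(1)
  define E where "E = {z \<in> space circle. cmod (\<alpha> z) > A - e}"
  have Em: "E \<in> sets circle" unfolding E_def by measurable
  have "measure circle E \<noteq> 0"
  proof
    assume "measure circle E = 0"
    hence "E \<in> null_sets circle" using Em by (auto simp: null_sets_def circle.emeasure_eq_measure)
    hence "AE z in circle. z \<notin> E" by (rule AE_not_in)
    hence "AE z in circle. cmod (\<alpha> z) \<le> A - e" using AE_space by eventually_elim (auto simp: E_def not_less)
    thus False using sup by simp
  qed
  hence E0: "measure circle E > 0" by (simp add: less_le)
  from circle_disjoint_pieces[OF Em E0, of d] obtain P :: "nat \<Rightarrow> complex set"
    where P': "\<forall>j\<le>d. P j \<in> sets circle \<and> P j \<subseteq> E \<and> measure circle (P j) > 0"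
      and P'': "\<forall>i\<le>d. \<forall>j\<le>d. i \<noteq> j \<longrightarrow> P i \<inter> P j = {}"
    by (elim exE conjE)
  have P: "P j \<in> sets circle" "P j \<subseteq> E" "measure circle (P j) > 0" if "j \<le> d" for j
    using P' that by auto
  note disj = P''[rule_format]
  define X :: "nat \<Rightarrow> complex \<Rightarrow> complex" where "X j = indicator (P j)" for j
  have XL: "X j \<in> Lp_fun p circle" if "j \<le> d" for j
  proof (rule Lp_circle_bounded(1)[OF _ _ p0])
    show "X j \<in> borel_measurable circle" unfolding X_def by (rule borel_measurable_indicator[OF P(1)[OF that]])
    show "cmod (X j z) \<le> 1" for z by (simp add: X_def indicator_def)
  qed
  have Xn: "pnorm p circle (X j) > 0" if "j \<le> d" for j
  proof -
    have "(LINT z|circle. cmod (X j z) powr p) = (LINT z|circle. indicator (P j) z)"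
      using p0 by (intro Bochner_Integration.integral_cong) (auto simp: X_def indicator_def)
    also have "\<dots> = measure circle (P j)" using sets.sets_into_space[OF P(1)[OF that]] by (simp add: Int_absorb2)
    finally show ?thesis using P(3)[OF that] by (simp add: pnorm_def)
  qed
  \<comment> \<open>Multiplication by \<alpha> enlarges norms at most by A, so a relative error
    \<eta> costs A * \<eta> = e. The factor 1/(d + 1) lets the errors of the d + 1 basis functions
    add up to \<eta>.\<close>
  define \<eta> where "\<eta> = e / A"
  have \<eta>: "\<eta> > 0" "\<eta> < 1" "A * \<eta> = e" using e A0 by (auto simp: \<eta>_def)
  have "\<exists>g. trig g \<and> pnorm p circle (\<lambda>z. X j z - g z) < \<eta> * pnorm p circle (X j) / real (d + 1)" if "j \<le> d" for j
  proof -
    have "\<eta> * pnorm p circle (X j) / real (d + 1) > 0" using Xn[OF that] \<eta>(1) by simp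
    thus ?thesis by (rule trig_dense_Lp[OF p XL[OF that]]) blast
  qed
  then obtain G where G: "\<And>j. j \<le> d \<Longrightarrow> trig (G j)"
    "\<And>j. j \<le> d \<Longrightarrow> pnorm p circle (\<lambda>z. X j z - G j z) < \<eta> * pnorm p circle (X j) / real (d + 1)"
    by metis
  show ?thesis
  proof (rule that[OF G(1)])
    fix c :: "nat \<Rightarrow> complex" assume "\<exists>j\<le>d. c j \<noteq> 0"
    then obtain j0 where j0: "j0 \<le> d" "c j0 \<noteq> 0" by blast
    \<comment> \<open>h is the combination of indicators that f imitates. Three losses of size e
      follow: |\<alpha>| > A - e on E, the error of replacing h by f under \<alpha>, and the factor
      1 + \<eta> between the norms of f and h.\<close>
    define h f where "h z = (\<Sum>j\<le>d. c j * X j z)" and "f z = (\<Sum>j\<le>d. c j * G j z)" for z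
    have hL: "h \<in> Lp_fun p circle"
      unfolding h_def using pnorm_sum[OF p, of "{..d}" "\<lambda>j z. c j * X j z" circle] XL by (auto intro: Lp_fun_cmult)
    have fT: "trig f" unfolding f_def by (intro trig_sum trig_cmult G) auto
    have fL: "f \<in> Lp_fun p circle" by (rule trig_Lp[OF fT p0])
    have h_piece: "h z = c j" if "j \<le> d" "z \<in> P j" for j z
    proof -
      have "h z = (\<Sum>i\<le>d. if i = j then c j else 0)"
        unfolding h_def X_def using disj[of _ j] that by (intro sum.cong) (auto simp: indicator_def)
      thus ?thesis using that(1) by simp
    qed
    \<comment> \<open>Because the pieces are disjoint, c j * X j is dominated pointwise by h. This
      makes the approximation error relative to the norm of h, uniformly in c.\<close>
    have cX: "cmod (c j) * pnorm p circle (X j) \<le> pnorm p circle h" if "j \<le> d" for j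
    proof -
      have "pnorm p circle (\<lambda>z. c j * X j z) \<le> 1 * pnorm p circle h"
      proof (rule Lp_fun_mono(2)[OF hL])
        show "(\<lambda>z. c j * X j z) \<in> borel_measurable circle" 
          by (rule Lp_fun_measurable[OF Lp_fun_cmult[OF XL[OF that]]])
        show "AE z in circle. cmod (c j * X j z) \<le> 1 * cmod (h z)"
          using h_piece[OF that] by (intro AE_I2) (auto simp: X_def indicator_def)
      qed (use p0 in auto)
      thus ?thesis by (simp add: pnorm_cmult[OF p0])
    qed
    have h0: "pnorm p circle h > 0"
      using cX[OF j0(1)] Xn[OF j0(1)] j0(2) by (meson less_le_trans mult_pos_pos zero_less_norm_iff)
    have dL: "(\<lambda>z. h z - f z) \<in> Lp_fun p circle" by (rule pnorm_triangle_diff(1)[OF p hL fL])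
    have d: "pnorm p circle (\<lambda>z. h z - f z) \<le> \<eta> * pnorm p circle h"
    proof -
      have cd: "(\<lambda>z. c j * (X j z - G j z)) \<in> Lp_fun p circle" if "j \<le> d" for j
        by (intro Lp_fun_cmult pnorm_triangle_diff(1)[OF p] XL trig_Lp[OF G(1) p0] that)
      have "(\<lambda>z. h z - f z) = (\<lambda>z. \<Sum>j\<le>d. c j * (X j z - G j z))"
        by (simp add: h_def f_def sum_subtractf right_diff_distrib)
      hence "pnorm p circle (\<lambda>z. h z - f z) \<le> (\<Sum>j\<le>d. pnorm p circle (\<lambda>z. c j * (X j z - G j z)))"
        using pnorm_sum[OF p, of "{..d}" "\<lambda>j z. c j * (X j z - G j z)" circle] cd by simp
      also have "\<dots> \<le> (\<Sum>j\<le>d. \<eta> * pnorm p circle h / real (d + 1))"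
      proof (rule sum_mono)
        fix j assume "j \<in> {..d}"
        hence j: "j \<le> d" by simp
        have "pnorm p circle (\<lambda>z. c j * (X j z - G j z)) = cmod (c j) * pnorm p circle (\<lambda>z. X j z - G j z)"
          by (rule pnorm_cmult[OF p0])
        also have "\<dots> \<le> cmod (c j) * (\<eta> * pnorm p circle (X j) / real (d + 1))"
          using G(2)[OF j] by (intro mult_left_mono) auto
        also have "\<dots> = \<eta> * (cmod (c j) * pnorm p circle (X j)) / real (d + 1)" by simp
        also have "\<dots> \<le> \<eta> * pnorm p circle h / real (d + 1)"
          using \<eta> by (intro divide_right_mono mult_left_mono cX[OF j]) auto
        finally show "pnorm p circle (\<lambda>z. c j * (X j z - G j z)) \<le> \<eta> * pnorm p circle h / real (d + 1)" .
      qed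
      also have "\<dots> = \<eta> * pnorm p circle h" by simp
      finally show ?thesis .
    qed
    have mulL: "(\<lambda>z. \<alpha> z * u z) \<in> Lp_fun p circle \<and> pnorm p circle (\<lambda>z. \<alpha> z * u z) \<le> A * pnorm p circle u" if "u \<in> Lp_fun p circle" for u
    proof -
      note [measurable] = Lp_fun_measurable[OF that]
      have m: "(\<lambda>z. \<alpha> z * u z) \<in> borel_measurable circle" by measurable
      have "AE z in circle. cmod (\<alpha> z * u z) \<le> A * cmod (u z)"
        using \<alpha>(2) by eventually_elim (auto simp: norm_mult intro: mult_right_mono)
      from Lp_fun_mono[OF that m this p0] A0 show ?thesis by auto
    qed
    have low: "(A - e) * pnorm p circle h \<le> pnorm p circle (\<lambda>z. \<alpha> z * h z)"
    proof -
      have Ae: "A - e > 0" using e by simp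
      have "pnorm p circle h \<le> 1 / (A - e) * pnorm p circle (\<lambda>z. \<alpha> z * h z)"
      proof (rule Lp_fun_mono(2))
        show "(\<lambda>z. \<alpha> z * h z) \<in> Lp_fun p circle" using mulL[OF hL] by simp
        show "h \<in> borel_measurable circle" by (rule Lp_fun_measurable[OF hL])
        show "AE z in circle. cmod (h z) \<le> 1 / (A - e) * cmod (\<alpha> z * h z)"
        proof (rule AE_I2)
          fix z
          show "cmod (h z) \<le> 1 / (A - e) * cmod (\<alpha> z * h z)"
          proof (cases "\<exists>j\<le>d. z \<in> P j")
            case True
            then obtain j where "j \<le> d" "z \<in> P j" by blast
            hence "A - e \<le> cmod (\<alpha> z)" using P(2)[of j] by (auto simp: E_def)
            hence "(A - e) * cmod (h z) \<le> cmod (\<alpha> z) * cmod (h z)" by (intro mult_right_mono) auto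
            thus ?thesis using Ae by (simp add: norm_mult field_simps)
          next
            case False
            hence "h z = 0" unfolding h_def X_def by (intro sum.neutral) (auto simp: indicator_def)
            thus ?thesis by simp
          qed
        qed
      qed (use p0 Ae in auto)
      thus ?thesis using Ae by (simp add: field_simps)
    qed
    have up: "(A - 2 * e) * pnorm p circle h \<le> pnorm p circle (\<lambda>z. \<alpha> z * f z)"
    proof -
      have "(\<lambda>z. \<alpha> z * h z) = (\<lambda>z. \<alpha> z * f z + \<alpha> z * (h z - f z))" by (simp add: algebra_simps)
      hence "pnorm p circle (\<lambda>z. \<alpha> z * h z) \<le> pnorm p circle (\<lambda>z. \<alpha> z * f z) + pnorm p circle (\<lambda>z. \<alpha> z * (h z - f z))"
        using pnorm_triangle(2)[OF p, of "\<lambda>z. \<alpha> z * f z" circle "\<lambda>z. \<alpha> z * (h z - f z)"] mulL[OF fL] mulL[OF dL] by simp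
      also have "pnorm p circle (\<lambda>z. \<alpha> z * (h z - f z)) \<le> A * (\<eta> * pnorm p circle h)"
        using mulL[OF dL] d A0 by (meson mult_left_mono order_trans less_imp_le)
      also have "A * (\<eta> * pnorm p circle h) = e * pnorm p circle h" using \<eta>(3) by (simp flip: mult.assoc)
      finally show ?thesis using low by (simp add: algebra_simps)
    qed
    have fh: "pnorm p circle f \<le> (1 + \<eta>) * pnorm p circle h"
      using pnorm_triangle_diff(2)[OF p hL dL] d by (simp add: algebra_simps)
    have hf: "pnorm p circle h \<le> pnorm p circle f + pnorm p circle (\<lambda>z. h z - f z)"
      using pnorm_triangle(2)[OF p fL dL] by simp
    have f0: "0 < pnorm p circle f"
    proof -
      have "\<eta> * pnorm p circle h < 1 * pnorm p circle h" using \<eta>(2) h0 by (intro mult_strict_right_mono)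
      thus ?thesis using hf d by simp
    qed
    have "(A - 3 * e) * pnorm p circle f \<le> (A - 2 * e) * pnorm p circle h"
    proof (cases "A - 3 * e \<le> 0")
      \<comment> \<open>Only 2 * e < A is known, so A - 3 * e may be nonpositive and must not
        multiply an upper bound for the norm of f.\<close>
      case True
      hence "(A - 3 * e) * pnorm p circle f \<le> 0" using f0 by (simp add: mult_nonpos_nonneg)
      also have "\<dots> \<le> (A - 2 * e) * pnorm p circle h" using h0 e by simp
      finally show ?thesis .
    next
      case False
      hence "(A - 3 * e) * pnorm p circle f \<le> (A - 3 * e) * ((1 + \<eta>) * pnorm p circle h)"
        by (intro mult_left_mono fh) auto
      also have "\<dots> = ((A - 3 * e) * (1 + \<eta>)) * pnorm p circle h" by simp
      also have "\<dots> \<le> (A - 2 * e) * pnorm p circle h"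
      proof (rule mult_right_mono)
        have "(A - 3 * e) * (1 + \<eta>) = A - 3 * e + A * \<eta> - 3 * e * \<eta>" by (simp add: algebra_simps)
        also have "\<dots> \<le> A - 2 * e" using \<eta> e by simp
        finally show "(A - 3 * e) * (1 + \<eta>) \<le> A - 2 * e" .
      qed simp
      finally show ?thesis .
    qed
    with up f0 show "0 < pnorm p circle (\<lambda>z. \<Sum>j\<le>d. c j * G j z) \<and>
      (A - 3 * e) * pnorm p circle (\<lambda>z. \<Sum>j\<le>d. c j * G j z) \<le> pnorm p circle (\<lambda>z. \<alpha> z * (\<Sum>j\<le>d. c j * G j z))"
      unfolding f_def[symmetric] by linarith
  qed
qed

text \<open>Modulo M each \<open>F j\<close> equals some \<open>b j\<close> in the span of B. These
  are \<open>card B + 1\<close> vectors in a space spanned by \<open>card B\<close>, so some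
  nontrivial combination of the \<open>b j\<close> vanishes, and the same combination of the
  \<open>F j\<close> lies in M.\<close>

lemma finite_codim_combination:
  assumes M: "L0.subspace M" and B: "finite B" "\<forall>f\<in>X. \<exists>b\<in>L0.span B. f - b \<in> M" and F: "\<And>j. j \<le> card B \<Longrightarrow> F j \<in> X"
  obtains c where "\<exists>j\<le>card B. c j \<noteq> 0" "(\<Sum>j\<le>card B. cscale (c j) (F j)) \<in> M"
proof -
  define d where "d = card B"
  have "\<forall>j\<in>{..d}. \<exists>b. b \<in> L0.span B \<and> F j - b \<in> M"
  proof
    fix j assume "j \<in> {..d}"
    hence "F j \<in> X" using F by (simp add: d_def)
    thus "\<exists>b. b \<in> L0.span B \<and> F j - b \<in> M" using B(2) by blast
  qed
  from bchoice[OF this] obtain b where b': "\<forall>j\<in>{..d}. b j \<in> L0.span B \<and> F j - b j \<in> M" ..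
  have b: "b j \<in> L0.span B" "F j - b j \<in> M" if "j \<le> d" for j
    using b' that by auto
  have "\<exists>c. (\<exists>j\<le>d. c j \<noteq> 0) \<and> (\<Sum>j\<le>d. cscale (c j) (b j)) = 0"
  proof (cases "inj_on b {..d}")
    case True
    have "L0.dependent (b ` {..d})"
    proof (rule ccontr)
      assume "\<not> L0.dependent (b ` {..d})"
      from L0.independent_span_bound[OF B(1) this] b(1) have "card (b ` {..d}) \<le> d" by (auto simp: d_def)
      thus False using card_image[OF True] by simp
    qed
    then obtain u v where u: "v \<in> b ` {..d}" "u v \<noteq> 0" "(\<Sum>v\<in>b ` {..d}. cscale (u v) v) = 0"
      unfolding L0.dependent_finite[OF finite_imageI[OF finite_atMost]] by blast
    have "(\<Sum>j\<le>d. cscale (u (b j)) (b j)) = 0" using u(3) by (simp add: sum.reindex[OF True])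
    thus ?thesis using u(1,2) by (intro exI[of _ "\<lambda>j. u (b j)"]) auto
  next
    \<comment> \<open>Linear dependence of the set of all \<open>b j\<close> does not register
      repetitions, so two equal vectors are cancelled by hand with coefficients 1 and -1.\<close>
    case False
    then obtain i j where ij: "i \<le> d" "j \<le> d" "i \<noteq> j" "b i = b j" by (auto simp: inj_on_def)
    define c :: "nat \<Rightarrow> complex" where "c k = (if k = i then 1 else if k = j then - 1 else 0)" for k
    have "(\<Sum>k\<le>d. cscale (c k) (b k)) = (\<Sum>k\<in>{i, j}. cscale (c k) (b k))"
      by (rule sum.mono_neutral_right) (use ij in \<open>auto simp: c_def L0.scale_zero_left\<close>)
    also have "\<dots> = 0" using ij by (simp add: c_def L0.scale_minus_left)
    finally show ?thesis using ij(1) by (intro exI[of _ c]) (auto simp: c_def)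
  qed
  then obtain c where c: "\<exists>j\<le>d. c j \<noteq> 0" "(\<Sum>j\<le>d. cscale (c j) (b j)) = 0" by blast
  have "(\<Sum>j\<le>d. cscale (c j) (F j)) = (\<Sum>j\<le>d. cscale (c j) (F j - b j)) + (\<Sum>j\<le>d. cscale (c j) (b j))"
    by (simp add: L0.scale_right_diff_distrib sum_subtractf)
  also have "\<dots> \<in> M"
    unfolding c(2) add_0_right by (intro L0.subspace_sum M L0.subspace_scale b(2)) auto
  finally show ?thesis using that c(1) unfolding d_def by blast
qed

text \<open>The loss 4 * e is 3 * e from \<open>concentrated_trig_polynomials\<close> and one e from
  replacing T(a) f by a * f on \<open>Hp_shift p N\<close>.\<close>

lemma op_norm_toeplitz_ge:
  assumes "p > 1" "a \<in> C_plus_Hinf" and M: "M \<subseteq> Hp (ennreal p)" "L0.subspace M" "finite_codim (Hp (ennreal p)) M"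
    and e: "e > 0" "2 * e < Lp_norm \<infinity> a"
  shows "ennreal (Lp_norm \<infinity> a - 4 * e) \<le> op_norm M (nrm p) (nrm p) (toeplitz a)"
proof -
  have p0: "p > 0" "p \<ge> 1" using assms by auto
  note aL = C_plus_Hinf_Linf[OF assms(2)]
  define A where "A = Lp_norm \<infinity> a"
  obtain \<alpha> where \<alpha>: "\<alpha> \<in> borel_measurable circle" "a = abs_L0 \<alpha>" "AE z in circle. cmod (\<alpha> z) \<le> A"
    "\<And>c. c \<ge> 0 \<Longrightarrow> AE z in circle. cmod (\<alpha> z) \<le> c \<Longrightarrow> A \<le> c"
    unfolding A_def by (rule Linf_cases[OF aL]) blast
  have sup: "\<not> (AE z in circle. cmod (\<alpha> z) \<le> A - e)" using \<alpha>(4)[of "A - e"] e by (auto simp: A_def)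
  obtain B where B: "finite B" "\<forall>f\<in>Hp (ennreal p). \<exists>b\<in>L0.span B. f - b \<in> M"
    using M(3) unfolding finite_codim_def by blast
  define d where "d = card B"
  obtain N where N: "\<And>f. f \<in> Hp_shift p N \<Longrightarrow> nrm p (toeplitz a f - a * f) \<le> e * nrm p f"
    by (rule toeplitz_shift[OF assms(1,2) e(1)]) blast
  obtain G :: "nat \<Rightarrow> complex \<Rightarrow> complex" where G: "\<And>j. j \<le> d \<Longrightarrow> trig (G j)"
    "\<And>c. \<exists>j\<le>d. c j \<noteq> 0 \<Longrightarrow> 0 < pnorm p circle (\<lambda>z. \<Sum>j\<le>d. c j * G j z) \<and>
      (A - 3 * e) * pnorm p circle (\<lambda>z. \<Sum>j\<le>d. c j * G j z) \<le> pnorm p circle (\<lambda>z. \<alpha> z * (\<Sum>j\<le>d. c j * G j z))"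
    by (rule concentrated_trig_polynomials[OF p0(2) \<alpha>(1,3) e(1) _ sup, of d]) (use e in \<open>auto simp: A_def\<close>)
  have "\<exists>n. \<forall>k < - int n. fcoef (G j) k = 0" if "j \<le> d" for j
    by (rule trig_fcoef_bounded_below[OF G(1)[OF that]]) blast
  then obtain n where n: "\<And>j k. j \<le> d \<Longrightarrow> k < - int (n j) \<Longrightarrow> fcoef (G j) k = 0" by metis
  \<comment> \<open>The sum of the \<open>n j\<close> exceeds each of them, so one shift moves every
    \<open>G j\<close> into \<open>Hp_shift p N\<close>. A common shift matters: it is a unimodular
    factor of the whole combination, so both norms are those of the unshifted one.\<close>
  define L where "L = int N + int (\<Sum>j\<le>d. n j)"
  define g where "g j z = zchar L z * G j z" for j z
  have gc: "continuous_on (sphere 0 1) (g j)" if "j \<le> d" for j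
    unfolding g_def by (intro continuous_intros continuous_on_zchar trig_continuous G that)
  have gm: "g j \<in> borel_measurable circle" if "j \<le> d" for j by (rule measurable_circle_continuous[OF gc[OF that]])
  define F where "F j = abs_L0 (g j)" for j
  have FS: "F j \<in> Hp_shift p N" if j: "j \<le> d" for j
  proof -
    have "F j \<in> Lp (ennreal p)" unfolding F_def by (rule Lp_fun_abs_L0(1)[OF Lp_circle_continuous[OF gc[OF j] p0(1)] p0(1)])
    moreover have "fourier (F j) k = 0" if "k < int N" for k
    proof -
      have "n j \<le> (\<Sum>j\<le>d. n j)" using j by (intro member_le_sum) auto
      hence "k - L < - int (n j)" using that unfolding L_def by linarith
      thus ?thesis using n[OF j] unfolding F_def fourier_abs_L0[OF gm[OF j]] g_def fcoef_zchar_mult by blast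
    qed
    ultimately show ?thesis by (auto simp: Hp_shift_def Hp_def)
  qed
  have FH: "F j \<in> Hp (ennreal p)" if "j \<le> d" for j using FS[OF that] by (simp add: Hp_shift_def)
  obtain c where c: "\<exists>j\<le>d. c j \<noteq> 0" "(\<Sum>j\<le>d. cscale (c j) (F j)) \<in> M"
    unfolding d_def by (rule finite_codim_combination[OF M(2) B FH[unfolded d_def]])
  define f where "f = (\<Sum>j\<le>d. cscale (c j) (F j))"
  let ?u = "\<lambda>z. \<Sum>j\<le>d. c j * g j z" and ?v = "\<lambda>z. \<Sum>j\<le>d. c j * G j z"
  have fS: "f \<in> Hp_shift p N"
    unfolding f_def
    by (intro L0.subspace_sum[OF subspace_Hp_shift[OF p0(2)]] L0.subspace_scale[OF subspace_Hp_shift[OF p0(2)]] FS) simp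
  have fH: "f \<in> Hp (ennreal p)" using fS by (simp add: Hp_shift_def)
  have um: "?u \<in> borel_measurable circle" by (intro measurable_circle_continuous continuous_intros gc) auto
  have cgm: "(\<lambda>z. c j * g j z) \<in> borel_measurable circle" if "j \<le> d" for j
    by (intro measurable_circle_continuous continuous_intros gc that)
  have f_eq: "f = abs_L0 ?u"
    unfolding f_def F_def by (subst abs_L0_sum[symmetric]) (auto simp: cgm abs_L0_cscale[OF gm])
  have uv: "?u z = zchar L z * ?v z" for z by (simp add: g_def sum_distrib_left mult_ac)
  have nf: "nrm p f = pnorm p circle ?v"
  proof -
    have "nrm p f = pnorm p circle ?u" unfolding f_eq by (rule Lp_norm_abs_L0[OF um p0(1)])
    also have "\<dots> = pnorm p circle ?v" unfolding uv by (rule pnorm_cong_norm) (simp add: norm_mult)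
    finally show ?thesis .
  qed
  have naf: "nrm p (a * f) = pnorm p circle (\<lambda>z. \<alpha> z * ?v z)"
  proof -
    have "(\<lambda>z. \<alpha> z * ?u z) \<in> borel_measurable circle" using \<alpha>(1) um by measurable
    hence "nrm p (a * f) = pnorm p circle (\<lambda>z. \<alpha> z * ?u z)"
      unfolding f_eq \<alpha>(2) abs_L0_mult[OF \<alpha>(1) um] by (rule Lp_norm_abs_L0[OF _ p0(1)])
    also have "\<dots> = pnorm p circle (\<lambda>z. \<alpha> z * ?v z)"
      unfolding uv by (rule pnorm_cong_norm) (simp add: norm_mult)
    finally show ?thesis .
  qed
  have f0: "nrm p f > 0" and big: "(A - 3 * e) * nrm p f \<le> nrm p (a * f)"
    unfolding nf naf using G(2)[OF c(1)] by auto
  have Tf: "(A - 4 * e) * nrm p f \<le> nrm p (toeplitz a f)"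
    using nrm_toeplitz_shift_le(2)[OF assms(1) aL fH N[OF fS]] big by (simp add: algebra_simps)
  define f1 where "f1 = cscale (of_real (1 / nrm p f)) f"
  have f1M: "f1 \<in> M" unfolding f1_def using c(2) M(2) by (intro L0.subspace_scale) (auto simp: f_def)
  have f1n: "nrm p f1 = 1" unfolding f1_def using f0 by (simp add: nrm_cscale[OF p0(1) HpD(1)[OF fH]] norm_divide)
  have Tf1: "A - 4 * e \<le> nrm p (toeplitz a f1)"
  proof -
    obtain lin: "linear_map (Hp (ennreal p)) (Hp (ennreal p)) (toeplitz a)" by (rule toeplitz_facts[OF assms(1) aL])
    have "toeplitz a f1 = cscale (of_real (1 / nrm p f)) (toeplitz a f)" "toeplitz a f \<in> Lp (ennreal p)"
      using lin fH by (auto simp: linear_map_def f1_def intro: HpD(1))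
    hence "nrm p (toeplitz a f1) = nrm p (toeplitz a f) / nrm p f" using f0 by (simp add: nrm_cscale[OF p0(1)] norm_divide)
    thus ?thesis using Tf f0 by (simp add: pos_le_divide_eq)
  qed
  have "ennreal (A - 4 * e) \<le> ennreal (nrm p (toeplitz a f1))" by (rule ennreal_leI[OF Tf1])
  also have "\<dots> \<le> op_norm M (nrm p) (nrm p) (toeplitz a)"
    unfolding op_norm_def by (rule SUP_upper) (use f1M f1n in auto)
  finally show ?thesis by (simp add: A_def)
qed

lemma m_norm_toeplitz_ge:
  assumes "p > 1" "a \<in> C_plus_Hinf"
  shows "ennreal (Lp_norm \<infinity> a) \<le> m_norm (Hp (ennreal p)) (nrm p) (nrm p) (toeplitz a)"
  unfolding m_norm_def
proof (rule INF_greatest)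
  fix M assume "M \<in> {M. M \<subseteq> Hp (ennreal p) \<and> L0.subspace M \<and> closedin (norm_topology (Hp (ennreal p)) (nrm p)) M \<and> finite_codim (Hp (ennreal p)) M}"
  hence M: "M \<subseteq> Hp (ennreal p)" "L0.subspace M" "finite_codim (Hp (ennreal p)) M" by auto
  show "ennreal (Lp_norm \<infinity> a) \<le> op_norm M (nrm p) (nrm p) (toeplitz a)"
  proof (cases "Lp_norm \<infinity> a > 0")
    case True
    show ?thesis
    proof (rule ennreal_le_epsilon)
      fix \<epsilon> :: real assume \<epsilon>: "\<epsilon> > 0"
      \<comment> \<open>\<epsilon>/4 absorbs the loss 4 * e. A quarter of the norm keeps 2 * e below
        it and the difference nonnegative, so that \<open>ennreal\<close> splits over the
        sum.\<close>
      define e where "e = min (\<epsilon> / 4) (Lp_norm \<infinity> a / 4)"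
      have e: "e > 0" "2 * e < Lp_norm \<infinity> a" "4 * e \<le> \<epsilon>" "4 * e \<le> Lp_norm \<infinity> a" using \<epsilon> True by (auto simp: e_def min_def)
      have "ennreal (Lp_norm \<infinity> a) \<le> ennreal ((Lp_norm \<infinity> a - 4 * e) + \<epsilon>)" using e by (intro ennreal_leI) simp
      also have "\<dots> = ennreal (Lp_norm \<infinity> a - 4 * e) + ennreal \<epsilon>" using e \<epsilon> by (intro ennreal_plus) auto
      also have "\<dots> \<le> op_norm M (nrm p) (nrm p) (toeplitz a) + ennreal \<epsilon>"
        by (intro add_right_mono op_norm_toeplitz_ge assms M e)
      finally show "ennreal (Lp_norm \<infinity> a) \<le> op_norm M (nrm p) (nrm p) (toeplitz a) + ennreal \<epsilon>" .
    qed
  qed (simp add: ennreal_neg)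
qed

theorem theorem4p1:
  fixes p :: real and a :: L0
  assumes "1 < p" and "a \<in> C_plus_Hinf"
  shows "m_norm (Hp (ennreal p)) (Lp_norm (ennreal p)) (Lp_norm (ennreal p)) (toeplitz a)
           = ennreal (Lp_norm \<infinity> a)
       \<and> essential_norm (Hp (ennreal p)) (Lp_norm (ennreal p))
           (Hp (ennreal p)) (Lp_norm (ennreal p)) (toeplitz a)
           \<le> ennreal (2 powr \<bar>1 - 2 / p\<bar> * Lp_norm \<infinity> a)"
  using m_norm_toeplitz_le[OF assms] m_norm_toeplitz_ge[OF assms] essential_norm_toeplitz_le[OF assms]
  by (auto intro: antisym)

end
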